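(* Let $A$ be a homotopy unital associative algebra (a $uA_\infty$-algebra) and let $V$ be a chain complex. Suppose given a strong deformation retract: chain maps $i:V\to A$ and $p:A\to V$ and a degree $1$ map $h:A\to A$ with $p\circ i=\mathrm{id}_V$ and $d_Ah+hd_A=\mathrm{id}_A-i\circ p$. Then there is a natural $uA_\infty$-algebra structure on $V$, and a natural extension of $i$ to an $\infty$-morphism of $uA_\infty$-algebras $V\rightsquigarrow A$ (that is, an $\infty$-morphism whose component $f_1^\emptyset:V\to A$ is $i$).
   Context: $\mathbb K$ is a field of characteristic $0$, gradings are homological, the Koszul sign rule is used. $\mathcal F(V)$, $\mathcal F^c(V)$: free operad and (conilpotent) cofree cooperad, superscript $(n)$ the part with $n$ vertices; $I$ the unit operad; $\circ$ the composite product of $\mathbb S$-modules; $M\circ_{(1)}N$ (also $M\otimes N$) trees with one vertex in $M$ and one in $N$ above; $\Delta_{(1)}$ the infinitesimal decomposition map; $f\circ'g$ applies $g$ to one upper factor, summed over factors; $s^{\pm1}$ (de)suspension; $\mathcal C(A)=\bigoplus_n\mathcal C(n)\otimes_{\mathbb S_n}A^{\otimes n}$. $u\mathcal As=\mathcal F(W)/(R)$ is the operad of unital associative algebras: $W$ is spanned by a nullary $\bullet$ and a binary $\mu$ without symmetry, both of degree $0$; $R$ is spanned by $\mu\circ(\mu,\mathrm{id})-\mu\circ(\mathrm{id},\mu)$, $\mu\circ(\bullet,\mathrm{id})-|$, $\mu\circ(\mathrm{id},\bullet)-|$. $\mathrm qR$ is the projection of $R$ on $\mathcal F(W)^{(2)}$.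 The curved cooperad $u\mathcal As^{\text{!`}}=(\mathcal C(sW,s^2\mathrm qR),0,\theta)$: $\mathcal C(sW,s^2\mathrm qR)$ is the largest sub-cooperad of $\mathcal F^c(sW)$ whose projection to $\mathcal F^c(sW)^{(2)}/s^2\mathrm qR$ vanishes, and $\theta$ (degree $-2$, to $I$) factors through $s^2\mathrm qR$, sends $s^2(\mu\circ(\bullet,\mathrm{id}))$ and $s^2(\mu\circ(\mathrm{id},\bullet))$ to $-|$ and the associativity relation to $0$. A $uA_\infty$-algebra is an algebra over the dg operad $uA_\infty:=\Omega\,u\mathcal As^{\text{!`}}=(\mathcal F(s^{-1}\overline{u\mathcal As^{\text{!`}}}),d_0-d_2)$, with $d_0$, $d_2$ the derivations extending $s\theta:s^{-1}\overline{u\mathcal As^{\text{!`}}}\to I$ and $s^{-1}\overline\Delta_{(1)}$. Concretely it is a chain complex $A$ with a family of maps $\mu_n^S:A^{\otimes(n-|S|)}\to A$ of degree $n-2+|S|$, $n\ge2$, $S\subset\{1,\dots,n\}$, and $\mu_1^{\{1\}}:\mathbb K\to A$, satisfying $\partial\mu_2^{\{1\}}=\mu_2^\emptyset(\mu_1^{\{1\}},-)-\mathrm{id}_A$, $\partial\mu_2^{\{2\}}=\mu_2^\emptyset(-,\mu_1^{\{1\}})-\mathrm{id}_A$, and for the other $(n,S)$ the signed $A_\infty$-type relations encoded by $d_2$. One depicts $\mu_n^S$ as a corolla with $n$ inputs, with a "cork" on each input in $S$. $\infty$-morphisms: let $\iota:u\mathcal As^{\text{!`}}\to\overline{u\mathcal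 As^{\text{!`}}}\cong s^{-1}\overline{u\mathcal As^{\text{!`}}}\rightarrowtail uA_\infty$. For a $uA_\infty$-algebra $(A,\gamma_A)$ let $\mathrm B_\iota A=(u\mathcal As^{\text{!`}}(A),d_1+d_2)$, $d_1=\mathrm{id}\circ'd_A$, $d_2:u\mathcal As^{\text{!`}}(A)\xrightarrow{\Delta_{(1)}\circ\mathrm{id}}(u\mathcal As^{\text{!`}}\circ_{(1)}u\mathcal As^{\text{!`}})(A)\xrightarrow{(\mathrm{id}\otimes\iota)\circ\mathrm{id}}(u\mathcal As^{\text{!`}}\circ uA_\infty)(A)\xrightarrow{\mathrm{id}\circ\gamma_A}u\mathcal As^{\text{!`}}(A)$. An $\infty$-morphism $A\rightsquigarrow B$ is a morphism of $u\mathcal As^{\text{!`}}$-coalgebras $\mathrm B_\iota A\to\mathrm B_\iota B$ commuting with the predifferentials; its component $f_1^\emptyset$ is $A=I(A)\rightarrowtail u\mathcal As^{\text{!`}}(A)\to u\mathcal As^{\text{!`}}(B)\twoheadrightarrow B$. On the word "natural": the structure and the extension are realised by explicit formulae in terms of $i$, $p$, $h$ and the operations of $A$. Namely $\mu_n^S(V)$ is a sum, with signs depending only on the tree, over planar rooted trees with $n$ leaves, with a cork above the $j$th leaf for $j\in S$, each cork being labelled "connected" or "disconnected"; each vertex is assigned the operation of $A$ with as many inputs as the vertex and with corks at the positions of its connected corks, a disconnected cork is the operation $\mu_1^{\{1\}}(A)$ followed by $h$, the other internal edges are assigned $h$, the uncorked leaves $i$ and the root $p$ (with $\mu_1^{\{1\}}(V)=p\circ\mu_1^{\{1\}}(A)$).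 The higher components of the $\infty$-morphism are given by the same sums with $h$ instead of $p$ at the root.
   Formalization: The tree formulae with h itself can fail for general h; they are asserted for h when h∘i=0 and h∘h=0, and for every h with h replaced by h'∘d_A∘h', h'=(id−ip)h(id−ip). Existence of the structure and of the extension of i holds for every h. Higher components carry an overall minus sign. *)

theory Defs
  imports Complex_Main "HOL-Library.Poly_Mapping"
begin

section \<open>Chain complexes\<close>

text \<open>
  A chain complex lives on a whole type; the grading is given by the projections
  \<open>proj X n\<close> onto the components \<open>X\<^sub>n\<close>, \<open>n \<in> \<int>\<close>.
\<close>

record ('k, 'a) cplx =
  scl :: "'k \<Rightarrow> 'a \<Rightarrow> 'a"
  proj :: "int \<Rightarrow> 'a \<Rightarrow> 'a"
  dif :: "'a \<Rightarrow> 'a"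

definition linear_map :: "('k::field_char_0, 'a::ab_group_add) cplx \<Rightarrow> ('k, 'b::ab_group_add) cplx
    \<Rightarrow> ('a \<Rightarrow> 'b) \<Rightarrow> bool" where
  "linear_map X Y f \<longleftrightarrow> Vector_Spaces.linear (scl X) (scl Y) f"

definition degree_map :: "('k::field_char_0, 'a::ab_group_add) cplx \<Rightarrow> ('k, 'b::ab_group_add) cplx
    \<Rightarrow> int \<Rightarrow> ('a \<Rightarrow> 'b) \<Rightarrow> bool" where
  "degree_map X Y k f \<longleftrightarrow>
     linear_map X Y f \<and> (\<forall>n x. proj Y (n + k) (f x) = f (proj X n x))"

definition chain_complex :: "('k::field_char_0, 'a::ab_group_add) cplx \<Rightarrow> bool" where
  "chain_complex X \<longleftrightarrow>
     vector_space (scl X) \<and>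
     (\<forall>n. linear_map X X (proj X n)) \<and>
     (\<forall>m n x. proj X m (proj X n x) = (if m = n then proj X n x else 0)) \<and>
     (\<forall>x. finite {n. proj X n x \<noteq> 0} \<and> x = (\<Sum>n | proj X n x \<noteq> 0. proj X n x)) \<and>
     degree_map X X (-1) (dif X) \<and>
     (\<forall>x. dif X (dif X x) = 0)"

definition chain_map :: "('k::field_char_0, 'a::ab_group_add) cplx \<Rightarrow> ('k, 'b::ab_group_add) cplx
    \<Rightarrow> ('a \<Rightarrow> 'b) \<Rightarrow> bool" where
  "chain_map X Y f \<longleftrightarrow> degree_map X Y 0 f \<and> (\<forall>x. f (dif X x) = dif Y (f x))"

definition strong_deformation_retract ::
    "('k::field_char_0, 'a::ab_group_add) cplx \<Rightarrow> ('k, 'v::ab_group_add) cplx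
      \<Rightarrow> ('v \<Rightarrow> 'a) \<Rightarrow> ('a \<Rightarrow> 'v) \<Rightarrow> ('a \<Rightarrow> 'a) \<Rightarrow> bool" where
  "strong_deformation_retract A V i p h \<longleftrightarrow>
     chain_map V A i \<and> chain_map A V p \<and> degree_map A A 1 h \<and>
     (\<forall>x. p (i x) = x) \<and>
     (\<forall>x. dif A (h x) + h (dif A x) = x - i (p x))"

text \<open>
  \<open>tau X\<close> is \<open>x \<mapsto> (-1)\<^bsup>|x|\<^esup> x\<close>. Koszul signs are written by applying \<open>tau\<close> to every
  argument that an odd symbol moves past; this makes sense for inhomogeneous arguments too.
\<close>

definition tau :: "('k, 'a::ab_group_add) cplx \<Rightarrow> 'a \<Rightarrow> 'a" where
  "tau X x = (\<Sum>n | proj X n x \<noteq> 0. if even n then proj X n x else - proj X n x)"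

text \<open>The \<open>m\<close>-ary operations of degree \<open>k\<close> in the (nonsymmetric) endomorphism operad of \<open>X\<close>;
  only the values on lists of length \<open>m\<close> matter.\<close>

definition End_op :: "('k::field_char_0, 'a::ab_group_add) cplx \<Rightarrow> nat \<Rightarrow> int
    \<Rightarrow> ('a list \<Rightarrow> 'a) \<Rightarrow> bool" where
  "End_op X m k f \<longleftrightarrow>
     (\<forall>us vs. length us + 1 + length vs = m \<longrightarrow> linear_map X X (\<lambda>x. f (us @ x # vs))) \<and>
     (\<forall>xs ds. length xs = m \<and> list_all2 (\<lambda>x d. proj X d x = x) xs ds \<longrightarrow>
        proj X (sum_list ds + k) (f xs) = f xs)"

text \<open>\<open>circ X f i m e g\<close> is the partial composite of \<open>f\<close> with an \<open>m\<close>-ary operation \<open>g\<close> of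
  degree \<open>e\<close> at the input with (0-based) number \<open>i\<close>.\<close>

definition circ :: "('k, 'a::ab_group_add) cplx \<Rightarrow> ('a list \<Rightarrow> 'a) \<Rightarrow> nat \<Rightarrow> nat \<Rightarrow> nat
    \<Rightarrow> ('a list \<Rightarrow> 'a) \<Rightarrow> 'a list \<Rightarrow> 'a" where
  "circ X f i m e g xs =
     f (map (tau X ^^ e) (take i xs) @ g (take m (drop i xs)) # drop (i + m) xs)"

definition End_dif :: "('k, 'a::ab_group_add) cplx \<Rightarrow> nat \<Rightarrow> nat \<Rightarrow> ('a list \<Rightarrow> 'a)
    \<Rightarrow> 'a list \<Rightarrow> 'a" where
  "End_dif X m k f xs =
     (let s = (\<Sum>j<m. circ X f j 1 1 (\<lambda>ys. dif X (hd ys)) xs)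
      in dif X (f xs) - (if even k then s else - s))"


section \<open>Free vector spaces\<close>

definition fsc :: "'k::field_char_0 \<Rightarrow> ('x \<Rightarrow>\<^sub>0 'k) \<Rightarrow> ('x \<Rightarrow>\<^sub>0 'k)" where
  "fsc c v = Poly_Mapping.map ((*) c) v"

abbreviation fspan :: "('x \<Rightarrow>\<^sub>0 'k::field_char_0) set \<Rightarrow> ('x \<Rightarrow>\<^sub>0 'k) set" where
  "fspan \<equiv> module.span fsc"

definition gen :: "'x \<Rightarrow> ('x \<Rightarrow>\<^sub>0 'k::field_char_0)" where
  "gen x = Poly_Mapping.single x 1"

definition lext :: "('x \<Rightarrow> ('y \<Rightarrow>\<^sub>0 'k)) \<Rightarrow> ('x \<Rightarrow>\<^sub>0 'k::field_char_0) \<Rightarrow> ('y \<Rightarrow>\<^sub>0 'k)" where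
  "lext f v = (\<Sum>x\<in>Poly_Mapping.keys v. fsc (Poly_Mapping.lookup v x) (f x))"

lemma lookup_fsc: "Poly_Mapping.lookup (fsc c v) x = c * Poly_Mapping.lookup v x"
  unfolding fsc_def by transfer (auto simp: when_def)

lemma vector_space_fsc: "vector_space (fsc :: 'k::field_char_0 \<Rightarrow> ('x \<Rightarrow>\<^sub>0 'k) \<Rightarrow> _)"
  by unfold_locales
    (auto intro!: poly_mapping_eqI simp: lookup_fsc lookup_add algebra_simps)


section \<open>The cofree cooperad on s W\<close>

text \<open>
  \<open>u\<A>s\<close> is presented without using symmetries, so \<open>\<F>(W)\<close>, \<open>\<F>\<^sup>c(sW)\<close> and the cooperad below are
  the regular \<open>\<S>\<close>-modules on nonsymmetric ones, and \<open>\<C>(n) \<otimes>\<^bsub>\<S>\<^sub>n\<^esub> A\<^bsup>\<otimes>n\<^esup>\<close> is \<open>\<C>\<^sub>n\<^sub>s(n) \<otimes> A\<^bsup>\<otimes>n\<^esup>\<close>. We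
  work with the nonsymmetric ones.

  A \<open>unit tree\<close> is a planar tree with vertices \<open>\<mu>\<close> (constructor \<open>Mu\<close>) and \<open>\<bullet>\<close> (constructor \<open>Cork\<close>);
  these trees are a basis of \<open>\<F>\<^sup>c(sW)\<close>, \<open>Lf ()\<close> being the unit \<open>|\<close>. A tree with leaves labelled by \<open>x\<^sub>1, \<dots>, x\<^sub>m\<close>
  stands for a monomial of \<open>\<F>\<^sup>c(sW)(X)\<close>. All vertices have degree 1. A monomial denotes the
  tensor of its vertices and of its labels taken in prefix order (root, left subtree,
  right subtree), vertices and labels interleaved. Hence cutting a tree into a bottom tree whose leaves
  are labelled by upper trees costs no sign, and an odd operator acting at some place
  produces the sign of all that precedes the place in prefix order.
\<close>

datatype 'x tree = Lf 'x | Cork | Mu "'x tree" "'x tree"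

primrec verts :: "'x tree \<Rightarrow> nat" where
  "verts (Lf x) = 0"
| "verts Cork = 1"
| "verts (Mu l r) = Suc (verts l + verts r)"

primrec arity :: "'x tree \<Rightarrow> nat" where
  "arity (Lf x) = 1"
| "arity Cork = 0"
| "arity (Mu l r) = arity l + arity r"

abbreviation shape :: "'x tree \<Rightarrow> unit tree" where
  "shape t \<equiv> map_tree (\<lambda>_. ()) t"

text \<open>
  \<open>place \<tau> b [x\<^sub>1, \<dots>, x\<^sub>m]\<close> is the tensor \<open>b \<otimes> x\<^sub>1 \<otimes> \<dots> \<otimes> x\<^sub>m\<close> rewritten in prefix order, where
  \<open>\<tau>\<close> is the parity involution on labels; \<open>labels \<tau>\<close> is the converse
  (\<open>t\<close> is \<open>shape t \<otimes> labels \<tau> t\<close>). In \<open>Mu l r\<close>, the labels of \<open>l\<close> and the vertices of \<open>r\<close> get exchanged.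
\<close>

primrec place :: "('x \<Rightarrow> 'x) \<Rightarrow> unit tree \<Rightarrow> 'x list \<Rightarrow> 'x tree" where
  "place \<tau> (Lf u) xs = Lf (hd xs)"
| "place \<tau> Cork xs = Cork"
| "place \<tau> (Mu l r) xs =
     Mu (place \<tau> l (map (\<tau> ^^ verts r) (take (arity l) xs))) (place \<tau> r (drop (arity l) xs))"

primrec labels :: "('x \<Rightarrow> 'x) \<Rightarrow> 'x tree \<Rightarrow> 'x list" where
  "labels \<tau> (Lf x) = [x]"
| "labels \<tau> Cork = []"
| "labels \<tau> (Mu l r) = map (\<tau> ^^ verts r) (labels \<tau> l) @ labels \<tau> r"

definition MuF :: "('x tree \<Rightarrow>\<^sub>0 'k::field_char_0) \<Rightarrow> ('x tree \<Rightarrow>\<^sub>0 'k) \<Rightarrow> ('x tree \<Rightarrow>\<^sub>0 'k)" where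
  "MuF u v = lext (\<lambda>s. lext (\<lambda>t. gen (Mu s t)) v) u"

text \<open>\<open>expand\<close> multiplies out a tree whose leaves are labelled by linear combinations.\<close>

primrec expand :: "('y \<Rightarrow>\<^sub>0 'k::field_char_0) tree \<Rightarrow> ('y tree \<Rightarrow>\<^sub>0 'k)" where
  "expand (Lf v) = lext (\<lambda>y. gen (Lf y)) v"
| "expand Cork = gen Cork"
| "expand (Mu l r) = MuF (expand l) (expand r)"

text \<open>
  The decomposition map: the sum over all ways to cut \<open>t\<close> into a bottom tree and upper trees,
  the latter labelling the leaves of the former. At labels in \<open>unit\<close> it is
  \<open>\<Delta> : \<F>\<^sup>c(sW) \<rightarrow> \<F>\<^sup>c(sW) \<circ> \<F>\<^sup>c(sW)\<close>, at labels in \<open>A\<close> it is \<open>\<Delta> \<circ> id\<^sub>A\<close>.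
\<close>

primrec decomp :: "'x tree \<Rightarrow> ('x tree tree \<Rightarrow>\<^sub>0 'k::field_char_0)" where
  "decomp (Lf x) = gen (Lf (Lf x))"
| "decomp Cork = gen (Lf Cork) + gen Cork"
| "decomp (Mu l r) = gen (Lf (Mu l r)) + MuF (decomp l) (decomp r)"

text \<open>
  The infinitesimal decomposition map \<open>\<Delta>\<^sub>(\<^sub>1\<^sub>)\<close>: an entry \<open>(e, b, j, u)\<close> stands for
  \<open>(-1)\<^sup>e b \<otimes> u\<close> with \<open>u\<close> grafted on the leaf of \<open>b\<close> with (0-based) number \<open>j\<close>. The sign arises
  from moving the vertices of \<open>u\<close> behind those of \<open>b\<close>.
\<close>

primrec inf_decomp :: "unit tree \<Rightarrow> (nat \<times> unit tree \<times> nat \<times> unit tree) list" where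
  "inf_decomp (Lf x) = [(0, Lf (), 0, Lf x)]"
| "inf_decomp Cork = [(0, Lf (), 0, Cork)]"
| "inf_decomp (Mu l r) = (0, Lf (), 0, Mu l r) #
     map (\<lambda>(e, b, j, u). (e + verts u * verts r, Mu b r, j, u)) (inf_decomp l) @
     map (\<lambda>(e, b, j, u). (e, Mu l b, arity l + j, u)) (inf_decomp r)"

definition red_inf_decomp :: "unit tree \<Rightarrow> (nat \<times> unit tree \<times> nat \<times> unit tree) list" where
  "red_inf_decomp w = filter (\<lambda>(e, b, j, u). b \<noteq> Lf () \<and> u \<noteq> Lf ()) (inf_decomp w)"


section \<open>The curved Koszul dual cooperad of unital associative algebras\<close>

definition part :: "(unit tree \<Rightarrow> bool) \<Rightarrow> (unit tree \<Rightarrow>\<^sub>0 'k::field_char_0) \<Rightarrow> (unit tree \<Rightarrow>\<^sub>0 'k)" where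
  "part Q = lext (\<lambda>w. if Q w then gen w else 0)"

definition tree_parity :: "(unit tree \<Rightarrow>\<^sub>0 'k::field_char_0) \<Rightarrow> (unit tree \<Rightarrow>\<^sub>0 'k)" where
  "tree_parity = lext (\<lambda>w. fsc ((-1) ^ verts w) (gen w))"

text \<open>\<open>P \<circ> P\<close> inside \<open>\<F>\<^sup>c(sW) \<circ> \<F>\<^sup>c(sW)\<close>, spanned by the \<open>x \<otimes> y\<^sub>1 \<otimes> \<dots> \<otimes> y\<^sub>m\<close>.\<close>

definition composite :: "(unit tree \<Rightarrow>\<^sub>0 'k::field_char_0) set \<Rightarrow> (unit tree tree \<Rightarrow>\<^sub>0 'k) set" where
  "composite P = fspan {lext (\<lambda>b. expand (place tree_parity b ys)) x | x ys.
     x \<in> P \<and> set ys \<subseteq> P \<and> (\<forall>b\<in>Poly_Mapping.keys x. arity b = length ys)}"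

definition subcooperad :: "(unit tree \<Rightarrow>\<^sub>0 'k::field_char_0) set \<Rightarrow> bool" where
  "subcooperad P \<longleftrightarrow>
     module.subspace fsc P \<and>
     (\<forall>v\<in>P. \<forall>m k. part (\<lambda>w. arity w = m \<and> verts w = k) v \<in> P) \<and>
     (\<forall>v\<in>P. lext decomp v \<in> composite P)"

text \<open>\<open>s\<^sup>2 qR\<close>; the projection \<open>qR\<close> of \<open>R\<close> forgets the summands \<open>|\<close> of the unit relations.\<close>

definition s2qR :: "(unit tree \<Rightarrow>\<^sub>0 'k::field_char_0) set" where
  "s2qR = fspan
     {gen (Mu (Mu (Lf ()) (Lf ())) (Lf ())) - gen (Mu (Lf ()) (Mu (Lf ()) (Lf ()))),
      gen (Mu Cork (Lf ())), gen (Mu (Lf ()) Cork)}"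

text \<open>
  The largest sub-cooperad with vanishing projection to \<open>\<F>\<^sup>c(sW)\<^bsup>(2)\<^esup> / s\<^sup>2 qR\<close>. A sum of such
  sub-cooperads is again one, so their union is the largest one.
\<close>

definition uAs_dual :: "(unit tree \<Rightarrow>\<^sub>0 'k::field_char_0) set" where
  "uAs_dual = \<Union>{P. subcooperad P \<and> (\<forall>v\<in>P. part (\<lambda>w. verts w = 2) v \<in> s2qR)}"

text \<open>The coefficient of \<open>|\<close> in the curvature; on \<open>uAs_dual\<close> the weight 2 part lies in \<open>s\<^sup>2 qR\<close>,
  whose associativity relation does not contain the two trees below.\<close>

definition curvature :: "(unit tree \<Rightarrow>\<^sub>0 'k::field_char_0) \<Rightarrow> 'k" where
  "curvature c = - Poly_Mapping.lookup c (Mu Cork (Lf ())) - Poly_Mapping.lookup c (Mu (Lf ()) Cork)"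

text \<open>
  The basis element \<open>\<mu>\<^sub>n\<^sup>S\<close> of \<open>uAs_dual\<close>: the signed sum of the binary trees with \<open>n\<close> leaves and
  corks on the leaves in \<open>S \<subseteq> {1..n}\<close>. It is normalised by giving coefficient 1 to
  the left comb; thus \<open>\<mu>\<^sub>2\<^sup>{\<^sup>1\<^sup>}\<close>, \<open>\<mu>\<^sub>2\<^sup>{\<^sup>2\<^sup>}\<close> and \<open>\<mu>\<^sub>3\<^sup>\<emptyset>\<close> are the three generators of \<open>s2qR\<close> above, and
  \<open>\<mu>\<^sub>1\<^sup>\<emptyset> = |\<close>, \<open>\<mu>\<^sub>1\<^sup>{\<^sup>1\<^sup>} = s\<bullet>\<close>. The degree of \<open>\<mu>\<^sub>n\<^sup>S\<close> is \<open>n - 1 + |S|\<close>.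
\<close>

primrec corkword :: "'x tree \<Rightarrow> bool list" where
  "corkword (Lf x) = [False]"
| "corkword Cork = [True]"
| "corkword (Mu l r) = corkword l @ corkword r"

definition positions :: "('b \<Rightarrow> bool) \<Rightarrow> 'b list \<Rightarrow> nat set" where
  "positions Q ys = {j. 1 \<le> j \<and> j \<le> length ys \<and> Q (ys ! (j - 1))}"

primrec treesgn :: "unit tree \<Rightarrow> nat" where
  "treesgn (Lf x) = 0"
| "treesgn Cork = 0"
| "treesgn (Mu l r) = treesgn l + treesgn r +
     (length (corkword l) + count_list (corkword l) True) * (length (corkword r) - 1)"

definition corolla :: "nat \<Rightarrow> nat set \<Rightarrow> (unit tree \<Rightarrow>\<^sub>0 'k::field_char_0)" where
  "corolla n S = (\<Sum>w | length (corkword w) = n \<and> positions id (corkword w) = S.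
     fsc ((-1) ^ treesgn w) (gen w))"


section \<open>Homotopy unital associative algebras\<close>

text \<open>
  A morphism of dg operads from the quasi-free operad \<open>\<Omega> u\<A>s\<^sup>\<exclamdown>\<close> to the endomorphism operad of \<open>A\<close> is
  a degree 0 map \<open>s\<^sup>-\<^sup>1 c \<mapsto> \<gamma>\<^sub>A(s\<^sup>-\<^sup>1 c)\<close> on the generators, i.e. for \<open>c\<close> in \<open>uAs_dual\<close> without component \<open>|\<close>,
  which is compatible with the differentials on generators:
  \<open>\<partial>(\<gamma>\<^sub>A(s\<^sup>-\<^sup>1 c)) = \<gamma>\<^sub>A((d\<^sub>0 - d\<^sub>2)(s\<^sup>-\<^sup>1 c)) = \<theta>(c) id - \<Sum> (-1)\<^bsup>|c'|\<^esup> \<gamma>\<^sub>A(s\<^sup>-\<^sup>1 c') \<circ>\<^sub>j \<gamma>\<^sub>A(s\<^sup>-\<^sup>1 c'')\<close>.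

  The map is given as a linear map on all of \<open>\<F>\<^sup>c(sW)\<close>, by its values \<open>\<gamma> w\<close> at the basis trees. Every linear
  map on \<open>uAs_dual\<close> extends to \<open>\<F>\<^sup>c(sW)\<close>. Since \<open>\<Delta>\<^sub>(\<^sub>1\<^sub>)\<close> maps \<open>uAs_dual\<close> to
  \<open>uAs_dual \<circ>\<^sub>(\<^sub>1\<^sub>) uAs_dual\<close>, nothing below depends on the extension.
\<close>

definition act :: "('k::field_char_0, 'a::ab_group_add) cplx \<Rightarrow> (unit tree \<Rightarrow> 'a list \<Rightarrow> 'a)
    \<Rightarrow> (unit tree \<Rightarrow>\<^sub>0 'k) \<Rightarrow> 'a list \<Rightarrow> 'a" where
  "act A \<gamma> c xs = (\<Sum>w\<in>Poly_Mapping.keys c. scl A (Poly_Mapping.lookup c w) (\<gamma> w xs))"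

definition uA_infinity_algebra :: "('k::field_char_0, 'a::ab_group_add) cplx
    \<Rightarrow> (unit tree \<Rightarrow> 'a list \<Rightarrow> 'a) \<Rightarrow> bool" where
  "uA_infinity_algebra A \<gamma> \<longleftrightarrow>
     chain_complex A \<and>
     (\<forall>w. w \<noteq> Lf () \<longrightarrow> End_op A (arity w) (int (verts w) - 1) (\<gamma> w)) \<and>
     (\<forall>c\<in>uAs_dual. \<forall>xs. Poly_Mapping.lookup c (Lf ()) = 0 \<and>
        (\<forall>w\<in>Poly_Mapping.keys c. arity w = length xs) \<longrightarrow>
        (\<Sum>w\<in>Poly_Mapping.keys c.
           scl A (Poly_Mapping.lookup c w) (End_dif A (arity w) (verts w - 1) (\<gamma> w) xs)) =
        scl A (curvature c) (hd xs) -
        (\<Sum>w\<in>Poly_Mapping.keys c. scl A (Poly_Mapping.lookup c w)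
           (\<Sum>(e, b, j, u)\<leftarrow>red_inf_decomp w. scl A ((-1) ^ (e + verts b))
              (circ A (\<gamma> b) j (arity u) (verts u - 1) (\<gamma> u) xs))))"

text \<open>The operation \<open>\<mu>\<^sub>n\<^sup>S\<close> of \<open>A\<close>, with \<open>n - |S|\<close> inputs, for \<open>n \<ge> 1\<close>, \<open>S \<subseteq> {1..n}\<close> and \<open>(n, S) \<noteq> (1, \<emptyset>)\<close>.\<close>

definition mu_op :: "('k::field_char_0, 'a::ab_group_add) cplx \<Rightarrow> (unit tree \<Rightarrow> 'a list \<Rightarrow> 'a)
    \<Rightarrow> nat \<Rightarrow> nat set \<Rightarrow> 'a list \<Rightarrow> 'a" where
  "mu_op A \<gamma> n S = act A \<gamma> (corolla n S)"


section \<open>Bar construction and infinity-morphisms\<close>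

text \<open>
  \<open>\<F>\<^sup>c(sW)(A)\<close> is the free vector space on the \<open>A\<close>-labelled trees modulo multilinearity in the
  labels, and likewise \<open>\<F>\<^sup>c(sW)(\<F>\<^sup>c(sW)(A))\<close>. We compute with representatives;
  \<open>slots B\<close> are the functions inserting, by means of an element of \<open>B\<close>, a variable in one leaf
  of a tree whose other leaves are fixed.
\<close>

inductive_set slots :: "('a \<Rightarrow> 'x) set \<Rightarrow> ('a \<Rightarrow> 'x tree) set" for B where
  "\<sigma> \<in> B \<Longrightarrow> (\<lambda>x. Lf (\<sigma> x)) \<in> slots B"
| "\<sigma> \<in> slots B \<Longrightarrow> (\<lambda>x. Mu (\<sigma> x) r) \<in> slots B"
| "\<sigma> \<in> slots B \<Longrightarrow> (\<lambda>x. Mu l (\<sigma> x)) \<in> slots B"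

definition multilin :: "('k::field_char_0, 'a::ab_group_add) cplx \<Rightarrow> ('a \<Rightarrow> 'y) set
    \<Rightarrow> ('y \<Rightarrow>\<^sub>0 'k) set" where
  "multilin A B = fspan
     ({gen (\<sigma> (x + y)) - gen (\<sigma> x) - gen (\<sigma> y) | \<sigma> x y. \<sigma> \<in> B} \<union>
      {gen (\<sigma> (scl A c x)) - fsc c (gen (\<sigma> x)) | \<sigma> c x. \<sigma> \<in> B})"

abbreviation rel1 :: "('k::field_char_0, 'a::ab_group_add) cplx \<Rightarrow> ('a tree \<Rightarrow>\<^sub>0 'k) set" where
  "rel1 A \<equiv> multilin A (slots {\<lambda>x. x})"

abbreviation rel2 :: "('k::field_char_0, 'a::ab_group_add) cplx \<Rightarrow> ('a tree tree \<Rightarrow>\<^sub>0 'k) set" where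
  "rel2 A \<equiv> multilin A (slots (slots {\<lambda>x. x}))"

text \<open>\<open>tensor_rep A c [a\<^sub>1, \<dots>, a\<^sub>m]\<close> represents \<open>c \<otimes> a\<^sub>1 \<otimes> \<dots> \<otimes> a\<^sub>m\<close>; \<open>cofree A\<close> is the preimage of
  the subspace \<open>u\<A>s\<^sup>\<exclamdown>(A)\<close> of \<open>\<F>\<^sup>c(sW)(A)\<close>.\<close>

definition tensor_rep :: "('k::field_char_0, 'a::ab_group_add) cplx \<Rightarrow> (unit tree \<Rightarrow>\<^sub>0 'k)
    \<Rightarrow> 'a list \<Rightarrow> ('a tree \<Rightarrow>\<^sub>0 'k)" where
  "tensor_rep A c xs = lext (\<lambda>w. gen (place (tau A) w xs)) c"

definition cofree :: "('k::field_char_0, 'a::ab_group_add) cplx \<Rightarrow> ('a tree \<Rightarrow>\<^sub>0 'k) set" where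
  "cofree A = fspan
     ({tensor_rep A c xs | c xs. c \<in> uAs_dual \<and> (\<forall>w\<in>Poly_Mapping.keys c. arity w = length xs)} \<union>
      rel1 A)"

definition homogeneous :: "('k::field_char_0, 'a::ab_group_add) cplx \<Rightarrow> int
    \<Rightarrow> ('a tree \<Rightarrow>\<^sub>0 'k) set" where
  "homogeneous A n = fspan
     ({gen t | t. \<exists>ds. list_all2 (\<lambda>x d. proj A d x = x) (labels (\<lambda>x. x) t) ds \<and>
        int (verts t) + sum_list ds = n} \<union>
      rel1 A)"

text \<open>
  The predifferential \<open>d\<^sub>1 + d\<^sub>2\<close>. It is the sum over the places of the tree; \<open>d\<^sub>1\<close> applies
  \<open>d\<^sub>A\<close> to a label and \<open>d\<^sub>2\<close> replaces a whole subtree \<open>u \<noteq> |\<close> by the label \<open>\<gamma>\<^sub>A(s\<^sup>-\<^sup>1 u)(\<dots>)\<close>,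
  applied to the labels of the subtree. Both operators are odd.
\<close>

primrec bar_dif :: "('k::field_char_0, 'a::ab_group_add) cplx \<Rightarrow> (unit tree \<Rightarrow> 'a list \<Rightarrow> 'a)
    \<Rightarrow> 'a tree \<Rightarrow> ('a tree \<Rightarrow>\<^sub>0 'k)" where
  "bar_dif A \<gamma> (Lf a) = gen (Lf (dif A a))"
| "bar_dif A \<gamma> Cork = gen (Lf (\<gamma> Cork []))"
| "bar_dif A \<gamma> (Mu l r) =
     gen (Lf (\<gamma> (shape (Mu l r)) (labels (tau A) (Mu l r))))
     - MuF (bar_dif A \<gamma> l) (gen r)
     - fsc ((-1) ^ verts l) (MuF (gen (map_tree (tau A) l)) (bar_dif A \<gamma> r))"

text \<open>
  \<open>F\<close> is given, on monomials, as a linear map on \<open>\<F>\<^sup>c(sW)(V)\<close>; again only its restriction to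
  \<open>u\<A>s\<^sup>\<exclamdown>(V)\<close> matters. The last two conditions say that it is a morphism of coalgebras and that it commutes with the
  predifferentials.
\<close>

definition infinity_morphism ::
    "('k::field_char_0, 'v::ab_group_add) cplx \<Rightarrow> (unit tree \<Rightarrow> 'v list \<Rightarrow> 'v)
      \<Rightarrow> ('k, 'a::ab_group_add) cplx \<Rightarrow> (unit tree \<Rightarrow> 'a list \<Rightarrow> 'a)
      \<Rightarrow> ('v tree \<Rightarrow> ('a tree \<Rightarrow>\<^sub>0 'k)) \<Rightarrow> bool" where
  "infinity_morphism V \<gamma>V A \<gamma>A F \<longleftrightarrow>
     lext F ` rel1 V \<subseteq> rel1 A \<and>
     lext F ` cofree V \<subseteq> cofree A \<and>
     (\<forall>n. lext F ` (cofree V \<inter> homogeneous V n) \<subseteq> homogeneous A n) \<and>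
     (\<forall>v\<in>cofree V. lext decomp (lext F v) - lext (\<lambda>b. expand (map_tree F b)) (lext decomp v) \<in> rel2 A) \<and>
     (\<forall>v\<in>cofree V. lext (bar_dif A \<gamma>A) (lext F v) - lext F (lext (bar_dif V \<gamma>V) v) \<in> rel1 A)"

definition root_part :: "('k::field_char_0, 'a::ab_group_add) cplx \<Rightarrow> ('a tree \<Rightarrow>\<^sub>0 'k) \<Rightarrow> 'a" where
  "root_part A v = (\<Sum>t\<in>Poly_Mapping.keys v.
     scl A (Poly_Mapping.lookup v t) (case t of Lf a \<Rightarrow> a | _ \<Rightarrow> 0))"

text \<open>The component \<open>f\<^sub>n\<^sup>S : V\<^bsup>\<otimes>(n - |S|)\<^esup> \<rightarrow> A\<close> of an infinity-morphism.\<close>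

definition component :: "('k::field_char_0, 'v::ab_group_add) cplx \<Rightarrow> ('k, 'a::ab_group_add) cplx
    \<Rightarrow> ('v tree \<Rightarrow> ('a tree \<Rightarrow>\<^sub>0 'k)) \<Rightarrow> nat \<Rightarrow> nat set \<Rightarrow> 'v list \<Rightarrow> 'a" where
  "component V A F n S xs = root_part A (lext F (tensor_rep V (corolla n S) xs))"


section \<open>The tree formulae\<close>

text \<open>\<open>Conn\<close> and \<open>Disc\<close> are leaves with a connected, respectively disconnected, cork.\<close>

datatype ptree = Leaf | Conn | Disc | Node "ptree list"

primrec ptree_ok :: "ptree \<Rightarrow> bool" where
  "ptree_ok Leaf = True"
| "ptree_ok Conn = True"
| "ptree_ok Disc = True"
| "ptree_ok (Node ts) = (2 \<le> length ts \<and> list_all id (map ptree_ok ts))"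

primrec pword :: "ptree \<Rightarrow> bool list" where
  "pword Leaf = [False]"
| "pword Conn = [True]"
| "pword Disc = [True]"
| "pword (Node ts) = concat (map pword ts)"

text \<open>A connected cork is a part of the vertex below it, so it needs one. For \<open>n = 1\<close> and \<open>S = {1}\<close>
  this leaves \<open>Disc\<close> only.\<close>

definition ptrees :: "nat \<Rightarrow> nat set \<Rightarrow> ptree set" where
  "ptrees n S = {t. ptree_ok t \<and> t \<noteq> Conn \<and> length (pword t) = n \<and> positions id (pword t) = S}"

abbreviation pleaves :: "ptree \<Rightarrow> nat" where
  "pleaves t \<equiv> length (pword t)"

abbreviation pcorks :: "ptree \<Rightarrow> nat" where
  "pcorks t \<equiv> count_list (pword t) True"

abbreviation pdegree :: "ptree \<Rightarrow> nat" where
  "pdegree t \<equiv> pleaves t - 1 + pcorks t"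

text \<open>
  \<open>tensor_apply \<tau> [(t\<^sub>1, f\<^sub>1), \<dots>]\<close> is \<open>f\<^sub>1 \<otimes> f\<^sub>2 \<otimes> \<dots>\<close>, where \<open>f\<^sub>j\<close> is the operation built from \<open>t\<^sub>j\<close> with
  the homotopy at its root; it has degree \<open>pdegree t\<^sub>j\<close>.
\<close>

fun tensor_apply :: "('v \<Rightarrow> 'v) \<Rightarrow> (ptree \<times> ('v list \<Rightarrow> 'a)) list \<Rightarrow> 'v list \<Rightarrow> 'a list" where
  "tensor_apply \<tau> [] xs = []"
| "tensor_apply \<tau> ((t, f) # fs) xs =
     (let m = pleaves t - pcorks t in
      f (map (\<tau> ^^ sum_list (map (pdegree \<circ> fst) fs)) (take m xs)) # tensor_apply \<tau> fs (drop m xs))"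

definition vertex_op :: "('k::field_char_0, 'a::ab_group_add) cplx \<Rightarrow> (unit tree \<Rightarrow> 'a list \<Rightarrow> 'a)
    \<Rightarrow> ('k, 'v::ab_group_add) cplx \<Rightarrow> ptree list \<Rightarrow> ('v list \<Rightarrow> 'a) list \<Rightarrow> 'v list \<Rightarrow> 'a" where
  "vertex_op A \<gamma> V ts fs xs =
     mu_op A \<gamma> (length ts) (positions (\<lambda>t. t = Conn) ts)
       (tensor_apply (tau V) (filter (\<lambda>(t, f). t \<noteq> Conn) (zip ts fs)) xs)"

text \<open>\<open>edge_op\<close> ends with \<open>i\<close> or with the homotopy \<open>h\<close>; \<open>core_op\<close> omits the last \<open>h\<close>.\<close>

primrec edge_op :: "('k::field_char_0, 'a::ab_group_add) cplx \<Rightarrow> (unit tree \<Rightarrow> 'a list \<Rightarrow> 'a)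
    \<Rightarrow> ('k, 'v::ab_group_add) cplx \<Rightarrow> ('v \<Rightarrow> 'a) \<Rightarrow> ('a \<Rightarrow> 'a) \<Rightarrow> ptree \<Rightarrow> 'v list \<Rightarrow> 'a" where
  "edge_op A \<gamma> V i h Leaf = (\<lambda>xs. i (hd xs))"
| "edge_op A \<gamma> V i h Conn = (\<lambda>xs. 0)"
| "edge_op A \<gamma> V i h Disc = (\<lambda>xs. h (mu_op A \<gamma> 1 {1} []))"
| "edge_op A \<gamma> V i h (Node ts) = (\<lambda>xs. h (vertex_op A \<gamma> V ts (map (edge_op A \<gamma> V i h) ts) xs))"

fun core_op :: "('k::field_char_0, 'a::ab_group_add) cplx \<Rightarrow> (unit tree \<Rightarrow> 'a list \<Rightarrow> 'a)
    \<Rightarrow> ('k, 'v::ab_group_add) cplx \<Rightarrow> ('v \<Rightarrow> 'a) \<Rightarrow> ('a \<Rightarrow> 'a) \<Rightarrow> ptree \<Rightarrow> 'v list \<Rightarrow> 'a" where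
  "core_op A \<gamma> V i h Disc xs = mu_op A \<gamma> 1 {1} []"
| "core_op A \<gamma> V i h (Node ts) xs = vertex_op A \<gamma> V ts (map (edge_op A \<gamma> V i h) ts) xs"
| "core_op A \<gamma> V i h _ xs = 0"

text \<open>
  The exponent of the sign of a tree. At each vertex, the two double sums give the sign
  with which the corresponding term \<open>\<mu>\<^sub>k\<^sup>T \<otimes> (\<mu>\<^bsub>n\<^sub>1\<^esub>\<^bsup>S\<^sub>1\<^esup> \<otimes> \<mu>\<^bsub>n\<^sub>2\<^esub>\<^bsup>S\<^sub>2\<^esup> \<otimes> \<dots>)\<close> occurs in \<open>\<Delta>(\<mu>\<^sub>n\<^sup>S)\<close>; in addition
  every edge and every disconnected cork carrying a homotopy contributes \<open>-1\<close>.
\<close>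

definition vertex_sgn :: "ptree list \<Rightarrow> nat" where
  "vertex_sgn ts =
     (\<Sum>j<length ts. (pleaves (ts ! j) - 1) * (\<Sum>l<j. pleaves (ts ! l) + pcorks (ts ! l))) +
     (\<Sum>j<length ts. if ts ! j = Conn then 0
        else pdegree (ts ! j) * card {l. j < l \<and> l < length ts \<and> ts ! l = Conn}) +
     length (filter (\<lambda>t. t \<noteq> Leaf \<and> t \<noteq> Conn) ts)"

primrec ptree_sgn :: "ptree \<Rightarrow> nat" where
  "ptree_sgn Leaf = 0"
| "ptree_sgn Conn = 0"
| "ptree_sgn Disc = 0"
| "ptree_sgn (Node ts) = vertex_sgn ts + sum_list (map ptree_sgn ts)"

definition tree_sum :: "('k::field_char_0, 'a::ab_group_add) cplx \<Rightarrow> (unit tree \<Rightarrow> 'a list \<Rightarrow> 'a)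
    \<Rightarrow> ('k, 'v::ab_group_add) cplx \<Rightarrow> ('v \<Rightarrow> 'a) \<Rightarrow> ('a \<Rightarrow> 'a)
    \<Rightarrow> ('k, 'b::ab_group_add) cplx \<Rightarrow> ('a \<Rightarrow> 'b) \<Rightarrow> nat \<Rightarrow> nat set \<Rightarrow> 'v list \<Rightarrow> 'b" where
  "tree_sum A \<gamma> V i h B q n S xs =
     (\<Sum>t\<in>ptrees n S. scl B ((-1) ^ ptree_sgn t) (q (core_op A \<gamma> V i h t xs)))"

text \<open>
  For an arbitrary homotopy \<open>h\<close> the tree sums need not satisfy the relations: the curvature \<open>\<theta>\<close>
  contributes terms in which \<open>h\<close> is applied to the output of \<open>i\<close> or of another \<open>h\<close>, and
  nothing else cancels them. They vanish if \<open>h \<circ> i = 0\<close> and \<open>h \<circ> h = 0\<close>. The homotopy \<open>h' d h'\<close> with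
  \<open>h' = (1 - i p) h (1 - i p)\<close> has these properties, and it equals \<open>h\<close> if \<open>h\<close> has them.
\<close>

definition normal_homotopy :: "('k, 'a::ab_group_add) cplx \<Rightarrow> ('v \<Rightarrow> 'a) \<Rightarrow> ('a \<Rightarrow> 'v)
    \<Rightarrow> ('a \<Rightarrow> 'a) \<Rightarrow> 'a \<Rightarrow> 'a" where
  "normal_homotopy A i p h =
     (let q = (\<lambda>x. x - i (p x)); h' = (\<lambda>x. q (h (q x))) in (\<lambda>x. h' (dif A (h' x))))"

end

theory Submission
  imports Defs
begin

text \<open>
  All computations take place on monomials, i.e. on labelled trees, modulo multilinearity in
  the labels (\<open>eqv\<close>). Write \<open>D\<close> for the predifferential of a bar construction, \<open>\<delta>\<close> for its part
  that ends in a single label (\<open>d\<close> on a label, the operation \<open>\<gamma>\<close> of the whole tree otherwise), and \<open>D'\<close>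
  for the rest. The relations of an algebra say that \<open>\<delta> \<circ> D = \<kappa>\<close> on the cofree coalgebra,
  where \<open>\<kappa>\<close> is the curvature (\<open>uA_infinity_algebra_iff\<close>).

  A coalgebra morphism \<open>F\<close> is determined by its projection \<open>f\<close> to the labels: \<open>F t\<close> is the sum over
  all ways to cut \<open>t\<close>, with each upper tree \<open>u\<close> replaced by the label \<open>f u\<close>. Let \<open>F' t\<close> be the part
  in which the bottom tree is not trivial; it involves only \<open>f\<close> of smaller trees. This permits to
  define, by recursion over binary trees,
  \<open>f = i\<close> on labels, \<open>f t = - h (\<gamma> (F' t))\<close> and \<open>\<gamma>V t = p (\<gamma> (F' t))\<close> on all other trees.

  Suppose that \<open>F\<close> commutes with the predifferentials on the two subtrees in each term \<open>Mu l r\<close> of an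
  element \<open>c\<close> of the cofree coalgebra. Then \<open>F' (D' c) = D' (F' c)\<close>, and with \<open>G = \<gamma> (F' c)\<close> the
  relations of \<open>A\<close>, applied to \<open>F' c\<close>, read \<open>d G + \<gamma> (F' (D' c)) = \<kappa> (F' c)\<close>. Applying \<open>p\<close> yields
  the relation of \<open>V\<close> for \<open>c\<close>, because \<open>p (\<kappa> (F' c)) = \<kappa> c\<close>; applying \<open>h\<close> and using
  \<open>d h + h d = 1 - i p\<close> yields that \<open>F\<close> commutes with the predifferentials on \<open>c\<close>, because
  \<open>h (\<kappa> (F' c)) = 0\<close> (\<open>transfer_step\<close>). The curvature only sees trees with one vertex \<open>\<mu>\<close>
  and one cork, so \<open>\<kappa> (F' c)\<close> consists of values of \<open>f\<close>; hence the last two equations come from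
  \<open>p i = 1\<close>, \<open>p h = 0\<close>, \<open>h i = 0\<close> and \<open>h h = 0\<close>.

  The induction needs elements \<open>c\<close> whose parts \<open>l\<close>, \<open>r\<close> and whose image \<open>F' c\<close> again belong to cofree
  coalgebras. The corollas supply them. The decomposition of a labelled corolla is
  a signed sum over the segmentations of its word into blocks (\<open>decomp_labcor\<close>), so the corollas
  span a sub-cooperad. This is all of \<open>uAs_dual\<close>, since in every
  cooperad with the prescribed weight 2 part the coefficients at left combs determine
  all others (\<open>coeff_left_comb\<close>). The same decomposition expresses \<open>f\<close> of a corolla by \<open>f\<close> of its
  blocks; unrolling this recursion gives the sums over planar trees (\<open>core_sum\<close>).
\<close>

section \<open>Linear extension from a free vector space\<close>

abbreviation coef :: "('x \<Rightarrow>\<^sub>0 'k::zero) \<Rightarrow> 'x \<Rightarrow> 'k" where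
  "coef \<equiv> Poly_Mapping.lookup"

abbreviation supp :: "('x \<Rightarrow>\<^sub>0 'k::zero) \<Rightarrow> 'x set" where
  "supp \<equiv> Poly_Mapping.keys"

interpretation fv: vector_space "fsc :: 'k::field_char_0 \<Rightarrow> ('x \<Rightarrow>\<^sub>0 'k) \<Rightarrow> ('x \<Rightarrow>\<^sub>0 'k)"
  by (rule vector_space_fsc)

text \<open>
  The extension of \<open>lext\<close> to maps into an arbitrary vector space with scalar
  multiplication \<open>s\<close>. The sums \<open>act\<close> and \<open>root_part\<close> have
  this form, too.
\<close>

definition gext :: "('k::field_char_0 \<Rightarrow> 'b \<Rightarrow> 'b) \<Rightarrow> ('x \<Rightarrow> 'b) \<Rightarrow> ('x \<Rightarrow>\<^sub>0 'k) \<Rightarrow> 'b::ab_group_add" where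
  "gext s g v = (\<Sum>x\<in>supp v. s (coef v x) (g x))"

lemma lext_gext: "lext f = gext fsc f"
  by (simp add: fun_eq_iff lext_def gext_def)

lemma gext_superset:
  fixes v :: "'x \<Rightarrow>\<^sub>0 'k::field_char_0"
  assumes "vector_space s" "finite K" "supp v \<subseteq> K"
  shows "gext s g v = (\<Sum>x\<in>K. s (coef v x) (g x))"
proof -
  interpret s: vector_space s by fact
  show ?thesis
    unfolding gext_def using assms(2,3)
    by (intro sum.mono_neutral_left) (auto simp: in_keys_iff)
qed

lemma gext_linear:
  fixes s :: "'k::field_char_0 \<Rightarrow> 'b \<Rightarrow> 'b::ab_group_add" and g :: "'x \<Rightarrow> 'b"
  assumes "vector_space s"
  shows "Vector_Spaces.linear fsc s (gext s g)"
proof -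
  interpret s: vector_space s by fact
  show ?thesis
  proof unfold_locales
    fix u v :: "'x \<Rightarrow>\<^sub>0 'k"
    let ?K = "supp u \<union> supp v"
    have "supp (u + v) \<subseteq> ?K" by (rule Poly_Mapping.keys_add)
    then show "gext s g (u + v) = gext s g u + gext s g v"
      by (simp add: gext_superset[OF assms, where K = ?K] lookup_add s.scale_left_distrib sum.distrib)
  next
    fix c and u :: "'x \<Rightarrow>\<^sub>0 'k"
    have "supp (fsc c u) \<subseteq> supp u"
      by (auto simp: in_keys_iff lookup_fsc)
    then show "gext s g (fsc c u) = s c (gext s g u)"
      by (simp add: gext_superset[OF assms, where K = "supp u"] lookup_fsc s.scale_sum_right)
  qed
qed

lemma gext_gen [simp]: "vector_space s \<Longrightarrow> gext s g (gen x) = g x"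
  by (simp add: gext_def gen_def vector_space.vector_space_assms)

lemma gext_gen_id: "gext fsc gen v = v"
proof (rule poly_mapping_eqI)
  fix x
  have "coef (\<Sum>y\<in>supp v. fsc (coef v y) (gen y)) x =
      (\<Sum>y\<in>supp v. if x = y then coef v y else 0)"
    unfolding lookup_sum by (rule sum.cong) (auto simp: lookup_fsc gen_def lookup_single)
  then show "coef (gext fsc gen v) x = coef v x"
    by (auto simp: gext_def in_keys_iff)
qed

text \<open>
  Equations between linear maps on a free vector space are proved throughout by pushing all maps
  into the argument of a linear extension, and comparing there.
\<close>

lemma lin_gext:
  assumes "Vector_Spaces.linear s t \<phi>"
  shows "\<phi> (gext s g v) = gext t (\<lambda>x. \<phi> (g x)) v"
proof -
  interpret l: Vector_Spaces.linear s t \<phi> by fact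
  show ?thesis by (simp add: gext_def l.sum l.scale)
qed

lemma lin_eq_gext:
  assumes "Vector_Spaces.linear fsc t \<phi>"
  shows "\<phi> v = gext t (\<lambda>x. \<phi> (gen x)) v"
  using lin_gext[OF assms, of gen v] by (simp add: gext_gen_id)

lemma gext_cong: "(\<And>x. x \<in> supp v \<Longrightarrow> g x = g' x) \<Longrightarrow> gext s g v = gext s g' v"
  by (simp add: gext_def)

lemma lext_linear: "Vector_Spaces.linear fsc fsc (lext f)"
  unfolding lext_gext by (rule gext_linear[OF vector_space_fsc])

interpretation lx: Vector_Spaces.linear "fsc :: 'k::field_char_0 \<Rightarrow> ('x \<Rightarrow>\<^sub>0 'k) \<Rightarrow> _"
  "fsc :: 'k::field_char_0 \<Rightarrow> ('y \<Rightarrow>\<^sub>0 'k) \<Rightarrow> _" "lext f" for f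
  by (rule lext_linear)

lemmas lext_simps [simp] = lx.add lx.scale lx.zero lx.diff lx.neg
lemmas lext_sum = lx.sum

lemma lext_gen [simp]: "lext f (gen x) = f x"
  by (simp add: lext_gext vector_space_fsc)

lemma lext_gen_id [simp]: "lext gen v = v" "lext (\<lambda>x. gen x) v = v"
  by (simp_all add: lext_gext gext_gen_id)

lemma lext_lext: "lext f (lext g v) = lext (\<lambda>x. lext f (g x)) v"
  using lin_gext[OF lext_linear, of f g v] by (simp add: lext_gext)

lemma gext_lext: "vector_space s \<Longrightarrow> gext s f (lext g v) = gext s (\<lambda>x. gext s f (g x)) v"
  using lin_gext[OF gext_linear, of s f g v] by (simp add: lext_gext)

lemma lext_fun_add: "lext (\<lambda>x. f x + g x) v = lext f v + lext g v"
  by (simp add: lext_def fv.scale_right_distrib sum.distrib)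

lemma lext_fun_diff: "lext (\<lambda>x. f x - g x) v = lext f v - lext g v"
  by (simp add: lext_def fv.scale_right_diff_distrib sum_subtractf)

lemma lext_fun_zero [simp]: "lext (\<lambda>x. 0) v = 0"
  by (simp add: lext_def)

lemma lext_fun_fsc: "lext (\<lambda>x. fsc c (f x)) v = fsc c (lext f v)"
  by (simp add: lext_def fv.scale_sum_right fv.scale_left_commute mult.commute)

lemma lext_fun_neg: "lext (\<lambda>x. - f x) v = - lext f v"
  by (simp add: lext_def sum_negf)

lemma lext_cong: "(\<And>x. x \<in> supp v \<Longrightarrow> f x = g x) \<Longrightarrow> lext f v = lext g v"
  by (simp add: lext_def)

lemma lookup_gen: "coef (gen x) y = (if x = y then 1 else 0)"
  by (simp add: gen_def lookup_single when_def)

lemma lext_in_subspace: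
  assumes "module.subspace fsc S" "\<And>x. x \<in> supp v \<Longrightarrow> f x \<in> S"
  shows "lext f v \<in> S"
  unfolding lext_def by (intro fv.subspace_sum fv.subspace_scale assms)

lemma MuF_linear_left: "Vector_Spaces.linear fsc fsc (\<lambda>u. MuF u v)"
  unfolding MuF_def by (rule lext_linear)

lemma MuF_linear_right: "Vector_Spaces.linear fsc fsc (MuF u)"
proof unfold_locales
  show "MuF u (x + y) = MuF u x + MuF u y" for x y
    by (simp add: MuF_def lext_fun_add)
  show "MuF u (fsc c x) = fsc c (MuF u x)" for c x
    by (simp add: MuF_def lext_fun_fsc)
qed

interpretation ml: Vector_Spaces.linear "fsc :: 'k::field_char_0 \<Rightarrow> ('x tree \<Rightarrow>\<^sub>0 'k) \<Rightarrow> _"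
  "fsc :: 'k::field_char_0 \<Rightarrow> ('x tree \<Rightarrow>\<^sub>0 'k) \<Rightarrow> _" "\<lambda>u. MuF u v" for v
  by (rule MuF_linear_left)

interpretation mr: Vector_Spaces.linear "fsc :: 'k::field_char_0 \<Rightarrow> ('x tree \<Rightarrow>\<^sub>0 'k) \<Rightarrow> _"
  "fsc :: 'k::field_char_0 \<Rightarrow> ('x tree \<Rightarrow>\<^sub>0 'k) \<Rightarrow> _" "MuF u" for u
  by (rule MuF_linear_right)

lemmas MuF_simps [simp] = ml.add ml.scale ml.zero ml.diff ml.neg mr.add mr.scale mr.zero mr.diff mr.neg
lemmas MuF_sum = ml.sum mr.sum

lemma MuF_gen [simp]: "MuF (gen s) (gen t) = gen (Mu s t)"
  by (simp add: MuF_def)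

lemma MuF_lext:
  "MuF (lext f u) w = lext (\<lambda>s. MuF (f s) w) u"
  "MuF z (lext g v) = lext (\<lambda>t. MuF z (g t)) v"
  using lin_gext[OF MuF_linear_left, where g = f] lin_gext[OF MuF_linear_right, where g = g]
  by (simp_all add: lext_gext)

lemma MuF_eq: "MuF u v = lext (\<lambda>s. MuF (gen s) v) u" "MuF u v = lext (\<lambda>t. MuF u (gen t)) v"
  by (simp_all flip: MuF_lext)

lemma lext_MuF: "lext f (MuF u v) = lext (\<lambda>s. lext (\<lambda>t. f (Mu s t)) v) u"
  by (simp add: MuF_def lext_lext)

text \<open>
  The maps that cut, graft or relabel trees respect the product \<open>MuF\<close>, which stands
  for adding a vertex at the root.
\<close>

lemma lext_MuF_hom:
  assumes "\<And>s t. f (Mu s t) = MuF (f s) (f t)"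
  shows "lext f (MuF u v) = MuF (lext f u) (lext f v)"
  by (simp add: lext_MuF assms MuF_lext(1)) (simp add: MuF_lext(2))

section \<open>Chain complexes and the parity involution\<close>

abbreviation parity_sgn :: "int \<Rightarrow> 'k::field_char_0" where
  "parity_sgn n \<equiv> (if even n then 1 else - 1)"

locale complex =
  fixes A :: "('k::field_char_0, 'a::ab_group_add) cplx"
  assumes complex: "chain_complex A"
begin

sublocale vector_space "scl A"
  using complex by (simp add: chain_complex_def)

lemma minus_scl [simp]: "scl A (- 1) x = - x"
  using scale_minus_left[of 1 x] by simp

lemma linear_proj: "Vector_Spaces.linear (scl A) (scl A) (proj A n)"
  using complex by (simp add: chain_complex_def linear_map_def)

lemma proj_proj: "proj A m (proj A n x) = (if m = n then proj A n x else 0)"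
  using complex by (simp add: chain_complex_def)

lemma finite_proj: "finite {n. proj A n x \<noteq> 0}"
  using complex unfolding chain_complex_def by blast

lemma sum_proj: "(\<Sum>n | proj A n x \<noteq> 0. proj A n x) = x"
proof -
  have "x = (\<Sum>n | proj A n x \<noteq> 0. proj A n x)"
    using complex unfolding chain_complex_def by blast
  then show ?thesis by (rule sym)
qed

lemma degree_dif: "degree_map A A (- 1) (dif A)"
  using complex by (simp add: chain_complex_def)

lemma linear_dif: "Vector_Spaces.linear (scl A) (scl A) (dif A)"
  using degree_dif by (simp add: degree_map_def linear_map_def)

lemma dif_dif [simp]: "dif A (dif A x) = 0"
  using complex by (simp add: chain_complex_def)

sublocale pr: Vector_Spaces.linear "scl A" "scl A" "proj A n" for n by (rule linear_proj)
sublocale df: Vector_Spaces.linear "scl A" "scl A" "dif A" by (rule linear_dif)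

lemma proj_ext: "(\<And>n. proj A n x = proj A n y) \<Longrightarrow> x = y"
proof -
  assume "\<And>n. proj A n x = proj A n y"
  then have "(\<Sum>n | proj A n x \<noteq> 0. proj A n x) = (\<Sum>n | proj A n y \<noteq> 0. proj A n y)" by simp
  then show "x = y" unfolding sum_proj .
qed

lemma tau_superset:
  assumes "finite K" "{n. proj A n x \<noteq> 0} \<subseteq> K"
  shows "tau A x = (\<Sum>n\<in>K. scl A (parity_sgn n) (proj A n x))"
proof -
  have "tau A x = (\<Sum>n | proj A n x \<noteq> 0. scl A (parity_sgn n) (proj A n x))"
    unfolding tau_def by (rule sum.cong) auto
  also have "\<dots> = (\<Sum>n\<in>K. scl A (parity_sgn n) (proj A n x))"
    using assms by (intro sum.mono_neutral_left) auto
  finally show ?thesis .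
qed

lemma proj_tau: "proj A n (tau A x) = scl A (parity_sgn n) (proj A n x)"
proof -
  have "proj A n (tau A x) = (\<Sum>m | proj A m x \<noteq> 0. proj A n (scl A (parity_sgn m) (proj A m x)))"
    unfolding tau_superset[OF finite_proj order_refl, of x] pr.sum ..
  also have "\<dots> = (\<Sum>m | proj A m x \<noteq> 0. if n = m then scl A (parity_sgn n) (proj A n x) else 0)"
  proof (rule sum.cong[OF refl])
    show "proj A n (scl A (parity_sgn m) (proj A m x)) = (if n = m then scl A (parity_sgn n) (proj A n x) else 0)" for m
      unfolding pr.scale proj_proj by (cases "n = m") (simp_all only: if_True if_False scale_zero_right refl)
  qed
  also have "\<dots> = scl A (parity_sgn n) (proj A n x)"
    by (simp add: sum.delta'[OF finite_proj])
  finally show ?thesis .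
qed

lemma linear_tau: "Vector_Spaces.linear (scl A) (scl A) (tau A)"
proof unfold_locales
  show "tau A (x + y) = tau A x + tau A y" for x y
    by (rule proj_ext) (simp only: proj_tau pr.add scale_right_distrib)
  show "tau A (scl A c x) = scl A c (tau A x)" for c x
    by (rule proj_ext) (simp only: proj_tau pr.scale scale_left_commute)
qed

sublocale ta: Vector_Spaces.linear "scl A" "scl A" "tau A" by (rule linear_tau)

lemma tau_tau [simp]: "tau A (tau A x) = x"
  by (rule proj_ext) (simp add: proj_tau)

lemma tau_comp_tau: "tau A \<circ> tau A = id"
  by (simp add: fun_eq_iff)

lemma tau_homogeneous: "proj A d x = x \<Longrightarrow> tau A x = scl A (parity_sgn d) x"
  by (rule proj_ext) (metis (no_types, lifting) proj_proj proj_tau pr.scale scale_zero_right)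

lemma tau_expand: "tau A x = (\<Sum>n | proj A n x \<noteq> 0. scl A (parity_sgn n) (proj A n x))"
  by (rule tau_superset[OF finite_proj order_refl])

lemma linear_tau_pow: "Vector_Spaces.linear (scl A) (scl A) (tau A ^^ n)"
proof (induction n)
  case 0
  show ?case by (auto intro!: linear_id[unfolded id_def])
next
  case (Suc n)
  then show ?case using Vector_Spaces.linear_compose[OF Suc linear_tau] by (simp add: comp_def)
qed

lemma tau_pow: "(tau A ^^ n) x = (if even n then x else tau A x)"
  by (induction n) auto

lemma tau_pow_fun: "tau A ^^ n = (if even n then id else tau A)"
  by (auto simp: fun_eq_iff tau_pow)

end

text \<open>
  The Koszul sign rule in terms of the parity involutions.
\<close>

lemma degree_map_tau:
  assumes "chain_complex X" "chain_complex Y" "degree_map X Y k f"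
  shows "f (tau X x) = scl Y (parity_sgn k) (tau Y (f x))"
proof -
  interpret X: complex X by unfold_locales fact
  interpret Y: complex Y by unfold_locales fact
  interpret f: Vector_Spaces.linear "scl X" "scl Y" f
    using assms(3) by (simp add: degree_map_def linear_map_def)
  have f: "proj Y m (f x) = f (proj X (m - k) x)" for m x
    using assms(3) by (metis degree_map_def diff_add_cancel)
  show ?thesis
    by (rule Y.proj_ext) (auto simp: f Y.pr.scale X.proj_tau Y.proj_tau f.scale f.neg Y.pr.neg)
qed

context complex
begin

lemma dif_tau: "dif A (tau A x) = - tau A (dif A x)"
  using degree_map_tau[OF complex complex degree_dif] by simp

lemma End_op_linear:
  assumes "End_op A m k g" "length us + 1 + length vs = m"
  shows "Vector_Spaces.linear (scl A) (scl A) (\<lambda>x. g (us @ x # vs))"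
  using assms by (simp add: End_op_def linear_map_def)

text \<open>
  The degree of an operation is only prescribed at homogeneous arguments. The general case follows
  by splitting the arguments into their components one after the other, from left to right.
\<close>

lemma End_op_tau:
  assumes "End_op A m k g" "length xs = m"
  shows "tau A (g xs) = scl A (parity_sgn k) (g (map (tau A) xs))"
proof -
  have "tau A (g (ys @ zs)) = scl A (parity_sgn (k + sum_list ds)) (g (ys @ map (tau A) zs))"
    if "list_all2 (\<lambda>x d. proj A d x = x) ys ds" "length ys + length zs = m" for ys zs ds
    using that
  proof (induction zs arbitrary: ys ds)
    case Nil
    then have "proj A (sum_list ds + k) (g ys) = g ys"
      using assms(1) by (simp add: End_op_def)
    then show ?case by (simp add: tau_homogeneous add.commute)
  next
    case (Cons z zs)
    let ?N = "{n. proj A n z \<noteq> 0}"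
    interpret l: Vector_Spaces.linear "scl A" "scl A" "\<lambda>x. g (ys @ x # zs)"
      by (rule End_op_linear[OF assms(1)]) (use Cons.prems in simp)
    interpret r: Vector_Spaces.linear "scl A" "scl A" "\<lambda>x. g (ys @ x # map (tau A) zs)"
      by (rule End_op_linear[OF assms(1)]) (use Cons.prems in simp)
    have "tau A (g (ys @ z # zs)) = (\<Sum>n\<in>?N. tau A (g (ys @ proj A n z # zs)))"
      by (subst sum_proj[of z, symmetric]) (simp add: l.sum ta.sum)
    also have "\<dots> = (\<Sum>n\<in>?N. scl A (parity_sgn (k + (sum_list ds + n)))
        (g (ys @ proj A n z # map (tau A) zs)))"
    proof (rule sum.cong[OF refl])
      fix n
      have "list_all2 (\<lambda>x d. proj A d x = x) (ys @ [proj A n z]) (ds @ [n])"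
        using Cons.prems by (simp add: proj_proj list_all2_appendI)
      from Cons.IH[OF this] show "tau A (g (ys @ proj A n z # zs)) =
          scl A (parity_sgn (k + (sum_list ds + n))) (g (ys @ proj A n z # map (tau A) zs))"
        using Cons.prems by simp
    qed
    also have "\<dots> = scl A (parity_sgn (k + sum_list ds)) (\<Sum>n\<in>?N. scl A (parity_sgn n)
        (g (ys @ proj A n z # map (tau A) zs)))"
      unfolding scale_sum_right by (rule sum.cong) auto
    also have "(\<Sum>n\<in>?N. scl A (parity_sgn n) (g (ys @ proj A n z # map (tau A) zs))) =
        g (ys @ tau A z # map (tau A) zs)"
      by (simp add: tau_expand[of z] r.sum r.scale)
    finally show ?case by simp
  qed
  from this[of "[]" "[]" xs] show ?thesis using assms(2) by simp
qed

end

section \<open>Multilinearity of labels\<close>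

definition eqv :: "('k::field_char_0, 'a::ab_group_add) cplx \<Rightarrow> ('a tree \<Rightarrow>\<^sub>0 'k)
    \<Rightarrow> ('a tree \<Rightarrow>\<^sub>0 'k) \<Rightarrow> bool" where
  "eqv A u v \<longleftrightarrow> u - v \<in> rel1 A"

abbreviation slots1 :: "('a \<Rightarrow> 'a tree) set" where
  "slots1 \<equiv> slots {\<lambda>x. x}"

lemma subspace_multilin: "fv.subspace (multilin A B)"
  unfolding multilin_def by (rule fv.subspace_span)

lemma multilin_add: "\<sigma> \<in> B \<Longrightarrow> gen (\<sigma> (x + y)) - gen (\<sigma> x) - gen (\<sigma> y) \<in> multilin A B"
  unfolding multilin_def by (rule fv.span_base) blast

lemma multilin_scl: "\<sigma> \<in> B \<Longrightarrow> gen (\<sigma> (scl A c x)) - fsc c (gen (\<sigma> x)) \<in> multilin A B"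
  unfolding multilin_def by (rule fv.span_base) blast

text \<open>
  The relations are a span, so a linear map sends them into a subspace as soon as it does so with
  the generators.
\<close>

lemma multilin_induct:
  assumes "v \<in> multilin A B" "Vector_Spaces.linear fsc s \<phi>" "module.subspace s S"
    and "\<And>\<sigma> x y. \<sigma> \<in> B \<Longrightarrow> \<phi> (gen (\<sigma> (x + y)) - gen (\<sigma> x) - gen (\<sigma> y)) \<in> S"
    and "\<And>\<sigma> c x. \<sigma> \<in> B \<Longrightarrow> \<phi> (gen (\<sigma> (scl A c x)) - fsc c (gen (\<sigma> x))) \<in> S"
  shows "\<phi> v \<in> S"
proof -
  interpret l: Vector_Spaces.linear fsc s \<phi> by fact
  have "fv.subspace (\<phi> -` S)"
    using l.subspace_vimage[OF assms(3)] by (simp add: vimage_def)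
  then have "multilin A B \<subseteq> \<phi> -` S"
    unfolding multilin_def by (rule fv.span_minimal[rotated]) (use assms(4,5) in auto)
  then show ?thesis using assms(1) by auto
qed

lemma eqv_refl [simp]: "eqv A u u"
  by (simp add: eqv_def fv.subspace_0[OF subspace_multilin])

lemma eqv_sym: "eqv A u v \<Longrightarrow> eqv A v u"
  unfolding eqv_def using fv.subspace_neg[OF subspace_multilin] by fastforce

lemma eqv_trans [trans]: "eqv A u v \<Longrightarrow> eqv A v w \<Longrightarrow> eqv A u w"
  unfolding eqv_def using fv.subspace_add[OF subspace_multilin] by fastforce

lemma eqv_eq_trans [trans]: "eqv A u v \<Longrightarrow> v = w \<Longrightarrow> eqv A u w"
  and eq_eqv_trans [trans]: "u = v \<Longrightarrow> eqv A v w \<Longrightarrow> eqv A u w"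
  by simp_all

lemma eqv_add: "eqv A u v \<Longrightarrow> eqv A u' v' \<Longrightarrow> eqv A (u + u') (v + v')"
  unfolding eqv_def using fv.subspace_add[OF subspace_multilin] by (fastforce simp: algebra_simps)

lemma eqv_fsc: "eqv A u v \<Longrightarrow> eqv A (fsc c u) (fsc c v)"
  unfolding eqv_def using fv.subspace_scale[OF subspace_multilin]
  by (fastforce simp flip: fv.scale_right_diff_distrib)

lemma eqv_neg: "eqv A u v \<Longrightarrow> eqv A (- u) (- v)"
  using eqv_fsc[of A u v "- 1"] by (simp add: fv.scale_minus_left)

lemma eqv_diff: "eqv A u v \<Longrightarrow> eqv A u' v' \<Longrightarrow> eqv A (u - u') (v - v')"
  using eqv_add[OF _ eqv_neg, of A u v u' v'] by simp

lemma eqv_sum: "(\<And>x. x \<in> X \<Longrightarrow> eqv A (f x) (g x)) \<Longrightarrow> eqv A (sum f X) (sum g X)"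
  unfolding eqv_def sum_subtractf[symmetric] by (rule fv.subspace_sum[OF subspace_multilin])

lemma eqv_lext: "(\<And>x. x \<in> supp v \<Longrightarrow> eqv A (f x) (g x)) \<Longrightarrow> eqv A (lext f v) (lext g v)"
  unfolding lext_def by (intro eqv_sum eqv_fsc)

lemma MuF_rel1_gen: "u \<in> rel1 A \<Longrightarrow> MuF u (gen r) \<in> rel1 A" "u \<in> rel1 A \<Longrightarrow> MuF (gen r) u \<in> rel1 A"
  subgoal
    by (rule multilin_induct[OF _ MuF_linear_left subspace_multilin])
      (use multilin_add[OF slots.intros(2)] multilin_scl[OF slots.intros(2)] in auto)
  subgoal
    by (rule multilin_induct[OF _ MuF_linear_right subspace_multilin])
      (use multilin_add[OF slots.intros(3)] multilin_scl[OF slots.intros(3)] in auto)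
  done

lemma MuF_rel1: "u \<in> rel1 A \<Longrightarrow> MuF u v \<in> rel1 A" "u \<in> rel1 A \<Longrightarrow> MuF v u \<in> rel1 A"
  by (subst MuF_eq(2), rule lext_in_subspace[OF subspace_multilin MuF_rel1_gen(1)], assumption)
    (subst MuF_eq(1), rule lext_in_subspace[OF subspace_multilin MuF_rel1_gen(2)], assumption)

lemma eqv_MuF: "eqv A u v \<Longrightarrow> eqv A u' v' \<Longrightarrow> eqv A (MuF u u') (MuF v v')"
proof -
  assume "eqv A u v" "eqv A u' v'"
  then have "MuF (u - v) u' + MuF v (u' - v') \<in> rel1 A"
    unfolding eqv_def by (intro fv.subspace_add[OF subspace_multilin] MuF_rel1)
  then show ?thesis by (simp add: eqv_def)
qed

text \<open>
  Trees depend on each label linearly only modulo the relations of the target. For a function on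
  trees that is built by recursion, this property along all slots makes its linear extension well
  defined on the quotients.
\<close>

definition qlin :: "('k::field_char_0, 'a::ab_group_add) cplx \<Rightarrow> ('k, 'b::ab_group_add) cplx
    \<Rightarrow> ('a \<Rightarrow> ('b tree \<Rightarrow>\<^sub>0 'k)) \<Rightarrow> bool" where
  "qlin A B \<phi> \<longleftrightarrow> (\<forall>x y. eqv B (\<phi> (x + y)) (\<phi> x + \<phi> y)) \<and>
     (\<forall>c x. eqv B (\<phi> (scl A c x)) (fsc c (\<phi> x)))"

lemma qlin_slot:
  assumes "\<sigma> \<in> slots1"
  shows "qlin A A (\<lambda>x. gen (\<sigma> x))"
  using multilin_add[OF assms, where A = A] multilin_scl[OF assms, where A = A] by (simp add: qlin_def eqv_def diff_diff_eq)

lemma qlin_comp: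
  assumes "Vector_Spaces.linear (scl A) (scl B) \<psi>" "qlin B C \<phi>"
  shows "qlin A C (\<lambda>x. \<phi> (\<psi> x))"
proof -
  interpret l: Vector_Spaces.linear "scl A" "scl B" \<psi> by fact
  show ?thesis using assms(2) by (simp add: qlin_def l.add l.scale)
qed

lemma qlin_Lf: "Vector_Spaces.linear (scl A) (scl B) \<psi> \<Longrightarrow> qlin A B (\<lambda>x. gen (Lf (\<psi> x)))"
  by (rule qlin_comp[where B = B and C = B]) (auto intro: qlin_slot slots.intros)

lemma qlin_Lf_id: "qlin A A (\<lambda>x. gen (Lf x))"
  by (auto intro: qlin_slot slots.intros)

lemma qlin_add: "qlin A B \<phi> \<Longrightarrow> qlin A B \<psi> \<Longrightarrow> qlin A B (\<lambda>x. \<phi> x + \<psi> x)"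
  unfolding qlin_def
  by (smt (verit, del_insts) eqv_add add.assoc add.left_commute fv.scale_right_distrib)

lemma qlin_fsc: "qlin A B \<phi> \<Longrightarrow> qlin A B (\<lambda>x. fsc c (\<phi> x))"
  unfolding qlin_def by (metis eqv_fsc fv.scale_left_commute fv.scale_right_distrib)

lemma qlin_neg: "qlin A B \<phi> \<Longrightarrow> qlin A B (\<lambda>x. - \<phi> x)"
  using qlin_fsc[of A B \<phi> "-1"] by (simp add: fv.scale_minus_left)

lemma qlin_diff: "qlin A B \<phi> \<Longrightarrow> qlin A B \<psi> \<Longrightarrow> qlin A B (\<lambda>x. \<phi> x - \<psi> x)"
  using qlin_add[OF _ qlin_neg, of A B \<phi> \<psi>] by simp

lemma qlin_MuF:
  assumes "qlin A B \<phi>"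
  shows "qlin A B (\<lambda>x. MuF (\<phi> x) v)" "qlin A B (\<lambda>x. MuF v (\<phi> x))"
proof -
  have *: "eqv B (\<phi> (x + y)) (\<phi> x + \<phi> y)" "eqv B (\<phi> (scl A c x)) (fsc c (\<phi> x))" for x y c
    using assms by (simp_all add: qlin_def)
  show "qlin A B (\<lambda>x. MuF (\<phi> x) v)"
    using *[THEN eqv_MuF[OF _ eqv_refl[of B v]]] by (simp add: qlin_def)
  show "qlin A B (\<lambda>x. MuF v (\<phi> x))"
    using *[THEN eqv_MuF[OF eqv_refl[of B v]]] by (simp add: qlin_def)
qed

lemma rel1_lext:
  fixes F :: "'a::ab_group_add tree \<Rightarrow> ('b::ab_group_add tree \<Rightarrow>\<^sub>0 'k::field_char_0)"
  assumes "\<And>\<sigma>. \<sigma> \<in> slots1 \<Longrightarrow> qlin A B (\<lambda>x. F (\<sigma> x))"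
  shows "v \<in> rel1 A \<Longrightarrow> lext F v \<in> rel1 B"
proof (erule multilin_induct[OF _ lext_linear subspace_multilin])
  fix \<sigma> :: "'a \<Rightarrow> 'a tree" and x y c assume "\<sigma> \<in> slots1"
  from assms[OF this]
  show "lext F (gen (\<sigma> (x + y)) - gen (\<sigma> x) - gen (\<sigma> y)) \<in> rel1 B"
    "lext F (gen (\<sigma> (scl A c x)) - fsc c (gen (\<sigma> x))) \<in> rel1 B"
    by (simp_all add: qlin_def eqv_def diff_diff_eq)
qed

lemma eqv_lext_cong:
  assumes "\<And>\<sigma>. \<sigma> \<in> slots1 \<Longrightarrow> qlin A B (\<lambda>x. F (\<sigma> x))"
  shows "eqv A u v \<Longrightarrow> eqv B (lext F u) (lext F v)"
  unfolding eqv_def using rel1_lext[OF assms] by fastforce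

text \<open>
  Linear extensions with values in a complex descend to the quotient if they are multilinear.
\<close>

lemma rel1_gext:
  fixes g :: "'a::ab_group_add tree \<Rightarrow> 'b::ab_group_add"
  assumes "\<And>\<sigma>. \<sigma> \<in> slots1 \<Longrightarrow> Vector_Spaces.linear (scl A) s (\<lambda>x. g (\<sigma> x))" "vector_space s"
  shows "v \<in> rel1 A \<Longrightarrow> gext s g v = 0"
proof -
  assume v: "v \<in> rel1 A"
  interpret s: vector_space s by fact
  interpret g: Vector_Spaces.linear fsc s "gext s g" by (rule gext_linear) fact
  have "gext s g v \<in> {0}"
  proof (rule multilin_induct[OF v gext_linear[OF assms(2)] s.subspace_single_0])
    fix \<sigma> :: "'a \<Rightarrow> 'a tree" and x y c assume "\<sigma> \<in> slots1"
    then interpret l: Vector_Spaces.linear "scl A" s "\<lambda>x. g (\<sigma> x)" by (rule assms)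
    show "gext s g (gen (\<sigma> (x + y)) - gen (\<sigma> x) - gen (\<sigma> y)) \<in> {0}"
      using assms(2) by (simp add: g.diff l.add)
    show "gext s g (gen (\<sigma> (scl A c x)) - fsc c (gen (\<sigma> x))) \<in> {0}"
      using assms(2) by (simp add: g.diff g.scale l.scale)
  qed
  then show ?thesis by simp
qed

lemma qlin_linear:
  assumes "vector_space (scl A)" "Vector_Spaces.linear fsc s \<psi>" "\<And>v. v \<in> rel1 B \<Longrightarrow> \<psi> v = 0" "qlin A B \<phi>"
  shows "Vector_Spaces.linear (scl A) s (\<lambda>x. \<psi> (\<phi> x))"
proof -
  interpret l: Vector_Spaces.linear fsc s \<psi> by fact
  interpret A: vector_space "scl A" by fact
  have *: "\<psi> u = \<psi> v" if "eqv B u v" for u v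
    using assms(3)[of "u - v"] that by (simp add: eqv_def l.diff)
  show ?thesis
  proof unfold_locales
    show "\<psi> (\<phi> (x + y)) = \<psi> (\<phi> x) + \<psi> (\<phi> y)" for x y
      using *[of "\<phi> (x + y)" "\<phi> x + \<phi> y"] assms(4) by (simp add: qlin_def l.add)
    show "\<psi> (\<phi> (scl A c x)) = s c (\<psi> (\<phi> x))" for c x
      using *[of "\<phi> (scl A c x)" "fsc c (\<phi> x)"] assms(4) by (simp add: qlin_def l.scale)
  qed
qed

section \<open>Trees and their labels\<close>

lemma verts_map_tree [simp]: "verts (map_tree g t) = verts t"
  by (induction t) auto

lemma arity_map_tree [simp]: "arity (map_tree g t) = arity t"
  by (induction t) auto

lemma length_labels [simp]: "length (labels \<tau> t) = arity t"
  by (induction t) auto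

lemma verts_place [simp]: "verts (place \<tau> w xs) = verts w"
  by (induction w arbitrary: xs) auto

lemma arity_place [simp]: "arity (place \<tau> w xs) = arity w"
  by (induction w arbitrary: xs) auto

lemma shape_place [simp]: "shape (place \<tau> w xs) = w"
  by (induction w arbitrary: xs) auto

lemma shape_eq_Lf_iff [simp]: "shape t = Lf () \<longleftrightarrow> (\<exists>x. t = Lf x)"
  by (cases t) auto

lemma place_eq_Lf_iff [simp]: "(\<exists>x. place \<tau> w xs = Lf x) \<longleftrightarrow> w = Lf ()"
  by (cases w) auto

lemma map_funpow: "map (f ^^ n) (map f xs) = map f (map (f ^^ n) xs)"
  by (simp add: funpow_swap1)

lemma map_tree_place: "arity w = length xs \<Longrightarrow> map_tree \<tau> (place \<tau> w xs) = place \<tau> w (map \<tau> xs)"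
proof (induction w arbitrary: xs)
  case (Lf x)
  then show ?case by (cases xs) auto
qed (auto simp: take_map drop_map map_funpow simp del: map_map)

lemma labels_map_tree: "labels \<tau> (map_tree \<tau> t) = map \<tau> (labels \<tau> t)"
  by (induction t) (auto simp: funpow_swap1)

lemma involution_pow:
  assumes "\<tau> \<circ> \<tau> = id"
  shows "(\<tau> ^^ n) ((\<tau> ^^ n) x) = x"
proof -
  have "(\<tau> ^^ n) x = (if even n then x else \<tau> x)" for x n
    using assms by (induction n) (auto simp: fun_eq_iff)
  then show ?thesis using assms by (simp add: fun_eq_iff)
qed

lemma labels_place:
  assumes "\<tau> \<circ> \<tau> = id"
  shows "arity w = length xs \<Longrightarrow> labels \<tau> (place \<tau> w xs) = xs"
proof (induction w arbitrary: xs)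
  case (Lf x)
  then show ?case by (cases xs) auto
qed (auto simp: involution_pow[OF assms] comp_def)

lemma place_labels:
  assumes "\<tau> \<circ> \<tau> = id"
  shows "place \<tau> (shape t) (labels \<tau> t) = t"
  by (induction t) (auto simp: involution_pow[OF assms] comp_def)

text \<open>
  This fact and its converse \<open>place_slot\<close> translate between positions in a tree and
  positions in a list of labels; the power of the involution is the sign of the vertices passed by
  the variable.
\<close>

lemma slots_shape:
  assumes "\<sigma> \<in> slots1"
  obtains w us vs e where "\<And>x. shape (\<sigma> x) = w" "\<And>x. labels \<tau> (\<sigma> x) = us @ (\<tau> ^^ e) x # vs"
    "length us + 1 + length vs = arity w" "(\<exists>x y. \<sigma> x = Lf y) \<Longrightarrow> \<sigma> = Lf"
proof -
  have "\<exists>w us vs e. (\<forall>x. shape (\<sigma> x) = w \<and> labels \<tau> (\<sigma> x) = us @ (\<tau> ^^ e) x # vs) \<and>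
      length us + 1 + length vs = arity w \<and> ((\<exists>x y. \<sigma> x = Lf y) \<longrightarrow> \<sigma> = Lf)"
    using assms
  proof (induction rule: slots.induct)
    case (1 \<sigma>)
    then show ?case by (intro exI[of _ "Lf ()"] exI[of _ "[]"] exI[of _ 0]) auto
  next
    case (2 \<sigma> r)
    then obtain w us vs e where *: "\<And>x. shape (\<sigma> x) = w"
      "\<And>x. labels \<tau> (\<sigma> x) = us @ (\<tau> ^^ e) x # vs" "length us + 1 + length vs = arity w"
      by blast
    show ?case
      by (rule exI[of _ "Mu w (shape r)"], rule exI[of _ "map (\<tau> ^^ verts r) us"],
          rule exI[of _ "map (\<tau> ^^ verts r) vs @ labels \<tau> r"], rule exI[of _ "verts r + e"])
        (use * in \<open>auto simp: funpow_add simp flip: *(3)\<close>)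
  next
    case (3 \<sigma> l)
    then obtain w us vs e where *: "\<And>x. shape (\<sigma> x) = w"
      "\<And>x. labels \<tau> (\<sigma> x) = us @ (\<tau> ^^ e) x # vs" "length us + 1 + length vs = arity w"
      by blast
    have v: "verts (\<sigma> x) = verts w" for x by (metis *(1) verts_map_tree)
    show ?case
      by (rule exI[of _ "Mu (shape l) w"], rule exI[of _ "map (\<tau> ^^ verts w) (labels \<tau> l) @ us"],
          rule exI[of _ vs], rule exI[of _ e])
        (use * v in \<open>auto simp flip: *(3)\<close>)
  qed
  then show ?thesis using that by blast
qed

lemma slots_verts: "\<sigma> \<in> slots1 \<Longrightarrow> verts (\<sigma> x) = verts (\<sigma> y)"
  by (rule slots_shape[of \<sigma> id]) (auto, metis verts_map_tree)

lemma slots_map_tree: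
  assumes "\<sigma> \<in> slots1"
  shows "\<exists>\<sigma>'\<in>slots1. \<forall>x. map_tree g (\<sigma> x) = \<sigma>' (g x)"
  using assms
proof (induction rule: slots.induct)
  case (1 \<sigma>)
  then show ?case by (intro bexI[of _ Lf]) (auto intro: slots.intros(1)[of "\<lambda>x. x" "{\<lambda>x. x}", simplified])
next
  case (2 \<sigma> r)
  then obtain \<sigma>' where "\<sigma>' \<in> slots1" "\<forall>x. map_tree g (\<sigma> x) = \<sigma>' (g x)" by blast
  then show ?case by (intro bexI[of _ "\<lambda>x. Mu (\<sigma>' x) (map_tree g r)"]) (auto intro: slots.intros)
next
  case (3 \<sigma> l)
  then obtain \<sigma>' where "\<sigma>' \<in> slots1" "\<forall>x. map_tree g (\<sigma> x) = \<sigma>' (g x)" by blast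
  then show ?case by (intro bexI[of _ "\<lambda>x. Mu (map_tree g l) (\<sigma>' x)"]) (auto intro: slots.intros)
qed

lemma place_slot:
  assumes "length us + 1 + length vs = arity w"
  shows "\<exists>\<sigma>\<in>slots1. \<exists>e. \<forall>x. place \<tau> w (us @ x # vs) = \<sigma> ((\<tau> ^^ e) x)"
  using assms
proof (induction w arbitrary: us vs)
  case (Lf u)
  then show ?case
    by (intro bexI[of _ Lf] exI[of _ 0]) (auto intro: slots.intros(1)[of "\<lambda>x. x" "{\<lambda>x. x}", simplified])
next
  case Cork
  then show ?case by simp
next
  case (Mu l r)
  show ?case
  proof (cases "length us < arity l")
    case True
    define ws where "ws = take (arity l - length us - 1) vs"
    define vs' where "vs' = drop (arity l - length us - 1) vs"
    have "length us + 1 + length ws = arity l" using True Mu.prems by (auto simp: ws_def)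
    then have "length (map (\<tau> ^^ verts r) us) + 1 + length (map (\<tau> ^^ verts r) ws) = arity l" by simp
    from Mu.IH(1)[OF this] obtain \<sigma> e where \<sigma>: "\<sigma> \<in> slots1"
      "\<And>x. place \<tau> l (map (\<tau> ^^ verts r) us @ x # map (\<tau> ^^ verts r) ws) = \<sigma> ((\<tau> ^^ e) x)" by blast
    have t: "take (arity l) (us @ x # vs) = us @ x # ws" for x
      using True by (cases "arity l - length us") (auto simp: ws_def)
    have d: "drop (arity l) (us @ x # vs) = vs'" for x
      using True by (cases "arity l - length us") (auto simp: vs'_def)
    have "place \<tau> (Mu l r) (us @ x # vs) = Mu (\<sigma> ((\<tau> ^^ (e + verts r)) x)) (place \<tau> r vs')" for x
      unfolding place.simps t d list.map map_append \<sigma>(2) funpow_add by simp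
    then show ?thesis using slots.intros(2)[OF \<sigma>(1), of "place \<tau> r vs'"]
      by (intro bexI[of _ "\<lambda>x. Mu (\<sigma> x) (place \<tau> r vs')"] exI[of _ "e + verts r"]) auto
  next
    case False
    define us' where "us' = drop (arity l) us"
    have "length us' + 1 + length vs = arity r" using False Mu.prems by (auto simp: us'_def)
    from Mu.IH(2)[OF this] obtain \<sigma> e where \<sigma>: "\<sigma> \<in> slots1"
      "\<And>x. place \<tau> r (us' @ x # vs) = \<sigma> ((\<tau> ^^ e) x)" by blast
    show ?thesis
      by (rule bexI[of _ "\<lambda>x. Mu (place \<tau> l (map (\<tau> ^^ verts r) (take (arity l) us))) (\<sigma> x)"], rule exI[of _ e])
        (use False in \<open>auto simp: \<sigma> slots.intros simp flip: us'_def\<close>)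
  qed
qed

section \<open>The predifferential\<close>

text \<open>
  \<open>root_op\<close> is the part of the predifferential that ends in a single label.
  \<open>top_op\<close> differs from it on single labels only; it is the contribution of the
  higher operations.
\<close>

definition top_op :: "(unit tree \<Rightarrow> 'a list \<Rightarrow> 'a) \<Rightarrow> ('k, 'a::ab_group_add) cplx \<Rightarrow> 'a tree \<Rightarrow> 'a" where
  "top_op \<gamma> A t = (case t of Lf a \<Rightarrow> 0 | _ \<Rightarrow> \<gamma> (shape t) (labels (tau A) t))"

definition root_op :: "(unit tree \<Rightarrow> 'a list \<Rightarrow> 'a) \<Rightarrow> ('k, 'a::ab_group_add) cplx \<Rightarrow> 'a tree \<Rightarrow> 'a" where
  "root_op \<gamma> A t = (case t of Lf a \<Rightarrow> dif A a | _ \<Rightarrow> \<gamma> (shape t) (labels (tau A) t))"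

text \<open>
  \<open>t \<mapsto> (-1)\<^bsup>|t|\<^esup> t\<close> for the total degree \<open>|t|\<close>,
  which counts the vertices and the degrees of the labels.
\<close>

definition sgn_map :: "('x \<Rightarrow> 'x) \<Rightarrow> 'x tree \<Rightarrow> ('x tree \<Rightarrow>\<^sub>0 'k::field_char_0)" where
  "sgn_map \<tau> t = fsc ((-1) ^ verts t) (gen (map_tree \<tau> t))"

definition inner_dif :: "('k::field_char_0, 'a::ab_group_add) cplx \<Rightarrow> (unit tree \<Rightarrow> 'a list \<Rightarrow> 'a)
    \<Rightarrow> 'a tree \<Rightarrow> ('a tree \<Rightarrow>\<^sub>0 'k)" where
  "inner_dif A \<gamma> t = (case t of Mu l r \<Rightarrow>
      - MuF (bar_dif A \<gamma> l) (gen r) - MuF (sgn_map (tau A) l) (bar_dif A \<gamma> r) | _ \<Rightarrow> 0)"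

lemma bar_dif_split: "bar_dif A \<gamma> t = gen (Lf (root_op \<gamma> A t)) + inner_dif A \<gamma> t"
  by (cases t) (auto simp: root_op_def inner_dif_def sgn_map_def)

text \<open>
  The inner part of the predifferential is a derivation with respect to adding a vertex of degree
  1 at the root.
\<close>

lemma inner_dif_MuF:
  "lext (inner_dif A \<gamma>) (MuF u v) =
    - MuF (lext (bar_dif A \<gamma>) u) v - MuF (lext (sgn_map (tau A)) u) (lext (bar_dif A \<gamma>) v)"
proof -
  have "lext (inner_dif A \<gamma>) (MuF u v) = lext (\<lambda>s. lext (\<lambda>t. - MuF (bar_dif A \<gamma> s) (gen t)) v) u -
      lext (\<lambda>s. lext (\<lambda>t. MuF (sgn_map (tau A) s) (bar_dif A \<gamma> t)) v) u"
    by (simp add: lext_MuF inner_dif_def lext_fun_diff)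
  also have "lext (\<lambda>s. lext (\<lambda>t. - MuF (bar_dif A \<gamma> s) (gen t)) v) u =
      lext (\<lambda>s. - MuF (bar_dif A \<gamma> s) v) u"
    by (simp add: lext_fun_neg flip: MuF_eq(2))
  also have "\<dots> = - MuF (lext (bar_dif A \<gamma>) u) v"
    by (simp add: lext_fun_neg MuF_lext)
  finally show ?thesis by (simp add: MuF_lext(1)) (simp add: MuF_lext(2))
qed

text \<open>
  Only the multilinearity and the degrees of the operations are assumed here, so that this can be
  used for the transferred operations before their relations are known.
\<close>

locale ops = complex A
  for A :: "('k::field_char_0, 'a::ab_group_add) cplx" +
  fixes \<gamma> :: "unit tree \<Rightarrow> 'a list \<Rightarrow> 'a"
  assumes End: "\<And>w. w \<noteq> Lf () \<Longrightarrow> End_op A (arity w) (int (verts w) - 1) (\<gamma> w)"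
begin

abbreviation "D \<equiv> bar_dif A \<gamma>"

text \<open>
  The differential of \<open>A\<close>, an operation of degree \<open>-1\<close> with one input,
  takes the place of the operation of the tree \<open>|\<close>. With this convention
  \<open>d\<^sub>1\<close> and \<open>d\<^sub>2\<close> are given by the same formulae, since
  \<open>inf_decomp\<close> contains one entry with upper tree \<open>|\<close> for each leaf.
\<close>

definition \<gamma>d :: "unit tree \<Rightarrow> 'a list \<Rightarrow> 'a" where
  "\<gamma>d w xs = (if w = Lf () then dif A (hd xs) else \<gamma> w xs)"

lemma \<gamma>_tau: "w \<noteq> Lf () \<Longrightarrow> length xs = arity w \<Longrightarrow>
    tau A (\<gamma> w xs) = scl A ((-1) ^ Suc (verts w)) (\<gamma> w (map (tau A) xs))"
  using End_op_tau[OF End, of w xs] by (simp add: minus_one_power_iff)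

lemma \<gamma>d_tau: "length xs = arity w \<Longrightarrow>
    tau A (\<gamma>d w xs) = scl A ((-1) ^ Suc (verts w)) (\<gamma>d w (map (tau A) xs))"
  by (cases xs) (auto simp: \<gamma>d_def \<gamma>_tau dif_tau)

lemma \<gamma>d_tau_pow: "length xs = arity w \<Longrightarrow>
    (tau A ^^ n) (\<gamma>d w xs) = scl A ((-1) ^ (n * Suc (verts w))) (\<gamma>d w (map (tau A ^^ n) xs))"
  by (cases "even n") (auto simp: tau_pow_fun \<gamma>d_tau minus_one_power_iff)

lemma linear_slot:
  assumes "\<sigma> \<in> slots1"
  shows "Vector_Spaces.linear (scl A) (scl A) (\<lambda>x. root_op \<gamma> A (\<sigma> x))"
    "Vector_Spaces.linear (scl A) (scl A) (\<lambda>x. top_op \<gamma> A (\<sigma> x))"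
proof -
  obtain w us vs e where *: "\<And>x. shape (\<sigma> x) = w" "\<And>x. labels (tau A) (\<sigma> x) = us @ (tau A ^^ e) x # vs"
    "length us + 1 + length vs = arity w" "(\<exists>x y. \<sigma> x = Lf y) \<Longrightarrow> \<sigma> = Lf"
    by (rule slots_shape[OF assms, of "tau A"], rule that)
  show "Vector_Spaces.linear (scl A) (scl A) (\<lambda>x. root_op \<gamma> A (\<sigma> x))"
    "Vector_Spaces.linear (scl A) (scl A) (\<lambda>x. top_op \<gamma> A (\<sigma> x))"
  proof (atomize (full), cases "\<exists>x y. \<sigma> x = Lf y")
    case True
    have zero: "Vector_Spaces.linear (scl A) (scl A) (\<lambda>x. 0)" by unfold_locales auto
    from True have "\<sigma> = Lf" by (rule *)
    then show "Vector_Spaces.linear (scl A) (scl A) (\<lambda>x. root_op \<gamma> A (\<sigma> x)) \<and>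
        Vector_Spaces.linear (scl A) (scl A) (\<lambda>x. top_op \<gamma> A (\<sigma> x))"
      using linear_dif zero by (simp add: root_op_def top_op_def)
  next
    case False
    then have "w \<noteq> Lf ()" using *(1) by (metis shape_eq_Lf_iff)
    have "root_op \<gamma> A (\<sigma> x) = \<gamma> w (us @ (tau A ^^ e) x # vs)"
      "top_op \<gamma> A (\<sigma> x) = \<gamma> w (us @ (tau A ^^ e) x # vs)" for x
      using False *(1)[of x] *(2)[of x] by (auto simp: root_op_def top_op_def split: tree.splits)
    then show "Vector_Spaces.linear (scl A) (scl A) (\<lambda>x. root_op \<gamma> A (\<sigma> x)) \<and>
        Vector_Spaces.linear (scl A) (scl A) (\<lambda>x. top_op \<gamma> A (\<sigma> x))"
      using Vector_Spaces.linear_compose[OF linear_tau_pow End_op_linear[OF End[OF \<open>w \<noteq> Lf ()\<close>] *(3)]]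
      by (simp add: comp_def)
  qed
qed

lemma qlin_bar_dif: "\<sigma> \<in> slots1 \<Longrightarrow> qlin A A (\<lambda>x. D (\<sigma> x))"
proof (induction rule: slots.induct)
  case (1 \<sigma>)
  then show ?case by (simp add: qlin_Lf[OF linear_dif])
next
  case (2 \<sigma> r)
  obtain n where v: "\<And>x. verts (\<sigma> x) = n" using slots_verts[OF 2(1)] by blast
  obtain \<sigma>' where \<sigma>': "\<sigma>' \<in> slots1" "\<And>x. map_tree (tau A) (\<sigma> x) = \<sigma>' (tau A x)"
    using slots_map_tree[OF 2(1), of "tau A"] by blast
  show ?case
    unfolding bar_dif_split[of A \<gamma> "Mu _ _"] inner_dif_def sgn_map_def tree.case v \<sigma>'(2)
    by (intro qlin_add qlin_diff qlin_neg qlin_MuF qlin_fsc 2 qlin_Lf linear_slot slots.intros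
        qlin_comp[OF linear_tau] qlin_slot \<sigma>')
next
  case (3 \<sigma> l)
  show ?case
    unfolding bar_dif_split[of A \<gamma> "Mu _ _"] inner_dif_def tree.case
    by (intro qlin_add qlin_diff qlin_neg qlin_MuF 3 qlin_Lf linear_slot slots.intros qlin_slot)
qed

lemma eqv_bar_dif: "eqv A u v \<Longrightarrow> eqv A (lext D u) (lext D v)"
  by (rule eqv_lext_cong[OF qlin_bar_dif])

lemma place_scl:
  assumes "length us + 1 + length vs = arity w"
  shows "eqv A (gen (place (tau A) w (us @ scl A c x # vs))) (fsc c (gen (place (tau A) w (us @ x # vs))))"
proof -
  obtain \<sigma> e where \<sigma>: "\<sigma> \<in> slots1" "\<And>x. place (tau A) w (us @ x # vs) = \<sigma> ((tau A ^^ e) x)"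
    using place_slot[OF assms] by blast
  interpret l: Vector_Spaces.linear "scl A" "scl A" "tau A ^^ e" by (rule linear_tau_pow)
  show ?thesis using qlin_slot[OF \<sigma>(1), of A] by (simp add: \<sigma>(2) l.scale qlin_def)
qed

end

lemma inf_decomp_props:
  assumes "(e, b, j, u) \<in> set (inf_decomp w)"
  shows "verts b + verts u = verts w" "arity b + arity u = Suc (arity w)" "j < arity b"
proof -
  have "verts b + verts u = verts w \<and> arity b + arity u = Suc (arity w) \<and> j < arity b"
    using assms by (induction w arbitrary: e b j u) fastforce+
  then show "verts b + verts u = verts w" "arity b + arity u = Suc (arity w)" "j < arity b" by auto
qed

context ops
begin

text \<open>
  \<open>Suc (verts u)\<close> has the parity of the degree \<open>|u| - 1\<close> of the
  operation.
\<close>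

definition plug :: "'a list \<Rightarrow> nat \<Rightarrow> unit tree \<Rightarrow> 'a list" where
  "plug xs j u = map (tau A ^^ Suc (verts u)) (take j xs) @
     \<gamma>d u (take (arity u) (drop j xs)) # drop (j + arity u) xs"

lemma length_plug: "(e, b, j, u) \<in> set (inf_decomp w) \<Longrightarrow> length xs = arity w \<Longrightarrow>
    length (plug xs j u) = arity b"
  using inf_decomp_props[of e b j u w] by (auto simp: plug_def)

end

lemma eqv_sum_list:
  "(\<And>x. x \<in> set ys \<Longrightarrow> eqv A (f x) (g x)) \<Longrightarrow> eqv A (sum_list (map f ys)) (sum_list (map g ys))"
  by (induction ys) (auto intro: eqv_add)

lemma MuF_sum_list:
  "MuF (sum_list (map f ys)) v = sum_list (map (\<lambda>x. MuF (f x) v) ys)"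
  "MuF v (sum_list (map f ys)) = sum_list (map (\<lambda>x. MuF v (f x)) ys)"
  by (induction ys) auto

lemma neg_sum_list: "- sum_list (map f ys) = sum_list (map (\<lambda>x. - f x :: 'b::ab_group_add) ys)"
  by (induction ys) auto

lemma power_parity: "even (m + n) \<Longrightarrow> (-1 :: 'k::field_char_0) ^ m = (-1) ^ n"
  by (auto simp: minus_one_power_iff)

context ops
begin

text \<open>
  The predifferential is defined by recursion over the tree, the relations of an algebra by a sum
  over \<open>inf_decomp\<close>. The signs of \<open>inf_decomp\<close> are the ones that arise
  from writing the result in prefix order.
\<close>

lemma bar_dif_place:
  "length xs = arity w \<Longrightarrow> eqv A (D (place (tau A) w xs))
     (\<Sum>(e, b, j, u)\<leftarrow>inf_decomp w. fsc ((-1) ^ (e + verts b)) (gen (place (tau A) b (plug xs j u))))"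
proof (induction w arbitrary: xs)
  case (Lf x)
  then obtain y where "xs = [y]" by (cases xs) auto
  then show ?case by (simp add: plug_def \<gamma>d_def)
next
  case Cork
  then show ?case by (simp add: plug_def \<gamma>d_def)
next
  case (Mu l r)
  define xl where "xl = take (arity l) xs"
  define xl' where "xl' = map (tau A ^^ verts r) xl"
  define xr where "xr = drop (arity l) xs"
  have len: "length xl = arity l" "length xl' = arity l" "length xr = arity r" and xs: "xs = xl @ xr"
    using Mu.prems by (auto simp: xl_def xl'_def xr_def)
  let ?pl = "place (tau A) l xl'" and ?pr = "place (tau A) r xr"
  have pl: "place (tau A) (Mu l r) xs = Mu ?pl ?pr"
    by (simp add: xl'_def xl_def xr_def)
  let ?t = "\<lambda>(e, b, j, u). fsc ((-1) ^ (e + verts b)) (gen (place (tau A) b (plug xs j u)))"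
  let ?tl = "\<lambda>(e, b, j, u). fsc ((-1) ^ (e + verts b)) (gen (place (tau A) b (plug xl' j u)))"
  let ?tr = "\<lambda>(e, b, j, u). fsc ((-1) ^ (e + verts b)) (gen (place (tau A) b (plug xr j u)))"
  have 1: "eqv A (- MuF (D ?pl) (gen ?pr))
      (\<Sum>(e, b, j, u)\<leftarrow>inf_decomp l. ?t (e + verts u * verts r, Mu b r, j, u))"
  proof -
    have "eqv A (- MuF (D ?pl) (gen ?pr)) (- MuF (sum_list (map ?tl (inf_decomp l))) (gen ?pr))"
      by (intro eqv_neg eqv_MuF eqv_refl Mu.IH len)
    also have "\<dots> = (\<Sum>x\<leftarrow>inf_decomp l. - MuF (?tl x) (gen ?pr))"
      by (simp add: MuF_sum_list neg_sum_list)
    also have "eqv A \<dots> (\<Sum>(e, b, j, u)\<leftarrow>inf_decomp l. ?t (e + verts u * verts r, Mu b r, j, u))"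
    proof (rule eqv_sum_list)
      fix x assume x: "x \<in> set (inf_decomp l)"
      obtain e b j u where xe: "x = (e, b, j, u)" by (cases x)
      note x = x[unfolded xe]
      note pr = inf_decomp_props[OF x]
      let ?us = "map (tau A ^^ Suc (verts u)) (take j xl')" and ?vs = "drop (j + arity u) xl'"
      let ?z = "take (arity u) (drop j xl)"
      have z: "length ?z = arity u" using pr len by auto
      have lw: "length ?us + 1 + length ?vs = arity b" using pr len by auto
      have "take (arity b) (plug xs j u) = plug xl j u"
        "drop (arity b) (plug xs j u) = xr"
        using pr len by (auto simp: plug_def xs take_Cons' drop_Cons')
      then have a: "place (tau A) (Mu b r) (plug xs j u) =
          Mu (place (tau A) b (map (tau A ^^ verts r) (plug xl j u))) ?pr" by simp
      have "map (tau A ^^ verts r) (plug xl j u) =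
          ?us @ (tau A ^^ verts r) (\<gamma>d u ?z) # ?vs"
        by (auto simp: plug_def xl'_def take_map drop_map tau_pow)
      also have "(tau A ^^ verts r) (\<gamma>d u ?z) = scl A ((-1) ^ (verts r * Suc (verts u))) (\<gamma>d u (take (arity u) (drop j xl')))"
        using z by (simp add: \<gamma>d_tau_pow xl'_def take_map drop_map)
      finally have b: "map (tau A ^^ verts r) (plug xl j u) = ?us @
          scl A ((-1) ^ (verts r * Suc (verts u))) (\<gamma>d u (take (arity u) (drop j xl'))) # ?vs" .
      have "eqv A (gen (place (tau A) (Mu b r) (plug xs j u)))
          (fsc ((-1) ^ (verts r * Suc (verts u))) (MuF (gen (place (tau A) b (plug xl' j u))) (gen ?pr)))"
        unfolding a b MuF_gen[symmetric] plug_def[of xl'] MuF_simps(2)[symmetric]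
        by (intro eqv_MuF eqv_refl place_scl lw)
      then have "eqv A (?t (e + verts u * verts r, Mu b r, j, u))
          (fsc ((-1) ^ (e + verts u * verts r + verts (Mu b r)))
            (fsc ((-1) ^ (verts r * Suc (verts u))) (MuF (gen (place (tau A) b (plug xl' j u))) (gen ?pr))))"
        unfolding prod.case by (rule eqv_fsc)
      also have "\<dots> = - MuF (?tl (e, b, j, u)) (gen ?pr)"
      proof -
        \<comment> \<open>the sign \<open>verts u * verts r\<close> of \<open>inf_decomp\<close> differs by \<open>verts r\<close> from the one of the operation, which
          has degree \<open>verts u - 1\<close>, moving past the vertices of \<open>r\<close>\<close>
        have "(-1 :: 'k) ^ (e + verts u * verts r + verts (Mu b r)) * (-1) ^ (verts r * Suc (verts u)) =
            - ((-1) ^ (e + verts b))"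
          by (auto simp: minus_one_power_iff)
        then show ?thesis by simp
      qed
      finally show "eqv A (- MuF (?tl x) (gen ?pr))
          (case x of (e, b, j, u) \<Rightarrow> ?t (e + verts u * verts r, Mu b r, j, u))"
        unfolding xe prod.case by (rule eqv_sym)
    qed
    finally show ?thesis .
  qed
  have 2: "eqv A (- MuF (sgn_map (tau A) ?pl) (D ?pr))
      (\<Sum>(e, b, j, u)\<leftarrow>inf_decomp r. ?t (e, Mu l b, arity l + j, u))"
  proof -
    have "eqv A (- MuF (sgn_map (tau A) ?pl) (D ?pr)) (- MuF (sgn_map (tau A) ?pl) (sum_list (map ?tr (inf_decomp r))))"
      by (intro eqv_neg eqv_MuF eqv_refl Mu.IH len)
    also have "\<dots> = (\<Sum>x\<leftarrow>inf_decomp r. - MuF (sgn_map (tau A) ?pl) (?tr x))"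
      by (simp add: MuF_sum_list neg_sum_list)
    also have "\<dots> = (\<Sum>(e, b, j, u)\<leftarrow>inf_decomp r. ?t (e, Mu l b, arity l + j, u))"
    proof (rule arg_cong[of _ _ sum_list], rule map_cong[OF refl])
      fix x assume x: "x \<in> set (inf_decomp r)"
      obtain e b j u where xe: "x = (e, b, j, u)" by (cases x)
      note x = x[unfolded xe]
      note pr = inf_decomp_props[OF x]
      have "plug xs (arity l + j) u = map (tau A ^^ Suc (verts u)) xl @ plug xr j u"
        using len by (simp add: plug_def xs)
      then have "place (tau A) (Mu l b) (plug xs (arity l + j) u) =
          Mu (place (tau A) l (map (tau A ^^ verts b) (map (tau A ^^ Suc (verts u)) xl)))
            (place (tau A) b (plug xr j u))"
        using len by simp
      also have "map (tau A ^^ verts b) (map (tau A ^^ Suc (verts u)) xl) = map (tau A) xl'"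
        using pr(1) by (auto simp: xl'_def tau_pow simp flip: pr(1))
      finally have "place (tau A) (Mu l b) (plug xs (arity l + j) u) =
          Mu (map_tree (tau A) ?pl) (place (tau A) b (plug xr j u))"
        using len by (simp add: map_tree_place)
      then show "- MuF (sgn_map (tau A) ?pl) (?tr x) =
          (case x of (e, b, j, u) \<Rightarrow> ?t (e, Mu l b, arity l + j, u))"
        unfolding xe by (simp add: sgn_map_def power_add mult.commute mult.left_commute)
    qed
    finally show ?thesis .
  qed
  have 0: "gen (Lf (root_op \<gamma> A (Mu ?pl ?pr))) = ?t (0, Lf (), 0, Mu l r)"
    using Mu.prems labels_place[OF tau_comp_tau, of "Mu l r" xs]
    by (simp add: root_op_def plug_def \<gamma>d_def flip: pl)
  have "D (Mu ?pl ?pr) = gen (Lf (root_op \<gamma> A (Mu ?pl ?pr))) +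
      (- MuF (D ?pl) (gen ?pr) + - MuF (sgn_map (tau A) ?pl) (D ?pr))"
    by (simp only: bar_dif_split[of A \<gamma> "Mu _ _"] inner_dif_def tree.case diff_conv_add_uminus)
  also have "eqv A \<dots> (?t (0, Lf (), 0, Mu l r) +
      ((\<Sum>(e, b, j, u)\<leftarrow>inf_decomp l. ?t (e + verts u * verts r, Mu b r, j, u)) +
       (\<Sum>(e, b, j, u)\<leftarrow>inf_decomp r. ?t (e, Mu l b, arity l + j, u))))"
    unfolding 0 by (intro eqv_add eqv_refl 1 2)
  also have "\<dots> = sum_list (map ?t (inf_decomp (Mu l r)))"
    by (simp add: case_prod_unfold comp_def)
  finally show ?case unfolding pl .
qed

end

section \<open>The relations in terms of the predifferential\<close>

text \<open>
  The curvature on labelled trees. The involution in the second case comes from moving the label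
  past the cork.
\<close>

definition curv_op :: "('k, 'a::ab_group_add) cplx \<Rightarrow> 'a tree \<Rightarrow> 'a" where
  "curv_op A t = (case t of
     Mu Cork (Lf a) \<Rightarrow> - a | Mu (Lf a) Cork \<Rightarrow> - tau A a | _ \<Rightarrow> 0)"

lemma sum_lessThan_add:
  "(\<Sum>j<m + n. f j) = (\<Sum>j<m. f j) + (\<Sum>j<n. f (m + j) :: 'b::ab_group_add)" for m n :: nat
  by (induction n) (auto simp: add.assoc)

lemma sum_list_inf_decomp_leaves:
  "(\<Sum>x\<leftarrow>filter (\<lambda>(e, b, j, u). u = Lf ()) (inf_decomp w). g x :: 'b::ab_group_add) =
     (\<Sum>j<arity w. g (0, w, j, Lf ()))"
proof (induction w arbitrary: g)
  case (Mu l r)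
  show ?case
    using Mu.IH(1)[of "\<lambda>(e, b, j, u). g (e + verts u * verts r, Mu b r, j, u)"]
      Mu.IH(2)[of "\<lambda>(e, b, j, u). g (e, Mu l b, arity l + j, u)"]
    by (simp add: filter_map comp_def case_prod_unfold sum_lessThan_add)
qed auto

lemma filter_inf_decomp_root:
  "w \<noteq> Lf () \<Longrightarrow> filter (\<lambda>(e, b, j, u). b = Lf () \<and> u \<noteq> Lf ()) (inf_decomp w) = [(0, Lf (), 0, w)]"
  by (cases w) (auto simp: filter_empty_conv)

lemma sum_list_filter3:
  fixes g :: "'x \<Rightarrow> 'b::ab_group_add"
  assumes "\<And>x. x \<in> set ys \<Longrightarrow> (P x \<and> \<not> Q x \<and> \<not> R x) \<or> (\<not> P x \<and> Q x \<and> \<not> R x) \<or> (\<not> P x \<and> \<not> Q x \<and> R x)"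
  shows "sum_list (map g ys) = sum_list (map g (filter P ys)) + sum_list (map g (filter Q ys)) +
    sum_list (map g (filter R ys))"
  using assms by (induction ys) (fastforce simp: algebra_simps)+

text \<open>
  The terms with upper tree \<open>|\<close> and the one with bottom tree \<open>|\<close> make up
  the differential of the endomorphism operad.
\<close>

lemma sum_list_inf_decomp:
  assumes "w \<noteq> Lf ()"
  shows "(\<Sum>x\<leftarrow>inf_decomp w. g x :: 'b::ab_group_add) =
    g (0, Lf (), 0, w) + (\<Sum>j<arity w. g (0, w, j, Lf ())) + (\<Sum>x\<leftarrow>red_inf_decomp w. g x)"
proof -
  have "\<not> (b = Lf () \<and> u = Lf ())" if "(e, b, j, u) \<in> set (inf_decomp w)" for e b j u
    using inf_decomp_props[OF that] assms by (cases w) auto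
  then have "(\<Sum>x\<leftarrow>inf_decomp w. g x) =
      (\<Sum>x\<leftarrow>filter (\<lambda>(e, b, j, u). b = Lf () \<and> u \<noteq> Lf ()) (inf_decomp w). g x) +
      (\<Sum>x\<leftarrow>filter (\<lambda>(e, b, j, u). u = Lf ()) (inf_decomp w). g x) +
      (\<Sum>x\<leftarrow>filter (\<lambda>(e, b, j, u). b \<noteq> Lf () \<and> u \<noteq> Lf ()) (inf_decomp w). g x)"
    by (intro sum_list_filter3) auto
  then show ?thesis
    unfolding filter_inf_decomp_root[OF assms] sum_list_inf_decomp_leaves red_inf_decomp_def[symmetric]
    by simp
qed

context complex
begin

lemma linear_gext: "Vector_Spaces.linear fsc (scl A) (gext (scl A) g)"
  by (rule gext_linear) (rule vector_space_axioms)

lemma gext_gen' [simp]: "gext (scl A) g (gen x) = g x"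
  by (rule gext_gen) (rule vector_space_axioms)

sublocale ge: Vector_Spaces.linear fsc "scl A" "gext (scl A) g" for g :: "'x \<Rightarrow> 'a"
  by (rule linear_gext)

lemma gext_lext': "gext (scl A) f (lext g v) = gext (scl A) (\<lambda>x. gext (scl A) f (g x)) v"
  by (rule gext_lext) (rule vector_space_axioms)

abbreviation "kap \<equiv> gext (scl A) (curv_op A)"

lemma curv_slot: "\<sigma> \<in> slots1 \<Longrightarrow> Vector_Spaces.linear (scl A) (scl A) (\<lambda>x. curv_op A (\<sigma> x))"
proof -
  have zero: "Vector_Spaces.linear (scl A) (scl A) (\<lambda>x. 0)" by unfold_locales auto
  have neg: "Vector_Spaces.linear (scl A) (scl A) (\<lambda>x. - x)" by unfold_locales auto
  have negt: "Vector_Spaces.linear (scl A) (scl A) (\<lambda>x. - tau A x)"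
    using Vector_Spaces.linear_compose[OF linear_tau neg] by (simp add: comp_def)
  show "\<sigma> \<in> slots1 \<Longrightarrow> ?thesis"
  proof (erule slots.cases)
    show "Vector_Spaces.linear (scl A) (scl A) (\<lambda>x. curv_op A (\<sigma> x))"
      if "\<sigma> = (\<lambda>x. Lf (\<sigma>' x))" for \<sigma>'
      using zero that by (simp add: curv_op_def)
    show "Vector_Spaces.linear (scl A) (scl A) (\<lambda>x. curv_op A (\<sigma> x))"
      if "\<sigma> = (\<lambda>x. Mu (\<sigma>' x) r)" "\<sigma>' \<in> slots1" for \<sigma>' r
      using that(2) by (cases; cases r) (use zero negt that(1) in \<open>auto simp: curv_op_def\<close>)
    show "Vector_Spaces.linear (scl A) (scl A) (\<lambda>x. curv_op A (\<sigma> x))"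
      if "\<sigma> = (\<lambda>x. Mu l (\<sigma>' x))" "\<sigma>' \<in> slots1" for \<sigma>' l
      using that(2) by (cases; cases l) (use zero neg that(1) in \<open>auto simp: curv_op_def split: tree.split\<close>)
  qed
qed

lemma kap_tensor_rep:
  assumes "\<And>w. w \<in> supp c \<Longrightarrow> arity w = length xs"
  shows "kap (tensor_rep A c xs) = scl A (curvature c) (hd xs)"
proof -
  let ?a = "Mu Cork (Lf ())" and ?b = "Mu (Lf ()) Cork"
  have *: "curv_op A (place (tau A) w xs) =
      (if ?a = w then - hd xs else 0) + (if ?b = w then - hd xs else 0)" if "arity w = length xs" for w
  proof -
    consider "w = ?a" | "w = ?b" | "w \<noteq> ?a" "w \<noteq> ?b" by blast
    then show ?thesis
    proof cases
      case 3
      have "curv_op A t = 0" if "shape t = w" for t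
        using that 3 by (cases t) (auto simp: curv_op_def split: tree.splits)
      from this[of "place (tau A) w xs"] show ?thesis using 3 by simp
    qed (use that in \<open>cases xs, auto simp: curv_op_def\<close>)+
  qed
  have "kap (tensor_rep A c xs) = gext (scl A) (\<lambda>w. curv_op A (place (tau A) w xs)) c"
    by (simp add: tensor_rep_def gext_lext')
  also have "\<dots> = (\<Sum>w\<in>supp c. scl A (coef c w)
      ((if ?a = w then - hd xs else 0) + (if ?b = w then - hd xs else 0)))"
    unfolding gext_def by (rule sum.cong[OF refl]) (simp only: * assms)
  also have "\<dots> = (\<Sum>w\<in>supp c. if ?a = w then - scl A (coef c w) (hd xs) else 0) +
      (\<Sum>w\<in>supp c. if ?b = w then - scl A (coef c w) (hd xs) else 0)"
    unfolding sum.distrib[symmetric]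
    by (rule sum.cong[OF refl]) (auto simp: scale_minus_right)
  also have "\<dots> = - scl A (coef c ?a) (hd xs) - scl A (coef c ?b) (hd xs)"
    by (auto simp: in_keys_iff)
  finally show ?thesis
    by (simp add: curvature_def scale_left_diff_distrib)
qed

end

context ops
begin

text \<open>
  \<open>gam\<close>, \<open>del\<close> and \<open>kap\<close> are \<open>\<gamma>\<close>,
  \<open>\<delta>\<close> and \<open>\<kappa>\<close> of the introduction, extended to linear
  combinations.
\<close>

abbreviation "gam \<equiv> gext (scl A) (top_op \<gamma> A)"
abbreviation "del \<equiv> gext (scl A) (root_op \<gamma> A)"

lemma rel1_kill:
  "v \<in> rel1 A \<Longrightarrow> gam v = 0" "v \<in> rel1 A \<Longrightarrow> del v = 0" "v \<in> rel1 A \<Longrightarrow> kap v = 0"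
  by (rule rel1_gext[OF _ vector_space_axioms], (rule linear_slot curv_slot), assumption, assumption)+

lemma eqv_gam: "eqv A u v \<Longrightarrow> gam u = gam v"
  and eqv_del: "eqv A u v \<Longrightarrow> del u = del v"
  and eqv_kap: "eqv A u v \<Longrightarrow> kap u = kap v"
  using rel1_kill[of "u - v"] by (simp_all add: eqv_def ge.diff)

lemma root_op_place: "length xs = arity b \<Longrightarrow> root_op \<gamma> A (place (tau A) b xs) = \<gamma>d b xs"
  using labels_place[OF tau_comp_tau, of b xs] shape_place[of "tau A" b xs]
  by (cases b) (auto simp: root_op_def \<gamma>d_def simp del: labels.simps shape_place)

lemma top_op_place:
  assumes "length xs = arity b" "b \<noteq> Lf ()"
  shows "top_op \<gamma> A (place (tau A) b xs) = \<gamma> b xs"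
  using root_op_place[OF assms(1)] assms(2)
  by (cases b) (auto simp: root_op_def top_op_def \<gamma>d_def simp del: labels.simps)

lemma del_sum_list: "del (sum_list (map f ys)) = sum_list (map (\<lambda>x. del (f x)) ys)"
  by (induction ys) (auto simp: ge.add)

lemma del_bar_dif:
  assumes "w \<noteq> Lf ()" "length xs = arity w"
  shows "del (D (place (tau A) w xs)) = End_dif A (arity w) (verts w - 1) (\<gamma> w) xs +
    (\<Sum>(e, b, j, u)\<leftarrow>red_inf_decomp w. scl A ((-1) ^ (e + verts b))
        (circ A (\<gamma> b) j (arity u) (verts u - 1) (\<gamma> u) xs))"
proof -
  let ?g = "\<lambda>(e, b, j, u). scl A ((-1) ^ (e + verts b)) (\<gamma>d b (plug xs j u))"
  have v: "verts w > 0" using assms(1) by (cases w) auto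
  have "del (D (place (tau A) w xs)) = (\<Sum>(e, b, j, u)\<leftarrow>inf_decomp w.
      del (fsc ((-1) ^ (e + verts b)) (gen (place (tau A) b (plug xs j u)))))"
    using eqv_del[OF bar_dif_place[OF assms(2)]] by (simp add: del_sum_list case_prod_unfold)
  also have "\<dots> = (\<Sum>x\<leftarrow>inf_decomp w. ?g x)"
    by (rule arg_cong[of _ _ sum_list], rule map_cong[OF refl])
      (auto simp: ge.scale root_op_place length_plug[OF _ assms(2)])
  also have "\<dots> = ?g (0, Lf (), 0, w) + (\<Sum>j<arity w. ?g (0, w, j, Lf ())) + (\<Sum>x\<leftarrow>red_inf_decomp w. ?g x)"
    by (rule sum_list_inf_decomp[OF assms(1)])
  also have "?g (0, Lf (), 0, w) = dif A (\<gamma> w xs)"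
    using assms by (simp add: plug_def \<gamma>d_def)
  also have "(\<Sum>j<arity w. ?g (0, w, j, Lf ())) =
      scl A ((-1) ^ verts w) (\<Sum>j<arity w. circ A (\<gamma> w) j 1 1 (\<lambda>ys. dif A (hd ys)) xs)"
    using assms by (simp add: plug_def \<gamma>d_def circ_def scale_sum_right)
  also have "(\<Sum>x\<leftarrow>red_inf_decomp w. ?g x) = (\<Sum>(e, b, j, u)\<leftarrow>red_inf_decomp w. scl A ((-1) ^ (e + verts b))
        (circ A (\<gamma> b) j (arity u) (verts u - 1) (\<gamma> u) xs))"
  proof -
    have "?g x = (\<lambda>(e, b, j, u). scl A ((-1) ^ (e + verts b))
        (circ A (\<gamma> b) j (arity u) (verts u - 1) (\<gamma> u) xs)) x" if x: "x \<in> set (red_inf_decomp w)" for x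
    proof -
      obtain e b j u where xe: "x = (e, b, j, u)" by (cases x)
      have bu: "b \<noteq> Lf ()" "u \<noteq> Lf ()" using x by (auto simp: xe red_inf_decomp_def)
      then have "verts u > 0" by (cases u) auto
      then have "tau A ^^ Suc (verts u) = tau A ^^ (verts u - 1)" by (auto simp: tau_pow_fun)
      then show ?thesis
        using bu by (simp add: xe plug_def circ_def \<gamma>d_def add.commute)
    qed
    then show ?thesis by (intro arg_cong[of _ _ sum_list] map_cong refl)
  qed
  finally show ?thesis using v by (auto simp: End_dif_def Let_def)
qed

lemma relation_iff:
  assumes "coef c (Lf ()) = 0" "\<And>w. w \<in> supp c \<Longrightarrow> arity w = length xs"
  shows "(\<Sum>w\<in>supp c.
           scl A (coef c w) (End_dif A (arity w) (verts w - 1) (\<gamma> w) xs)) =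
        scl A (curvature c) (hd xs) -
        (\<Sum>w\<in>supp c. scl A (coef c w)
           (\<Sum>(e, b, j, u)\<leftarrow>red_inf_decomp w. scl A ((-1) ^ (e + verts b))
              (circ A (\<gamma> b) j (arity u) (verts u - 1) (\<gamma> u) xs))) \<longleftrightarrow>
     del (lext D (tensor_rep A c xs)) = kap (tensor_rep A c xs)"
proof -
  have "del (lext D (tensor_rep A c xs)) = gext (scl A) (\<lambda>w. del (D (place (tau A) w xs))) c"
    by (simp add: tensor_rep_def gext_lext' lext_lext)
  also have "\<dots> = (\<Sum>w\<in>supp c. scl A (coef c w)
      (End_dif A (arity w) (verts w - 1) (\<gamma> w) xs +
       (\<Sum>(e, b, j, u)\<leftarrow>red_inf_decomp w. scl A ((-1) ^ (e + verts b))
        (circ A (\<gamma> b) j (arity u) (verts u - 1) (\<gamma> u) xs))))"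
  proof (subst gext_def, rule sum.cong[OF refl])
    fix w assume w: "w \<in> supp c"
    then have "w \<noteq> Lf ()" using assms(1) by (auto simp: in_keys_iff)
    then show "scl A (coef c w) (del (D (place (tau A) w xs))) =
        scl A (coef c w) (End_dif A (arity w) (verts w - 1) (\<gamma> w) xs +
       (\<Sum>(e, b, j, u)\<leftarrow>red_inf_decomp w. scl A ((-1) ^ (e + verts b))
        (circ A (\<gamma> b) j (arity u) (verts u - 1) (\<gamma> u) xs)))"
      using assms(2)[OF w] by (simp add: del_bar_dif)
  qed
  finally have *: "del (lext D (tensor_rep A c xs)) = \<dots>" .
  have "kap (tensor_rep A c xs) = scl A (curvature c) (hd xs)"
    by (rule kap_tensor_rep) (rule assms(2))
  then show ?thesis
    unfolding * by (simp only: scale_right_distrib sum.distrib eq_diff_eq)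
qed

end

text \<open>
  The differential of the endomorphism operad and \<open>d\<^sub>2\<close> of the cobar
  construction together are the composite \<open>\<delta> \<circ> D\<close>, by
  \<open>del_bar_dif\<close>.
\<close>

lemma uA_infinity_algebra_iff:
  "uA_infinity_algebra A \<gamma> \<longleftrightarrow> ops A \<gamma> \<and>
    (\<forall>c\<in>uAs_dual. \<forall>xs. coef c (Lf ()) = 0 \<and>
        (\<forall>w\<in>supp c. arity w = length xs) \<longrightarrow>
      gext (scl A) (root_op \<gamma> A) (lext (bar_dif A \<gamma>) (tensor_rep A c xs)) =
      gext (scl A) (curv_op A) (tensor_rep A c xs))"
proof (cases "ops A \<gamma>")
  case True
  then interpret ops A \<gamma> .
  show ?thesis
  proof -
    have "(\<forall>c\<in>uAs_dual. \<forall>xs. coef c (Lf ()) = 0 \<and>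
        (\<forall>w\<in>supp c. arity w = length xs) \<longrightarrow>
        (\<Sum>w\<in>supp c.
           scl A (coef c w) (End_dif A (arity w) (verts w - 1) (\<gamma> w) xs)) =
        scl A (curvature c) (hd xs) -
        (\<Sum>w\<in>supp c. scl A (coef c w)
           (\<Sum>(e, b, j, u)\<leftarrow>red_inf_decomp w. scl A ((-1) ^ (e + verts b))
              (circ A (\<gamma> b) j (arity u) (verts u - 1) (\<gamma> u) xs)))) \<longleftrightarrow>
      (\<forall>c\<in>uAs_dual. \<forall>xs. coef c (Lf ()) = 0 \<and>
        (\<forall>w\<in>supp c. arity w = length xs) \<longrightarrow>
        del (lext D (tensor_rep A c xs)) = kap (tensor_rep A c xs))"
      by (intro ball_cong refl all_cong1 imp_cong relation_iff) auto
    then show ?thesis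
      unfolding uA_infinity_algebra_def using complex End True by blast
  qed
next
  case False
  then show ?thesis by (auto simp: uA_infinity_algebra_def ops_def ops_axioms_def complex_def)
qed

section \<open>Corollas\<close>

definition splits :: "'a list \<Rightarrow> ('a list \<times> 'a list) set" where
  "splits zs = {(l, r). l @ r = zs \<and> l \<noteq> [] \<and> r \<noteq> []}"

lemma splits_image: "splits zs = (\<lambda>k. (take k zs, drop k zs)) ` {1..<length zs}"
proof (rule set_eqI, clarify)
  fix l r
  show "(l, r) \<in> splits zs \<longleftrightarrow> (l, r) \<in> (\<lambda>k. (take k zs, drop k zs)) ` {1..<length zs}"
  proof
    assume "(l, r) \<in> splits zs"
    then show "(l, r) \<in> (\<lambda>k. (take k zs, drop k zs)) ` {1..<length zs}"
      by (intro image_eqI[of _ _ "length l"]) (auto simp: splits_def Suc_le_eq)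
  qed (auto simp: splits_def)
qed

lemma finite_splits [simp]: "finite (splits zs)"
  by (simp add: splits_image)

lemma sum_splits: "(\<Sum>(l, r)\<in>splits zs. g l r) = (\<Sum>k\<in>{1..<length zs}. g (take k zs) (drop k zs))"
proof -
  have "inj_on (\<lambda>k. (take k zs, drop k zs)) {1..<length zs}"
    by (rule inj_onI) (auto dest!: arg_cong[of "take _ zs" _ length] simp: min_def)
  then show ?thesis by (simp add: splits_image sum.reindex)
qed

lemma sum_pair_cong:
  "(\<And>l r. (l, r) \<in> S \<Longrightarrow> f l r = g l r) \<Longrightarrow> (\<Sum>(l, r)\<in>S. f l r) = (\<Sum>(l, r)\<in>S. g l r)"
  by (rule sum.cong) auto

lemma sum_splits_map: "(\<Sum>(l, r)\<in>splits (map f zs). g l r) = (\<Sum>(l, r)\<in>splits zs. g (map f l) (map f r))"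
  by (simp add: sum_splits take_map drop_map)

abbreviation corks :: "bool list \<Rightarrow> nat" where
  "corks b \<equiv> count_list b True"

text \<open>
  Corollas are indexed by cork words rather than by pairs \<open>(n, S)\<close>: concatenation of
  words corresponds to adding a vertex at the root.
\<close>

definition cor :: "bool list \<Rightarrow> (unit tree \<Rightarrow>\<^sub>0 'k::field_char_0)" where
  "cor b = (\<Sum>w | corkword w = b. fsc ((-1) ^ treesgn w) (gen w))"

definition split_sgn :: "bool list \<Rightarrow> bool list \<Rightarrow> nat" where
  "split_sgn l r = (length l + corks l) * (length r - 1)"

lemma corkword_nonempty [simp]: "corkword w \<noteq> []"
  by (induction w) auto

lemma verts_corkword: "Suc (verts w) = length (corkword w) + corks (corkword w)"
  by (induction w) auto

lemma arity_corkword: "arity w + corks (corkword w) = length (corkword w)"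
  by (induction w) auto

lemma trees_single: "{w :: unit tree. corkword w = [x]} = {if x then Cork else Lf ()}"
proof -
  have "corkword w = [x] \<longleftrightarrow> w = (if x then Cork else Lf ())" for w :: "unit tree"
    by (cases w) (auto simp: append_eq_Cons_conv)
  then show ?thesis by auto
qed

lemma trees_rec:
  assumes "2 \<le> length b"
  shows "{w :: unit tree. corkword w = b} = (\<lambda>(_, s, t). Mu s t) `
    (SIGMA (l, r):splits b. {s. corkword s = l} \<times> {t. corkword t = r})" (is "?L = ?R")
proof (rule set_eqI)
  fix w :: "unit tree"
  show "w \<in> ?L \<longleftrightarrow> w \<in> ?R"
    using assms by (cases w) (auto simp: splits_def image_iff)
qed

lemma finite_trees: "finite {w :: unit tree. corkword w = b}"
proof (induction b rule: length_induct)
  case (1 b)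
  consider "b = []" | x where "b = [x]" | "2 \<le> length b"
    by (cases b rule: remdups_adj.cases) auto
  then show ?case
  proof cases
    case 2
    then show ?thesis by (simp only: trees_single) simp
  next
    case 3
    then show ?thesis
      unfolding trees_rec[OF 3] using 1
      by (intro finite_imageI finite_SigmaI finite_splits) (auto simp: splits_def)
  qed simp
qed

lemma lookup_cor: "coef (cor b) w = (if corkword w = b then (-1) ^ treesgn w else 0)"
proof -
  have "coef (cor b) w = (\<Sum>t | corkword t = b. if w = t then (-1) ^ treesgn w else 0)"
    unfolding cor_def lookup_sum by (rule sum.cong) (auto simp: lookup_fsc lookup_gen)
  then show ?thesis by (simp add: finite_trees)
qed

lemma keys_cor: "w \<in> supp (cor b) \<Longrightarrow> corkword w = b"
  by (auto simp: in_keys_iff lookup_cor split: if_splits)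

lemma cor_Nil [simp]: "cor [] = 0"
  by (simp add: cor_def)

lemma cor_single [simp]: "cor [x] = gen (if x then Cork else Lf ())"
  by (cases x) (simp_all add: cor_def trees_single)

text \<open>
  The root of a binary tree splits its cork word into two.
\<close>

lemma cor_rec:
  assumes "2 \<le> length b"
  shows "(cor b :: _ \<Rightarrow>\<^sub>0 'k::field_char_0) =
    (\<Sum>(l, r)\<in>splits b. fsc ((-1) ^ split_sgn l r) (MuF (cor l) (cor r)))"
proof -
  let ?g = "\<lambda>w. fsc ((-1) ^ treesgn w) (gen w) :: unit tree \<Rightarrow>\<^sub>0 'k"
  let ?W = "\<lambda>b. {w :: unit tree. corkword w = b}"
  have "inj_on (\<lambda>(x, s, t). Mu s t) (SIGMA (l, r):splits b. ?W l \<times> ?W r)"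
    by (auto simp: inj_on_def)
  then have "cor b = (\<Sum>(x, s, t)\<in>(SIGMA (l, r):splits b. ?W l \<times> ?W r). ?g (Mu s t))"
    unfolding cor_def trees_rec[OF assms] by (subst sum.reindex) (auto simp: comp_def case_prod_unfold)
  also have "\<dots> = (\<Sum>(l, r)\<in>splits b. \<Sum>(s, t)\<in>?W l \<times> ?W r. ?g (Mu s t))"
    by (subst sum.Sigma[symmetric]) (auto simp: finite_trees case_prod_unfold)
  also have "\<dots> = (\<Sum>(l, r)\<in>splits b. fsc ((-1) ^ split_sgn l r) (MuF (cor l) (cor r)))"
  proof (rule sum_pair_cong)
    fix l r
    have "(\<Sum>(s, t)\<in>?W l \<times> ?W r. ?g (Mu s t)) =
        (\<Sum>s\<in>?W l. \<Sum>t\<in>?W r. fsc ((-1) ^ split_sgn l r) (MuF (?g s) (?g t)))"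
      unfolding sum.cartesian_product
      by (rule sum.cong) (auto simp: split_sgn_def power_add mult_ac)
    also have "\<dots> = fsc ((-1) ^ split_sgn l r) (MuF (cor l) (cor r))"
      by (simp only: cor_def MuF_sum(1) fv.scale_sum_right) (simp only: MuF_sum(2) fv.scale_sum_right)
    finally show "(\<Sum>(s, t)\<in>?W l \<times> ?W r. ?g (Mu s t)) = \<dots>" .
  qed
  finally show ?thesis .
qed

section \<open>Labelled corollas\<close>

text \<open>
  A labelled corolla is given by a list with \<open>None\<close> at the corks and a label at every
  other leaf. This keeps the labels together with their position, and avoids all bookkeeping with
  \<open>take\<close> and \<open>drop\<close>.
\<close>

abbreviation word :: "'x option list \<Rightarrow> bool list" where
  "word zs \<equiv> map (\<lambda>z. z = None) zs"

abbreviation vals :: "'x option list \<Rightarrow> 'x list" where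
  "vals zs \<equiv> map the (filter (\<lambda>z. z \<noteq> None) zs)"

abbreviation n_corks :: "'x option list \<Rightarrow> nat" where
  "n_corks zs \<equiv> count_list (word zs) True"

definition n_verts :: "'x option list \<Rightarrow> nat" where
  "n_verts zs = length zs - 1 + n_corks zs"

definition labcor :: "('x \<Rightarrow> 'x) \<Rightarrow> 'x option list \<Rightarrow> ('x tree \<Rightarrow>\<^sub>0 'k::field_char_0)" where
  "labcor \<tau> zs = lext (\<lambda>w. gen (place \<tau> w (vals zs))) (cor (word zs))"

lemma labelled_word_cases:
  assumes "zs \<noteq> []"
  obtains "zs = [None]" | x where "zs = [Some x]" | "2 \<le> length zs"
proof (cases zs)
  case (Cons z zs')
  then show ?thesis using that by (cases zs'; cases z) auto
qed (use assms in simp)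

lemma word_map_option [simp]: "word (map (map_option f) zs) = word zs"
  by simp

lemma vals_map_option: "vals (map (map_option f) zs) = map f (vals zs)"
  by (induction zs) (auto simp: option.map_sel)

lemma length_vals: "length (vals zs) + n_corks zs = length zs"
  by (induction zs) auto

lemma n_verts_map_option [simp]: "n_verts (map (map_option f) zs) = n_verts zs"
  by (simp add: n_verts_def comp_def)

lemma verts_word: "corkword w = word zs \<Longrightarrow> verts w = n_verts zs"
  using verts_corkword[of w] by (cases zs) (auto simp: n_verts_def)

lemma arity_word: "corkword w = word zs \<Longrightarrow> arity w = length (vals zs)"
  using arity_corkword[of w] length_vals[of zs] by auto

lemma labcor_single [simp]: "labcor \<tau> [None] = gen Cork" "labcor \<tau> [Some x] = gen (Lf x)"
  by (simp_all add: labcor_def)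

text \<open>
  The labels of the left part move past the vertices of the right part.
\<close>

lemma labcor_rec:
  assumes "2 \<le> length zs"
  shows "(labcor \<tau> zs :: _ \<Rightarrow>\<^sub>0 'k::field_char_0) = (\<Sum>(l, r)\<in>splits zs. fsc ((-1) ^ split_sgn (word l) (word r))
    (MuF (labcor \<tau> (map (map_option (\<tau> ^^ n_verts r)) l)) (labcor \<tau> r)))"
proof -
  have "(labcor \<tau> zs :: _ \<Rightarrow>\<^sub>0 'k) = lext (\<lambda>w. gen (place \<tau> w (vals zs))) (\<Sum>(l, r)\<in>splits zs.
      fsc ((-1) ^ split_sgn (word l) (word r)) (MuF (cor (word l)) (cor (word r))))"
    using assms by (simp only: labcor_def cor_rec length_map sum_splits_map)
  also have "\<dots> = (\<Sum>(l, r)\<in>splits zs. fsc ((-1) ^ split_sgn (word l) (word r))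
      (lext (\<lambda>w. gen (place \<tau> w (vals zs))) (MuF (cor (word l)) (cor (word r)))))"
    by (simp only: lext_sum case_prod_unfold lext_simps)
  also have "\<dots> = (\<Sum>(l, r)\<in>splits zs. fsc ((-1) ^ split_sgn (word l) (word r))
      (MuF (labcor \<tau> (map (map_option (\<tau> ^^ n_verts r)) l)) (labcor \<tau> r)))"
  proof (rule sum_pair_cong)
    fix l r assume "(l, r) \<in> splits zs"
    then have zs: "zs = l @ r" by (simp add: splits_def)
    have "lext (\<lambda>w. gen (place \<tau> w (vals zs))) (MuF (cor (word l)) (cor (word r)) :: _ \<Rightarrow>\<^sub>0 'k) =
        lext (\<lambda>s. lext (\<lambda>t. MuF (gen (place \<tau> s (map (\<tau> ^^ n_verts r) (vals l))))
          (gen (place \<tau> t (vals r)))) (cor (word r))) (cor (word l))"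
      unfolding lext_MuF
    proof (rule lext_cong, rule lext_cong)
      fix s t assume "s \<in> supp (cor (word l) :: _ \<Rightarrow>\<^sub>0 'k)" "t \<in> supp (cor (word r) :: _ \<Rightarrow>\<^sub>0 'k)"
      then have "arity s = length (vals l)" "verts t = n_verts r"
        by (auto dest!: keys_cor simp: verts_word arity_word)
      then show "gen (place \<tau> (Mu s t) (vals zs)) =
          (MuF (gen (place \<tau> s (map (\<tau> ^^ n_verts r) (vals l)))) (gen (place \<tau> t (vals r))) :: _ \<Rightarrow>\<^sub>0 'k)"
        by (simp add: zs)
    qed
    also have "\<dots> = MuF (labcor \<tau> (map (map_option (\<tau> ^^ n_verts r)) l)) (labcor \<tau> r)"
      unfolding labcor_def vals_map_option word_map_option MuF_lext(1) by (simp only: MuF_lext(2))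
    finally show "fsc ((-1) ^ split_sgn (word l) (word r))
        (lext (\<lambda>w. gen (place \<tau> w (vals zs))) (MuF (cor (word l)) (cor (word r)) :: _ \<Rightarrow>\<^sub>0 'k)) =
      fsc ((-1) ^ split_sgn (word l) (word r))
      (MuF (labcor \<tau> (map (map_option (\<tau> ^^ n_verts r)) l)) (labcor \<tau> r))" by simp
  qed
  finally show ?thesis .
qed

lemma labcor_sgn_map:
  "lext (sgn_map \<tau>) (labcor \<tau> zs) = fsc ((-1) ^ n_verts zs) (labcor \<tau> (map (map_option \<tau>) zs))"
proof -
  have "lext (sgn_map \<tau>) (labcor \<tau> zs :: _ \<Rightarrow>\<^sub>0 'b) =
      lext (\<lambda>w. fsc ((-1) ^ n_verts zs) (gen (place \<tau> w (map \<tau> (vals zs))))) (cor (word zs))"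
    unfolding labcor_def lext_lext
    by (rule lext_cong) (auto dest!: keys_cor simp: sgn_map_def map_tree_place verts_word arity_word)
  then show ?thesis by (simp only: labcor_def vals_map_option word_map_option lext_fun_fsc)
qed

text \<open>
  The condition is required for all iterates, because placing labels applies powers of the
  involution.
\<close>

lemma labcor_natural:
  assumes "\<And>x. Some x \<in> set zs \<Longrightarrow> \<forall>n. g ((\<tau> ^^ n) x) = (\<tau>' ^^ n) (g x)"
  shows "lext (\<lambda>t. gen (map_tree g t)) (labcor \<tau> zs) = labcor \<tau>' (map (map_option g) zs)"
proof -
  have *: "map_tree g (place \<tau> w xs) = place \<tau>' w (map g xs)"
    if "arity w = length xs" "\<forall>x\<in>set xs. \<forall>n. g ((\<tau> ^^ n) x) = (\<tau>' ^^ n) (g x)" for w xs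
    using that
  proof (induction w arbitrary: xs)
    case (Lf x)
    then show ?case by (cases xs) auto
  next
    case (Mu l r)
    have "\<forall>x\<in>set (map (\<tau> ^^ verts r) (take (arity l) xs)). \<forall>n. g ((\<tau> ^^ n) x) = (\<tau>' ^^ n) (g x)"
    proof (clarsimp, rename_tac x n)
      fix x n assume "x \<in> set (take (arity l) xs)"
      then have *: "\<forall>n. g ((\<tau> ^^ n) x) = (\<tau>' ^^ n) (g x)" using Mu.prems(2) by (blast dest: in_set_takeD)
      show "g ((\<tau> ^^ n) ((\<tau> ^^ verts r) x)) = (\<tau>' ^^ n) (g ((\<tau> ^^ verts r) x))"
        using *[rule_format, of "n + verts r"] *[rule_format, of "verts r"] by (simp add: funpow_add)
    qed
    then have "map_tree g (place \<tau> l (map (\<tau> ^^ verts r) (take (arity l) xs))) =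
        place \<tau>' l (map g (map (\<tau> ^^ verts r) (take (arity l) xs)))"
      using Mu.prems by (intro Mu.IH) auto
    also have "map g (map (\<tau> ^^ verts r) (take (arity l) xs)) = map (\<tau>' ^^ verts r) (take (arity l) (map g xs))"
      using Mu.prems(2) by (auto simp: take_map dest: in_set_takeD)
    finally have l: "map_tree g (place \<tau> l (map (\<tau> ^^ verts r) (take (arity l) xs))) =
        place \<tau>' l (map (\<tau>' ^^ verts r) (take (arity l) (map g xs)))" .
    have "map_tree g (place \<tau> r (drop (arity l) xs)) = place \<tau>' r (map g (drop (arity l) xs))"
      using Mu.prems by (intro Mu.IH) (auto dest: in_set_dropD)
    then show ?case by (simp add: l drop_map)
  qed auto
  have "lext (\<lambda>t. gen (map_tree g t)) (labcor \<tau> zs :: _ \<Rightarrow>\<^sub>0 'c) =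
      lext (\<lambda>w. gen (place \<tau>' w (map g (vals zs)))) (cor (word zs))"
    unfolding labcor_def lext_lext
    by (rule lext_cong) (use assms in \<open>auto dest!: keys_cor simp: * arity_word\<close>)
  then show ?thesis by (simp only: labcor_def vals_map_option word_map_option)
qed

section \<open>Segmentations and the decomposition of a corolla\<close>

text \<open>
  A segmentation cuts a word into nonempty blocks, each of which is the word of an upper tree,
  written \<open>Some b\<close>. A block consisting of a single cork may also be left attached to
  the bottom tree, which is written \<open>None\<close>. So a segmentation is itself a word,
  namely the one of the bottom tree, with the blocks as labels.
\<close>

abbreviation blk :: "'x option list option \<Rightarrow> 'x option list" where
  "blk q \<equiv> case_option [None] (\<lambda>b. b) q"

abbreviation ucat :: "'x option list option list \<Rightarrow> 'x option list" where
  "ucat Q \<equiv> concat (map blk Q)"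

definition segs :: "'x option list \<Rightarrow> 'x option list option list set" where
  "segs zs = {Q. ucat Q = zs \<and> Some [] \<notin> set Q}"

definition upper_verts :: "'x option list option list \<Rightarrow> nat" where
  "upper_verts Q = sum_list (map (case_option 0 n_verts) Q)"

text \<open>
  The sign of a segmentation in the decomposition of a corolla; it is \<open>vertex_sgn\<close>
  without the contribution of the homotopies, written as a recursion that is convenient for
  concatenation.
\<close>

primrec seg_sgn :: "'x option list option list \<Rightarrow> nat" where
  "seg_sgn [] = 0"
| "seg_sgn (q # Q) = seg_sgn Q + (length (ucat Q) - length Q) * (length (blk q) + n_corks (blk q)) +
     case_option 0 n_verts q * n_corks Q"

abbreviation relabel :: "('x \<Rightarrow> 'y) \<Rightarrow> 'x option list option list \<Rightarrow> 'y option list option list" where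
  "relabel f Q \<equiv> map (map_option (map (map_option f))) Q"

text \<open>
  Every upper tree moves past the labels of the earlier blocks.
\<close>

primrec shift :: "('x \<Rightarrow> 'x) \<Rightarrow> 'x option list option list \<Rightarrow> 'x option list option list" where
  "shift \<tau> [] = []"
| "shift \<tau> (q # Q) = map_option (map (map_option (\<tau> ^^ upper_verts Q))) q # shift \<tau> Q"

text \<open>
  The term of a segmentation: the corolla of the bottom tree, with the corollas of the blocks
  grafted on it.
\<close>

definition segterm :: "('x \<Rightarrow> 'x) \<Rightarrow> 'x option list option list \<Rightarrow> ('x tree tree \<Rightarrow>\<^sub>0 'k::field_char_0)" where
  "segterm \<tau> Q = lext expand (labcor (lext (sgn_map \<tau>)) (map (map_option (labcor \<tau>)) (shift \<tau> Q)))"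

lemma upper_verts_simps [simp]: "upper_verts [] = 0" "upper_verts (q # Q) = case_option 0 n_verts q + upper_verts Q" "upper_verts (Q @ R) = upper_verts Q + upper_verts R"
  by (simp_all add: upper_verts_def)

lemma upper_verts_relabel [simp]: "upper_verts (relabel f Q) = upper_verts Q"
  by (induction Q) (auto split: option.split)

lemma ucat_relabel: "ucat (relabel f Q) = map (map_option f) (ucat Q)"
  by (induction Q) (auto split: option.split)

lemma ucat_relabel': "concat (map (case_option [None] (map (map_option f))) Q) = map (map_option f) (ucat Q)"
  by (induction Q) (auto split: option.split)

lemma seg_sgn_relabel [simp]: "seg_sgn (relabel f Q) = seg_sgn Q"
  by (induction Q) (auto simp: ucat_relabel' comp_def split: option.split)

lemma length_shift [simp]: "length (shift \<tau> Q) = length Q"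
  by (induction Q) auto

lemma word_shift [simp]: "word (shift \<tau> Q) = word Q"
  by (induction Q) auto

lemma shift_append: "shift \<tau> (Q @ R) = relabel (\<tau> ^^ upper_verts R) (shift \<tau> Q) @ shift \<tau> R"
proof (induction Q)
  case (Cons q Q)
  have "\<tau> ^^ (upper_verts Q + upper_verts R) = (\<lambda>x. (\<tau> ^^ upper_verts R) ((\<tau> ^^ upper_verts Q) x))"
    by (metis add.commute comp_def funpow_add)
  then show ?case using Cons by (simp add: option.map_comp comp_def)
qed simp

lemma shift_relabel: "shift \<tau> (relabel (\<tau> ^^ n) Q) = relabel (\<tau> ^^ n) (shift \<tau> Q)"
proof (induction Q)
  case (Cons q Q)
  have "(\<tau> ^^ upper_verts Q) ((\<tau> ^^ n) x) = (\<tau> ^^ n) ((\<tau> ^^ upper_verts Q) x)" for x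
    by (metis add.commute comp_apply funpow_add)
  then show ?case using Cons by (simp add: option.map_comp comp_def)
qed simp

lemma length_ucat: "Some [] \<notin> set Q \<Longrightarrow> length Q \<le> length (ucat Q)"
proof (induction Q)
  case (Cons q Q)
  then have "1 \<le> length (blk q)" by (cases q) (auto simp: Suc_le_eq)
  with Cons show ?case by auto
qed simp

lemma upper_verts_count: "Some [] \<notin> set Q \<Longrightarrow> upper_verts Q + length Q + n_corks Q = length (ucat Q) + n_corks (ucat Q)"
proof (induction Q)
  case (Cons q Q)
  show ?case
  proof (cases q)
    case (Some b)
    then show ?thesis using Cons by (cases b) (auto simp: n_verts_def)
  qed (use Cons in auto)
qed simp

text \<open>
  Cutting a tree does not change the number of its vertices.
\<close>

lemma n_verts_ucat: "Some [] \<notin> set Q \<Longrightarrow> Q \<noteq> [] \<Longrightarrow> n_verts Q + upper_verts Q = n_verts (ucat Q)"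
  using upper_verts_count[of Q] length_ucat[of Q] by (cases Q) (auto simp: n_verts_def)

text \<open>
  The interaction of the two parts consists of the two products in \<open>seg_sgn\<close>, summed
  over the blocks on the right and on the left, respectively.
\<close>

lemma seg_sgn_append:
  assumes "Some [] \<notin> set Q" "Some [] \<notin> set R"
  shows "seg_sgn (Q @ R) = seg_sgn Q + seg_sgn R +
    (length (ucat R) - length R) * (length (ucat Q) + n_corks (ucat Q)) + upper_verts Q * n_corks R"
  using assms(1)
proof (induction Q)
  case (Cons q Q)
  have "length (ucat (Q @ R)) - length (Q @ R) = (length (ucat Q) - length Q) + (length (ucat R) - length R)"
    using length_ucat[of Q] length_ucat[of R] assms Cons.prems by simp
  then show ?case using Cons by (simp add: algebra_simps)
qed simp

lemma finite_segs [simp]: "finite (segs zs)"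
proof (rule finite_subset)
  let ?S = "insert None (Some ` {b. set b \<subseteq> set zs \<and> length b \<le> length zs})"
  show "segs zs \<subseteq> {Q. set Q \<subseteq> ?S \<and> length Q \<le> length zs}"
  proof (clarify, intro conjI subsetI)
    fix Q assume Q: "Q \<in> segs zs"
    then show "length Q \<le> length zs" using length_ucat[of Q] by (auto simp: segs_def)
    fix q assume q: "q \<in> set Q"
    show "q \<in> ?S"
    proof (cases q)
      case (Some b)
      have "set b \<subseteq> set (ucat Q)" using q Some by force
      moreover have "length b \<le> length (ucat Q)"
        using member_le_sum_list[of "length b" "map (length \<circ> blk) Q"] q Some
        by (force simp: length_concat comp_def)
      ultimately show ?thesis using Q Some by (auto simp: segs_def)
    qed simp
  qed
  show "finite {Q. set Q \<subseteq> ?S \<and> length Q \<le> length zs}"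
    by (intro finite_lists_length_le finite.insertI finite_imageI) auto
qed

text \<open>
  A segmentation of a given word is determined by its cuts and by the corks left at the bottom,
  whatever the labels are.
\<close>

lemma relabel_inj:
  assumes "relabel f Q = relabel f R" "ucat Q = ucat R"
  shows "Q = R"
  using assms
proof (induction Q arbitrary: R)
  case (Cons q Q)
  then obtain r R' where R: "R = r # R'" by (cases R) auto
  have e: "map_option (map (map_option f)) q = map_option (map (map_option f)) r"
    using Cons.prems(1) R by simp
  then have "length (blk q) = length (blk r)"
    by (cases q; cases r) (auto dest: map_eq_imp_length_eq)
  then have "blk q = blk r" and u: "ucat Q = ucat R'" using Cons.prems(2) R by auto
  then have "q = r" using e by (cases q; cases r) auto
  then show ?case using Cons.IH[of R'] Cons.prems(1) R u by simp
qed simp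

lemma segs_relabel: "segs (map (map_option f) zs) = relabel f ` segs zs"
proof (intro equalityI subsetI)
  fix Q assume "Q \<in> segs (map (map_option f) zs)"
  then have "ucat Q = map (map_option f) zs" "Some [] \<notin> set Q" by (auto simp: segs_def)
  then have "\<exists>R. Q = relabel f R \<and> ucat R = zs \<and> Some [] \<notin> set R"
  proof (induction Q arbitrary: zs)
    case (Cons q Q)
    then have "map (map_option f) zs = blk q @ ucat Q" by simp
    then obtain z1 z2 where z: "zs = z1 @ z2" "map (map_option f) z1 = blk q" "map (map_option f) z2 = ucat Q"
      by (auto simp: map_eq_append_conv)
    obtain R where R: "Q = relabel f R" "ucat R = z2" "Some [] \<notin> set R"
      using Cons.IH[of z2] z Cons.prems(2) by auto
    show ?case
    proof (cases q)
      case None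
      then have "z1 = [None]" using z(2) by auto
      then show ?thesis using R z None by (intro exI[of _ "None # R"]) auto
    next
      case (Some b)
      then show ?thesis using R z Cons.prems(2) by (intro exI[of _ "Some z1 # R"]) auto
    qed
  qed auto
  then show "Q \<in> relabel f ` segs zs" by (auto simp: segs_def)
next
  fix Q assume "Q \<in> relabel f ` segs zs"
  then show "Q \<in> segs (map (map_option f) zs)"
  proof
    fix R assume R: "Q = relabel f R" "R \<in> segs zs"
    have "Some [] \<notin> set Q"
    proof
      assume "Some [] \<in> set Q"
      then obtain q where "q \<in> set R" "map_option (map (map_option f)) q = Some []"
        unfolding R(1) set_map by (metis imageE)
      then have "Some [] \<in> set R" by (cases q) auto
      then show False using R(2) by (simp add: segs_def)
    qed
    moreover have "ucat Q = map (map_option f) zs"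
      using R(2) unfolding R(1) ucat_relabel segs_def by simp
    ultimately show ?thesis by (simp add: segs_def)
  qed
qed

lemma sum_segs_relabel: "(\<Sum>Q\<in>segs (map (map_option f) zs). g Q) = (\<Sum>Q\<in>segs zs. g (relabel f Q))"
proof -
  have "inj_on (relabel f) (segs zs)"
    by (rule inj_onI, rule relabel_inj[of f]) (auto simp: segs_def simp del: map_map)
  then show ?thesis unfolding segs_relabel by (simp only: sum.reindex comp_def)
qed

lemma ucat_nonempty: "Q \<noteq> [] \<Longrightarrow> Some [] \<notin> set Q \<Longrightarrow> ucat Q \<noteq> []"
  using length_ucat[of Q] by (metis le_zero_eq length_0_conv)

text \<open>
  A split of the word together with segmentations of both parts is the same as a segmentation with
  a split of the list of its blocks. This exchange is the combinatorial core of the decomposition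
  formula.
\<close>

lemma sum_segs_splits:
  "(\<Sum>(l, r)\<in>splits zs. \<Sum>Q\<in>segs l. \<Sum>R\<in>segs r. g Q R) =
   (\<Sum>Q\<in>segs zs. \<Sum>(Q1, Q2)\<in>splits Q. g Q1 Q2)"
proof -
  have "(\<Sum>(l, r)\<in>splits zs. \<Sum>Q\<in>segs l. \<Sum>R\<in>segs r. g Q R) =
      (\<Sum>x\<in>splits zs. \<Sum>(Q, R)\<in>segs (fst x) \<times> segs (snd x). g Q R)"
    by (simp add: sum.cartesian_product case_prod_unfold)
  also have "\<dots> = (\<Sum>(x, Q, R)\<in>(SIGMA x:splits zs. segs (fst x) \<times> segs (snd x)). g Q R)"
    by (subst sum.Sigma) auto
  also have "\<dots> = (\<Sum>(Q, Q1, Q2)\<in>(SIGMA Q:segs zs. splits Q). g Q1 Q2)"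
  proof (rule sum.reindex_bij_witness[where
        i = "\<lambda>(Q, Q1, Q2). ((ucat Q1, ucat Q2), Q1, Q2)" and j = "\<lambda>(x, Q1, Q2). (Q1 @ Q2, Q1, Q2)"])
    fix y assume "y \<in> (SIGMA Q:segs zs. splits Q)"
    then obtain Q Q1 Q2 where y: "y = (Q, Q1, Q2)" "Q \<in> segs zs" "(Q1, Q2) \<in> splits Q" by auto
    then show "(case y of (Q, Q1, Q2) \<Rightarrow> ((ucat Q1, ucat Q2), Q1, Q2)) \<in>
        (SIGMA x:splits zs. segs (fst x) \<times> segs (snd x))"
      by (auto simp: segs_def splits_def ucat_nonempty simp del: concat_eq_Nil_conv Nil_eq_concat_conv)
  qed (auto simp: segs_def splits_def)
  also have "\<dots> = (\<Sum>Q\<in>segs zs. \<Sum>(Q1, Q2)\<in>splits Q. g Q1 Q2)"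
    by (subst sum.Sigma) auto
  finally show ?thesis .
qed

lemma segs_single: "segs [None] = {[Some [None]], [None]}" "segs [Some x] = {[Some [Some x]]}"
proof -
  have "Q = [Some [None]] \<or> Q = [None]" if "Q \<in> segs [None]" for Q :: "'a option list option list"
  proof -
    have "length Q \<le> 1" "Q \<noteq> []" using that length_ucat[of Q] by (auto simp: segs_def)
    then obtain q where "Q = [q]" by (cases Q) auto
    then show ?thesis using that by (cases q) (auto simp: segs_def)
  qed
  then show "segs [None] = {[Some [None :: 'a option]], [None]}" by (auto simp: segs_def)
  have "Q = [Some [Some x]]" if "Q \<in> segs [Some x]" for Q
  proof -
    have "length Q \<le> 1" "Q \<noteq> []" using that length_ucat[of Q] by (auto simp: segs_def)
    then obtain q where "Q = [q]" by (cases Q) auto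
    then show ?thesis using that by (cases q) (auto simp: segs_def)
  qed
  then show "segs [Some x] = {[Some [Some x]]}" by (auto simp: segs_def)
qed

lemma lext_expand_MuF: "lext expand (MuF u v) = MuF (lext expand u) (lext expand v)"
  by (rule lext_MuF_hom) simp

text \<open>
  Labels by linear combinations are multilinear after expansion.
\<close>

lemma expand_scale:
  assumes "\<And>c v. E (fsc c v) = fsc c (E v)"
  shows "length qs = arity w \<Longrightarrow> expand (place E w (map (\<lambda>q. fsc (c q) (g q)) qs)) =
    fsc (prod_list (map c qs)) (expand (place E w (map g qs)))"
proof (induction w arbitrary: qs g)
  case (Lf x)
  then obtain q where "qs = [q]" by (cases qs) auto
  then show ?case by simp
next
  case (Mu l r)
  have E: "(E ^^ n) (fsc c v) = fsc c ((E ^^ n) v)" for n c v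
    by (induction n) (auto simp: assms)
  have "expand (place E l (map (\<lambda>q. fsc (c q) ((E ^^ verts r) (g q))) (take (arity l) qs))) =
      fsc (prod_list (map c (take (arity l) qs))) (expand (place E l (map (\<lambda>q. (E ^^ verts r) (g q)) (take (arity l) qs))))"
    by (rule Mu.IH) (use Mu.prems in simp)
  moreover have "expand (place E r (map (\<lambda>q. fsc (c q) (g q)) (drop (arity l) qs))) =
      fsc (prod_list (map c (drop (arity l) qs))) (expand (place E r (map g (drop (arity l) qs))))"
    by (rule Mu.IH) (use Mu.prems in simp)
  moreover have "prod_list (map c qs) = prod_list (map c (take (arity l) qs)) * prod_list (map c (drop (arity l) qs))"
    by (metis append_take_drop_id map_append prod_list.append)
  ultimately show ?case
    by (simp add: take_map drop_map comp_def E mult.commute)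
qed simp

lemma labcor_expand:
  "lext expand (labcor \<tau> zs) = lext (\<lambda>w. expand (place \<tau> w (vals zs))) (cor (word zs))"
  by (simp add: labcor_def lext_lext)

lemma labcor_scale:
  assumes "\<And>c v. E (fsc c v) = fsc c (E v)"
  shows "lext expand (labcor E (map (map_option (\<lambda>q. fsc (c q) (g q))) Q)) =
    fsc (prod_list (map c (vals Q))) (lext expand (labcor E (map (map_option g) Q)))"
  unfolding labcor_expand vals_map_option word_map_option lext_fun_fsc[symmetric]
  by (rule lext_cong, rule expand_scale[OF assms], drule keys_cor, erule arity_word[symmetric])

lemma funpow_sgn_map_labcor:
  "((lext (sgn_map \<tau>)) ^^ n) (labcor \<tau> zs) = fsc ((-1) ^ (n * n_verts zs)) (labcor \<tau> (map (map_option (\<tau> ^^ n)) zs))"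
proof (induction n)
  case 0
  then show ?case by (simp add: option.map_id0 flip: id_def)
next
  case (Suc n)
  then show ?case by (simp add: labcor_sgn_map option.map_comp comp_def power_add mult.commute)
qed

lemma upper_verts_vals: "upper_verts Q = sum_list (map n_verts (vals Q))"
  by (induction Q) (auto split: option.split)

lemma prod_list_power: "prod_list (map (\<lambda>q. (-1 :: 'k::field_char_0) ^ (n * f q)) qs) = (-1) ^ (n * sum_list (map f qs))"
  by (induction qs) (auto simp: power_add distrib_left)

text \<open>
  The labels of the left part of a bottom tree, which are trees, move past the vertices of its
  right part. This produces a sign from the degrees of these trees and a further shift of their
  labels.
\<close>

lemma segterm_shift:
  "lext expand (labcor (lext (sgn_map \<tau>)) (map (map_option (lext (sgn_map \<tau>) ^^ n))
      (map (map_option (labcor \<tau>)) (relabel (\<tau> ^^ m) (shift \<tau> Q))))) =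
    fsc ((-1) ^ (n * upper_verts Q)) (segterm \<tau> (relabel (\<tau> ^^ (n + m)) Q) :: _ \<Rightarrow>\<^sub>0 'k::field_char_0)"
proof -
  let ?E = "lext (sgn_map \<tau>) :: (_ \<Rightarrow>\<^sub>0 'k) \<Rightarrow> _" and ?R = "relabel (\<tau> ^^ m) (shift \<tau> Q)"
  let ?c = "\<lambda>q. (-1 :: 'k) ^ (n * n_verts q)" and ?g = "\<lambda>q. labcor \<tau> (map (map_option (\<tau> ^^ n)) q) :: _ \<Rightarrow>\<^sub>0 'k"
  have pds: "upper_verts (shift \<tau> Q) = upper_verts Q"
    by (induction Q) (auto split: option.split)
  have 1: "map (map_option (?E ^^ n)) (map (map_option (labcor \<tau>)) ?R) =
      map (map_option (\<lambda>q. fsc (?c q) (?g q))) ?R"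
    by (simp add: option.map_comp comp_def funpow_sgn_map_labcor)
  have 2: "lext expand (labcor ?E (map (map_option (\<lambda>q. fsc (?c q) (?g q))) ?R)) =
      fsc (prod_list (map ?c (vals ?R))) (lext expand (labcor ?E (map (map_option ?g) ?R)))"
    by (rule labcor_scale) simp
  have 3: "prod_list (map ?c (vals ?R)) = (-1) ^ (n * upper_verts Q)"
    unfolding prod_list_power upper_verts_vals[symmetric] upper_verts_relabel pds ..
  have 4: "map (map_option ?g) ?R = map (map_option (labcor \<tau>)) (relabel (\<tau> ^^ (n + m)) (shift \<tau> Q))"
    by (simp add: option.map_comp comp_def funpow_add)
  show ?thesis
    unfolding segterm_def shift_relabel 1 2 3 4 ..
qed

lemma segterm_rec:
  assumes "2 \<le> length Q"
  shows "(segterm \<tau> Q :: _ \<Rightarrow>\<^sub>0 'k::field_char_0) = (\<Sum>(Q1, Q2)\<in>splits Q. fsc ((-1) ^ (split_sgn (word Q1) (word Q2) + n_verts Q2 * upper_verts Q1))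
    (MuF (segterm \<tau> (relabel (\<tau> ^^ (n_verts Q2 + upper_verts Q2)) Q1)) (segterm \<tau> Q2)))"
proof -
  let ?E = "lext (sgn_map \<tau>) :: (_ \<Rightarrow>\<^sub>0 'k) \<Rightarrow> _" and ?lab = "map (map_option (labcor \<tau>))"
  have "(segterm \<tau> Q :: _ \<Rightarrow>\<^sub>0 'k) = (\<Sum>(l, r)\<in>splits (?lab (shift \<tau> Q)). fsc ((-1) ^ split_sgn (word l) (word r))
      (MuF (lext expand (labcor ?E (map (map_option (?E ^^ n_verts r)) l))) (lext expand (labcor ?E r))))"
    unfolding segterm_def using assms
    by (subst labcor_rec) (simp_all only: length_map length_shift lext_sum case_prod_unfold lext_simps lext_expand_MuF)
  also have "\<dots> = (\<Sum>k\<in>{1..<length Q}.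
      fsc ((-1) ^ split_sgn (word (take k Q)) (word (drop k Q))) (MuF
        (lext expand (labcor ?E (map (map_option (?E ^^ n_verts (drop k Q))) (?lab (relabel (\<tau> ^^ upper_verts (drop k Q)) (shift \<tau> (take k Q)))))))
        (segterm \<tau> (drop k Q))))"
    unfolding sum_splits length_map length_shift
  proof (rule sum.cong[OF refl])
    fix k assume k: "k \<in> {1..<length Q}"
    have sh: "shift \<tau> Q = relabel (\<tau> ^^ upper_verts (drop k Q)) (shift \<tau> (take k Q)) @ shift \<tau> (drop k Q)"
      using shift_append[of \<tau> "take k Q" "drop k Q"] by simp
    have t: "take k (shift \<tau> Q) = relabel (\<tau> ^^ upper_verts (drop k Q)) (shift \<tau> (take k Q))"
      and d: "drop k (shift \<tau> Q) = shift \<tau> (drop k Q)"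
      using k by (subst sh; simp)+
    have vts: "n_verts (shift \<tau> R) = n_verts R" for R :: "'a option list option list" by (simp add: n_verts_def)
    show "fsc ((-1) ^ split_sgn (word (take k (?lab (shift \<tau> Q)))) (word (drop k (?lab (shift \<tau> Q)))))
        (MuF (lext expand (labcor ?E (map (map_option (?E ^^ n_verts (drop k (?lab (shift \<tau> Q))))) (take k (?lab (shift \<tau> Q))))))
          (lext expand (labcor ?E (drop k (?lab (shift \<tau> Q)))))) =
      fsc ((-1) ^ split_sgn (word (take k Q)) (word (drop k Q))) (MuF
        (lext expand (labcor ?E (map (map_option (?E ^^ n_verts (drop k Q))) (?lab (relabel (\<tau> ^^ upper_verts (drop k Q)) (shift \<tau> (take k Q)))))))
        (segterm \<tau> (drop k Q)))"
      by (simp only: take_map drop_map t d word_map_option word_shift n_verts_map_option vts segterm_def)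
  qed
  also have "\<dots> = (\<Sum>(Q1, Q2)\<in>splits Q. fsc ((-1) ^ (split_sgn (word Q1) (word Q2) + n_verts Q2 * upper_verts Q1))
    (MuF (segterm \<tau> (relabel (\<tau> ^^ (n_verts Q2 + upper_verts Q2)) Q1)) (segterm \<tau> Q2)))"
    unfolding sum_splits by (simp only: segterm_shift MuF_simps fv.scale_scale power_add)
  finally show ?thesis .
qed

lemma decomp_MuF:
  "lext decomp (MuF u v) = lext (\<lambda>t. gen (Lf t)) (MuF u v) + MuF (lext decomp u) (lext decomp v)"
  by (simp add: lext_MuF lext_fun_add MuF_lext(1)) (simp add: MuF_lext(2))

lemma segterm_whole: "segterm \<tau> [Some zs] = lext (\<lambda>t. gen (Lf t)) (labcor \<tau> zs)"
  by (simp add: segterm_def option.map_id0 flip: id_def)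

text \<open>
  The comparison of signs in the induction step: splitting before segmenting on one side,
  segmenting before splitting on the other.
\<close>

lemma seg_sgn_split:
  assumes "Some [] \<notin> set Q1" "Some [] \<notin> set Q2" "Q1 \<noteq> []" "Q2 \<noteq> []"
  shows "even (split_sgn (word (ucat Q1)) (word (ucat Q2)) + seg_sgn Q1 + seg_sgn Q2 +
    (seg_sgn (Q1 @ Q2) + (split_sgn (word Q1) (word Q2) + n_verts Q2 * upper_verts Q1)))"
proof -
  obtain n where n: "length Q2 = Suc n" using assms(4) by (cases Q2) auto
  obtain m where m: "length (ucat Q2) = Suc n + m" using length_ucat[OF assms(2)] n by (metis le_Suc_ex)
  define c1 c2 where "c1 = n_corks Q1" and "c2 = n_corks Q2"
  define L where "L = length (ucat Q1) + n_corks (ucat Q1)"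
  have L: "L = upper_verts Q1 + length Q1 + c1" using upper_verts_count[OF assms(1)] by (simp add: L_def c1_def)
  show ?thesis
    unfolding seg_sgn_append[OF assms(1,2)] split_sgn_def n_verts_def length_map L_def[symmetric] c1_def[symmetric]
      c2_def[symmetric] n m
  proof -
    \<comment> \<open>with \<open>n + 1\<close> the number of blocks on the right and \<open>n + 1 + m\<close> the length of their concatenation, every
      term of the sum of both exponents occurs twice\<close>
    have "L * (Suc n + m - 1) + seg_sgn Q1 + seg_sgn Q2 + (seg_sgn Q1 + seg_sgn Q2 +
        (Suc n + m - Suc n) * L + upper_verts Q1 * c2 + ((length Q1 + c1) * (Suc n - 1) + (Suc n - 1 + c2) * upper_verts Q1)) =
        2 * (seg_sgn Q1 + seg_sgn Q2 + m * L + L * n + upper_verts Q1 * c2)"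
      by (simp add: L algebra_simps)
    then show "even (L * (Suc n + m - 1) + seg_sgn Q1 + seg_sgn Q2 + (seg_sgn Q1 + seg_sgn Q2 +
        (Suc n + m - Suc n) * L + upper_verts Q1 * c2 + ((length Q1 + c1) * (Suc n - 1) + (Suc n - 1 + c2) * upper_verts Q1)))"
      by (rule dvdI)
  qed
qed

lemma scale_sum_pair: "fsc c (\<Sum>(l, r)\<in>S. f l r) = (\<Sum>(l, r)\<in>S. fsc c (f l r))"
  by (simp add: fv.scale_sum_right case_prod_unfold)

text \<open>
  The decomposition of a corolla is the signed sum over all segmentations of its word. In the
  induction, \<open>decomp\<close> either keeps the whole tree as upper tree, which is the
  segmentation with one block, or cuts both subtrees of the root.
\<close>

lemma decomp_labcor:
  assumes "zs \<noteq> []"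
  shows "(lext decomp (labcor \<tau> zs) :: _ \<Rightarrow>\<^sub>0 'k::field_char_0) = (\<Sum>Q\<in>segs zs. fsc ((-1) ^ seg_sgn Q) (segterm \<tau> Q))"
  using assms
proof (induction zs rule: measure_induct_rule[of length])
  case (less zs)
  show ?case
    using less.prems
  proof (cases rule: labelled_word_cases)
    case 1
    show ?thesis unfolding 1 segs_single by (simp add: segterm_whole) (simp add: segterm_def)
  next
    case 2
    show ?thesis unfolding 2 segs_single by (simp add: segterm_whole)
  next
    case 3
    let ?sh = "\<lambda>r. map (map_option (\<tau> ^^ n_verts r))"
    let ?g = "\<lambda>Q1 Q2. fsc ((-1) ^ (split_sgn (word (ucat Q1)) (word (ucat Q2)) + seg_sgn Q1 + seg_sgn Q2))
        (MuF (segterm \<tau> (relabel (\<tau> ^^ n_verts (ucat Q2)) Q1)) (segterm \<tau> Q2)) :: _ \<Rightarrow>\<^sub>0 'k"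
    have IH: "(lext decomp (labcor \<tau> (?sh r l)) :: _ \<Rightarrow>\<^sub>0 'k) = (\<Sum>Q\<in>segs l. fsc ((-1) ^ seg_sgn Q) (segterm \<tau> (relabel (\<tau> ^^ n_verts r) Q)))"
      "(lext decomp (labcor \<tau> r) :: _ \<Rightarrow>\<^sub>0 'k) = (\<Sum>Q\<in>segs r. fsc ((-1) ^ seg_sgn Q) (segterm \<tau> Q))"
      if "(l, r) \<in> splits zs" for l r
    proof -
      have "(lext decomp (labcor \<tau> (?sh r l)) :: _ \<Rightarrow>\<^sub>0 'k) = (\<Sum>Q\<in>segs (?sh r l). fsc ((-1) ^ seg_sgn Q) (segterm \<tau> Q))"
        using that by (intro less.IH) (auto simp: splits_def)
      then show "(lext decomp (labcor \<tau> (?sh r l)) :: _ \<Rightarrow>\<^sub>0 'k) = (\<Sum>Q\<in>segs l. fsc ((-1) ^ seg_sgn Q) (segterm \<tau> (relabel (\<tau> ^^ n_verts r) Q)))"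
        unfolding sum_segs_relabel seg_sgn_relabel .
      show "(lext decomp (labcor \<tau> r) :: _ \<Rightarrow>\<^sub>0 'k) = (\<Sum>Q\<in>segs r. fsc ((-1) ^ seg_sgn Q) (segterm \<tau> Q))"
        using that by (intro less.IH) (auto simp: splits_def)
    qed
    have "(lext decomp (labcor \<tau> zs) :: _ \<Rightarrow>\<^sub>0 'k) = (\<Sum>(l, r)\<in>splits zs. fsc ((-1) ^ split_sgn (word l) (word r))
        (lext (\<lambda>t. gen (Lf t)) (MuF (labcor \<tau> (?sh r l)) (labcor \<tau> r)) +
          MuF (lext decomp (labcor \<tau> (?sh r l))) (lext decomp (labcor \<tau> r))))"
      unfolding labcor_rec[OF 3] by (simp only: lext_sum case_prod_unfold lext_simps decomp_MuF)
    also have "\<dots> = lext (\<lambda>t. gen (Lf t)) (labcor \<tau> zs) +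
        (\<Sum>(l, r)\<in>splits zs. fsc ((-1) ^ split_sgn (word l) (word r))
          (MuF (lext decomp (labcor \<tau> (?sh r l))) (lext decomp (labcor \<tau> r))))"
      unfolding labcor_rec[OF 3] by (simp only: lext_sum case_prod_unfold lext_simps fv.scale_right_distrib sum.distrib)
    also have "(\<Sum>(l, r)\<in>splits zs. fsc ((-1) ^ split_sgn (word l) (word r))
          (MuF (lext decomp (labcor \<tau> (?sh r l))) (lext decomp (labcor \<tau> r)))) =
        (\<Sum>(l, r)\<in>splits zs. \<Sum>Q1\<in>segs l. \<Sum>Q2\<in>segs r. ?g Q1 Q2)"
    proof (rule sum_pair_cong)
      fix l r assume lr: "(l, r) \<in> splits zs"
      show "fsc ((-1) ^ split_sgn (word l) (word r))
          (MuF (lext decomp (labcor \<tau> (?sh r l))) (lext decomp (labcor \<tau> r))) = (\<Sum>Q1\<in>segs l. \<Sum>Q2\<in>segs r. ?g Q1 Q2)"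
        unfolding IH[OF lr] MuF_sum(1) fv.scale_sum_right unfolding MuF_sum(2) fv.scale_sum_right
        by (intro sum.cong refl) (auto simp: segs_def power_add mult_ac)
    qed
    also have "\<dots> = (\<Sum>Q\<in>segs zs. \<Sum>(Q1, Q2)\<in>splits Q. ?g Q1 Q2)"
      by (rule sum_segs_splits)
    also have "\<dots> = (\<Sum>Q\<in>segs zs - {[Some zs]}. fsc ((-1) ^ seg_sgn Q) (segterm \<tau> Q))"
    proof -
      have whole: "[Some zs] \<in> segs zs" using 3 by (auto simp: segs_def)
      \<comment> \<open>a list with one block has no splits\<close>
      have "(\<Sum>(Q1, Q2)\<in>splits [Some zs]. ?g Q1 Q2) = 0" by (simp add: splits_image)
      then have "(\<Sum>Q\<in>segs zs. \<Sum>(Q1, Q2)\<in>splits Q. ?g Q1 Q2) =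
          (\<Sum>Q\<in>segs zs - {[Some zs]}. \<Sum>(Q1, Q2)\<in>splits Q. ?g Q1 Q2)"
        using whole by (subst sum.remove[OF finite_segs whole]) simp
      also have "\<dots> = (\<Sum>Q\<in>segs zs - {[Some zs]}. fsc ((-1) ^ seg_sgn Q) (segterm \<tau> Q))"
      proof (rule sum.cong[OF refl])
        fix Q assume Q: "Q \<in> segs zs - {[Some zs]}"
        have "2 \<le> length Q"
        proof (rule ccontr)
          assume "\<not> 2 \<le> length Q"
          then consider "Q = []" | q where "Q = [q]" by (cases Q rule: remdups_adj.cases) auto
          then show False using Q 3 by cases (auto simp: segs_def split: option.splits)
        qed
        show "(\<Sum>(Q1, Q2)\<in>splits Q. ?g Q1 Q2) = fsc ((-1) ^ seg_sgn Q) (segterm \<tau> Q)"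
          unfolding segterm_rec[OF \<open>2 \<le> length Q\<close>] scale_sum_pair
        proof (rule sum_pair_cong)
          fix Q1 Q2 assume "(Q1, Q2) \<in> splits Q"
          then have s: "Q = Q1 @ Q2" "Q1 \<noteq> []" "Q2 \<noteq> []" "Some [] \<notin> set Q1" "Some [] \<notin> set Q2"
            using Q by (auto simp: splits_def segs_def)
          show "?g Q1 Q2 = fsc ((-1) ^ seg_sgn Q) (fsc ((-1) ^ (split_sgn (word Q1) (word Q2) + n_verts Q2 * upper_verts Q1))
              (MuF (segterm \<tau> (relabel (\<tau> ^^ (n_verts Q2 + upper_verts Q2)) Q1)) (segterm \<tau> Q2)))"
            unfolding n_verts_ucat[OF s(5,3)] fv.scale_scale power_add[symmetric] s(1)
            by (subst power_parity[OF seg_sgn_split[OF s(4,5,2,3)]]) (rule refl)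
        qed
      qed
      finally show ?thesis .
    qed
    also have "lext (\<lambda>t. gen (Lf t)) (labcor \<tau> zs) + \<dots> = (\<Sum>Q\<in>segs zs. fsc ((-1) ^ seg_sgn Q) (segterm \<tau> Q))"
    proof -
      have whole: "[Some zs] \<in> segs zs" using 3 by (auto simp: segs_def)
      show ?thesis by (simp add: sum.remove[OF finite_segs whole] segterm_whole)
    qed
    finally show ?thesis .
  qed
qed

section \<open>The cooperad is spanned by the corollas\<close>

lemma linear_span:
  assumes "Vector_Spaces.linear fsc s \<phi>" "module.subspace s T" "\<And>x. x \<in> S \<Longrightarrow> \<phi> x \<in> T" "v \<in> fv.span S"
  shows "\<phi> v \<in> T"
proof -
  interpret l: Vector_Spaces.linear fsc s \<phi> by fact
  have "fv.subspace (\<phi> -` T)"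
    using l.subspace_vimage[OF assms(2)] by (simp add: vimage_def)
  then have "fv.span S \<subseteq> \<phi> -` T"
    by (rule fv.span_minimal[rotated]) (use assms(3) in auto)
  then show ?thesis using assms(4) by auto
qed

lemma place_unit [simp]: "place \<tau> w (xs :: unit list) = w"
  by (induction w arbitrary: xs) auto

lemma labcor_unit: "labcor \<tau> (zs :: unit option list) = cor (word zs)"
  by (simp add: labcor_def)

lemma tree_parity_eq: "tree_parity = lext (sgn_map id)"
  unfolding tree_parity_def sgn_map_def[abs_def] tree.map_id ..

text \<open>
  This is the decomposition formula with the trivial label at every leaf.
\<close>

lemma decomp_cor_composite:
  "(lext decomp (cor b) :: _ \<Rightarrow>\<^sub>0 'k::field_char_0) \<in> composite (fv.span (range cor))"
proof (cases "b = []")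
  case True
  then show ?thesis by (simp add: composite_def fv.span_zero)
next
  case False
  define zs where "zs = map (\<lambda>c. if c then None else Some ()) b"
  have w: "word zs = b" by (simp add: zs_def comp_def)
  have "zs \<noteq> []" using False by (simp add: zs_def)
  have "(lext decomp (cor b) :: _ \<Rightarrow>\<^sub>0 'k) = (\<Sum>Q\<in>segs zs. fsc ((-1) ^ seg_sgn Q) (segterm id Q :: _ \<Rightarrow>\<^sub>0 'k))"
    using decomp_labcor[OF \<open>zs \<noteq> []\<close>, of id] by (simp only: labcor_unit w)
  also have "\<dots> \<in> composite (fv.span (range cor))"
  proof -
    have "\<exists>x ys. segterm id Q = lext (\<lambda>b. expand (place tree_parity b ys)) x \<and>
        x \<in> fv.span (range cor) \<and> set ys \<subseteq> fv.span (range cor) \<and>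
        (\<forall>b\<in>supp (x :: _ \<Rightarrow>\<^sub>0 'k). arity b = length ys)" for Q :: "unit option list option list"
    proof (intro exI conjI)
      let ?ys = "vals (map (map_option (labcor id)) (shift id Q)) :: (unit tree \<Rightarrow>\<^sub>0 'k) list"
      show "segterm id Q = lext (\<lambda>b. expand (place tree_parity b ?ys)) (cor (word Q))"
        unfolding segterm_def labcor_expand tree_parity_eq word_map_option word_shift ..
      show "cor (word Q) \<in> fv.span (range cor)" by (auto intro: fv.span_base)
      show "set ?ys \<subseteq> fv.span (range cor)"
        unfolding vals_map_option by (auto simp: labcor_unit intro!: fv.span_base)
      show "\<forall>b\<in>supp (cor (word Q) :: _ \<Rightarrow>\<^sub>0 'k). arity b = length ?ys"
      proof
        fix b assume "b \<in> supp (cor (word Q) :: _ \<Rightarrow>\<^sub>0 'k)"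
        then have "corkword b = word (map (map_option (labcor id :: _ \<Rightarrow> unit tree \<Rightarrow>\<^sub>0 'k)) (shift id Q))"
          by (simp only: word_map_option word_shift keys_cor)
        then show "arity b = length ?ys" by (rule arity_word)
      qed
    qed
    then show ?thesis
      unfolding composite_def by (intro fv.span_sum fv.span_scale fv.span_base) blast
  qed
  finally show ?thesis .
qed

lemma part_cor:
  assumes "\<And>w w'. corkword w = b \<Longrightarrow> corkword w' = b \<Longrightarrow> Q w \<longleftrightarrow> Q w'"
  shows "part Q (cor b :: _ \<Rightarrow>\<^sub>0 'k::field_char_0) = cor b \<or> part Q (cor b :: _ \<Rightarrow>\<^sub>0 'k) = 0"
proof (cases "\<exists>w. corkword w = b \<and> Q w")
  case True
  then have "part Q (cor b :: _ \<Rightarrow>\<^sub>0 'k) = lext gen (cor b)"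
    unfolding part_def by (intro lext_cong) (use assms in \<open>auto dest!: keys_cor\<close>)
  then show ?thesis by simp
next
  case False
  then have "part Q (cor b :: _ \<Rightarrow>\<^sub>0 'k) = lext (\<lambda>_. 0) (cor b)"
    unfolding part_def by (intro lext_cong) (auto dest!: keys_cor)
  then show ?thesis by simp
qed

lemma part_linear: "Vector_Spaces.linear fsc fsc (part Q)"
  unfolding part_def by (rule lext_linear)

lemma verts_eq: "corkword w = corkword w' \<Longrightarrow> verts w = verts w'"
  by (metis verts_corkword nat.inject)

lemma arity_eq: "corkword w = corkword w' \<Longrightarrow> arity w = arity w'"
  by (metis arity_corkword add_right_cancel)

lemma cor_weight2: "length b + corks b = 3 \<Longrightarrow> (cor b :: _ \<Rightarrow>\<^sub>0 'k::field_char_0) \<in> s2qR"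
proof -
  assume *: "length b + corks b = 3"
  have "b = [False, False, False] \<or> b = [True, False] \<or> b = [False, True]"
  proof -
    have "length b \<le> 3" using * by simp
    then consider "b = []" | x where "b = [x]" | x y where "b = [x, y]" | x y z where "b = [x, y, z]"
      by (cases b rule: remdups_adj.cases; cases "tl (tl b)") auto
    then show ?thesis using * by cases (auto split: if_splits)
  qed
  moreover have "(cor [x, y] :: _ \<Rightarrow>\<^sub>0 'k) = MuF (cor [x]) (cor [y])" for x y
    by (subst cor_rec) (simp_all add: sum_splits split_sgn_def del: cor_single)
  moreover have "(cor [False, False, False] :: _ \<Rightarrow>\<^sub>0 'k) = gen (Mu (Mu (Lf ()) (Lf ())) (Lf ())) - gen (Mu (Lf ()) (Mu (Lf ()) (Lf ())))"
    by (subst cor_rec) (simp_all add: sum_splits split_sgn_def calculation(2) atLeastLessThan_upt upt_rec)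
  ultimately show ?thesis unfolding s2qR_def by (auto intro!: fv.span_base)
qed

lemma subcooperad_cor: "subcooperad (fv.span (range (cor :: _ \<Rightarrow> _ \<Rightarrow>\<^sub>0 'k::field_char_0)))"
  unfolding subcooperad_def
proof (intro conjI ballI allI)
  show "fv.subspace (fv.span (range cor))" by (rule fv.subspace_span)
  fix v :: "unit tree \<Rightarrow>\<^sub>0 'k" assume v: "v \<in> fv.span (range cor)"
  show "part (\<lambda>w. arity w = m \<and> verts w = k) v \<in> fv.span (range cor)" for m k
  proof (rule linear_span[OF part_linear fv.subspace_span _ v])
    fix x :: "unit tree \<Rightarrow>\<^sub>0 'k" assume "x \<in> range cor"
    then obtain b where "x = cor b" by auto
    moreover have "part (\<lambda>w. arity w = m \<and> verts w = k) (cor b :: unit tree \<Rightarrow>\<^sub>0 'k) = cor b \<or>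
        part (\<lambda>w. arity w = m \<and> verts w = k) (cor b :: unit tree \<Rightarrow>\<^sub>0 'k) = 0"
      by (rule part_cor) (metis verts_eq arity_eq)
    ultimately show "part (\<lambda>w. arity w = m \<and> verts w = k) x \<in> fv.span (range cor)"
      by (auto intro: fv.span_base fv.span_zero)
  qed
  show "lext decomp v \<in> composite (fv.span (range cor))"
  proof (rule linear_span[OF lext_linear _ _ v])
    show "fv.subspace (composite (fv.span (range cor)))"
      unfolding composite_def by (rule fv.subspace_span)
  qed (auto simp: decomp_cor_composite)
qed

lemma cor_weight2_part: "part (\<lambda>w. verts w = 2) v \<in> s2qR" if "v \<in> fv.span (range cor)"
proof (rule linear_span[OF part_linear _ _ that])
  show "fv.subspace s2qR" by (simp add: s2qR_def fv.subspace_span)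
  then have zero: "0 \<in> s2qR" by (rule fv.subspace_0)
  fix x :: "unit tree \<Rightarrow>\<^sub>0 'a" assume "x \<in> range cor"
  then obtain b where x: "x = cor b" by auto
  show "part (\<lambda>w. verts w = 2) x \<in> s2qR"
  proof (cases "length b + corks b = 3")
    case True
    then show ?thesis
      using part_cor[of b "\<lambda>w. verts w = 2"] verts_eq cor_weight2[OF True] zero unfolding x by (metis (no_types, lifting))
  next
    case False
    have "part (\<lambda>w. verts w = 2) x = lext (\<lambda>_. 0) x"
      unfolding part_def x
    proof (rule lext_cong)
      fix w assume "w \<in> supp (cor b :: unit tree \<Rightarrow>\<^sub>0 'a)"
      then have "corkword w = b" by (rule keys_cor)
      then have "verts w \<noteq> 2" using False verts_corkword[of w] by simp
      then show "(if verts w = 2 then gen w else 0) = (0 :: unit tree \<Rightarrow>\<^sub>0 'a)" by simp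
    qed
    then show ?thesis using zero by simp
  qed
qed

lemma cor_in_uAs_dual: "fv.span (range cor) \<subseteq> uAs_dual"
  unfolding uAs_dual_def using subcooperad_cor cor_weight2_part by blast

lemma lookup_lext: "coef (lext f v) y =
    (\<Sum>x\<in>supp v. coef v x * coef (f x) y)"
  by (simp add: lext_def lookup_sum lookup_fsc)

lemma lookup_MuF [simp]:
  "coef (MuF u v :: _ \<Rightarrow>\<^sub>0 'b::field_char_0) (Mu s t) = coef u s * coef v t"
  "coef (MuF u v :: _ \<Rightarrow>\<^sub>0 'b) (Lf x) = 0"
  "coef (MuF u v :: _ \<Rightarrow>\<^sub>0 'b) Cork = 0"
proof -
  have *: "coef (gen (Mu s' t') :: _ \<Rightarrow>\<^sub>0 'b) (Mu s t) =
      coef (gen s') s * coef (gen t') t" for s' t'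
    by (auto simp: lookup_gen)
  have g: "(\<Sum>x\<in>supp w. coef w x * coef (gen x) y) = coef w y"
    for w :: "'a tree \<Rightarrow>\<^sub>0 'b" and y
    using lookup_lext[of gen w y] by simp
  have "coef (MuF u v) (Mu s t) = (\<Sum>x\<in>supp u. coef u x *
      (coef (gen x) s * (\<Sum>y\<in>supp v. coef v y * coef (gen y) t)))"
    unfolding MuF_def lookup_lext * sum_distrib_left by (simp only: mult_ac)
  then show "coef (MuF u v) (Mu s t) = coef u s * coef v t"
    unfolding g by (simp add: mult.assoc[symmetric] sum_distrib_right[symmetric] g)
qed (simp_all add: MuF_def lookup_lext lookup_gen)

text \<open>
  \<open>\<F>\<^sup>c(sW)\<close> is cofree on trees: each two-level tree arises from exactly one
  tree, by cutting it. So the coefficients of a decomposition are coefficients of the original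
  element.
\<close>

primrec graft :: "'x tree tree \<Rightarrow> 'x tree" where
  "graft (Lf t) = t"
| "graft Cork = Cork"
| "graft (Mu s t) = Mu (graft s) (graft t)"

lemma lookup_decomp: "coef (decomp w) B = (if graft B = w then 1 else 0)"
  by (induction w arbitrary: B; case_tac B) (auto simp: lookup_add lookup_gen)

lemma lookup_lext_decomp: "coef (lext decomp c) B = coef c (graft B)"
proof -
  have "coef (lext decomp c) B =
      (\<Sum>x\<in>supp c. if graft B = x then coef c x else 0)"
    unfolding lookup_lext by (rule sum.cong) (auto simp: lookup_decomp)
  then show ?thesis by (auto simp: in_keys_iff)
qed

lemma lookup_Lf: "coef (lext (\<lambda>y. gen (Lf y)) v) B =
    (case B of Lf y \<Rightarrow> coef v y | _ \<Rightarrow> 0)"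
proof (cases B)
  case (Lf y)
  have "coef (lext (\<lambda>y. gen (Lf y)) v) B =
      (\<Sum>x\<in>supp v. if y = x then coef v x else 0)"
    unfolding lookup_lext by (rule sum.cong) (auto simp: lookup_gen Lf)
  then show ?thesis by (auto simp: in_keys_iff Lf)
qed (auto simp: lookup_lext lookup_gen)

lemma lookup_expand_shape: "shape s \<noteq> shape B \<Longrightarrow> coef (expand s) B = 0"
  by (induction s arbitrary: B; case_tac B) (auto simp: lookup_Lf lookup_gen)

text \<open>
  Only the bottom tree of the right shape contributes to the coefficient of a two-level tree.
\<close>

lemma lookup_generator:
  "coef (lext (\<lambda>b. expand (place \<tau> b ys)) x) B =
     coef x (shape B) * coef (expand (place \<tau> (shape B) ys)) B"
proof -
  have "coef (lext (\<lambda>b. expand (place \<tau> b ys)) x) B =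
      (\<Sum>b\<in>supp x. if shape B = b then coef x b * coef (expand (place \<tau> b ys)) B else 0)"
    unfolding lookup_lext by (rule sum.cong) (auto simp: lookup_expand_shape)
  then show ?thesis by (auto simp: in_keys_iff)
qed

text \<open>
  Any sub-cooperad that satisfies the condition in the definition of \<open>uAs_dual\<close>.
\<close>

locale weight2_cooperad =
  fixes P :: "(unit tree \<Rightarrow>\<^sub>0 'k::field_char_0) set"
  assumes sub: "subcooperad P" and weight2: "\<And>v. v \<in> P \<Longrightarrow> part (\<lambda>w. verts w = 2) v \<in> s2qR"
begin

lemma subspace: "fv.subspace P"
  using sub by (simp add: subcooperad_def)

lemma composite_rule:
  assumes "c \<in> P" "Vector_Spaces.linear fsc s \<phi>" "module.subspace s T"
    and "\<And>x ys. x \<in> P \<Longrightarrow> set ys \<subseteq> P \<Longrightarrow> (\<forall>b\<in>supp x. arity b = length ys) \<Longrightarrow>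
      \<phi> (lext (\<lambda>b. expand (place tree_parity b ys)) x) \<in> T"
  shows "\<phi> (lext decomp c) \<in> T"
proof (rule linear_span[OF assms(2,3)])
  show "lext decomp c \<in> fspan {lext (\<lambda>b. expand (place tree_parity b ys)) x | x ys.
     x \<in> P \<and> set ys \<subseteq> P \<and> (\<forall>b\<in>supp x. arity b = length ys)}"
    using sub assms(1) by (simp add: subcooperad_def composite_def)
qed (use assms(4) in auto)

lemma keys_arity: "\<forall>b\<in>supp x. arity b = m \<Longrightarrow> arity b \<noteq> m \<Longrightarrow> coef x b = 0"
  by (meson in_keys_iff)

lemma generator_at_Mu:
  assumes "set ys \<subseteq> P" "\<forall>b\<in>supp x. arity b = length ys"
  shows "\<exists>a. \<exists>y1\<in>P. \<exists>y2\<in>P. \<forall>l r. coef (lext (\<lambda>b. expand (place tree_parity b ys)) x)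
    (Mu (Lf l) (Lf r)) = a * coef y1 l * coef y2 r"
proof (cases "length ys = 2")
  case True
  then obtain y1 y2 where ys: "ys = [y1, y2]" by (auto simp: length_Suc_conv numeral_2_eq_2)
  show ?thesis
    by (rule exI[of _ "coef x (Mu (Lf ()) (Lf ()))"], rule bexI[of _ y1], rule bexI[of _ y2])
      (use assms(1) ys in \<open>auto simp: lookup_generator lookup_Lf\<close>)
next
  case False
  then have "coef x (Mu (Lf ()) (Lf ())) = 0"
    using keys_arity[OF assms(2), of "Mu (Lf ()) (Lf ())"] by simp
  then show ?thesis
    using fv.subspace_0[OF subspace] by (intro exI[of _ 0] bexI[of _ 0]) (auto simp: lookup_generator)
qed

text \<open>
  If the coefficients at a family of two-level trees, seen as a function of the index, come from
  \<open>P\<close> for the generators of \<open>composite P\<close>, they do so for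
  decompositions. For a bottom tree with one vertex \<open>\<mu>\<close> this gives the two slices
  below: fixing one subtree of the root leaves an element of \<open>P\<close>.
\<close>

lemma slice:
  assumes "c \<in> P" "inj B"
    and "\<And>(x :: unit tree \<Rightarrow>\<^sub>0 'k) ys. set ys \<subseteq> P \<Longrightarrow> (\<forall>b\<in>supp x. arity b = length ys) \<Longrightarrow>
      \<exists>y\<in>P. \<forall>z. coef (lext (\<lambda>b. expand (place tree_parity b ys)) x) (B z) = coef y z"
  shows "\<exists>c'\<in>P. \<forall>z. coef c' z = coef c (graft (B z))"
proof -
  define \<phi> :: "(unit tree tree \<Rightarrow>\<^sub>0 'k) \<Rightarrow> (unit tree \<Rightarrow>\<^sub>0 'k)" where
    "\<phi> = lext (\<lambda>T. if T \<in> range B then gen (inv B T) else 0)"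
  have \<phi>: "coef (\<phi> X) z = coef X (B z)" for X z
  proof -
    have "coef (\<phi> X) z =
        (\<Sum>T\<in>supp X. if B z = T then coef X T else 0)"
      unfolding \<phi>_def lookup_lext using assms(2)
      by (intro sum.cong) (auto simp: lookup_gen inj_eq inv_f_f split: if_splits, metis rangeI)
    then show ?thesis by (auto simp: in_keys_iff)
  qed
  have "\<phi> (lext decomp c) \<in> P"
  proof (rule composite_rule[OF assms(1) _ subspace])
    show "Vector_Spaces.linear fsc fsc \<phi>" unfolding \<phi>_def by (rule lext_linear)
    fix x :: "unit tree \<Rightarrow>\<^sub>0 'k" and ys
    assume "set ys \<subseteq> P" "\<forall>b\<in>supp x. arity b = length ys"
    then obtain y where y: "y \<in> P"
      "\<And>z. coef (lext (\<lambda>b. expand (place tree_parity b ys)) x) (B z) = coef y z"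
      using assms(3) by blast
    have "\<phi> (lext (\<lambda>b. expand (place tree_parity b ys)) x) = y"
      by (rule poly_mapping_eqI) (simp add: \<phi> y(2))
    then show "\<phi> (lext (\<lambda>b. expand (place tree_parity b ys)) x) \<in> P" using y(1) by simp
  qed
  then show ?thesis
    by (intro bexI[of _ "\<phi> (lext decomp c)"]) (simp_all add: \<phi> lookup_lext_decomp)
qed

lemma left_slice:
  assumes "c \<in> P"
  shows "\<exists>c'\<in>P. \<forall>l. coef c' l = coef c (Mu l r)"
proof -
  have "\<exists>c'\<in>P. \<forall>l. coef c' l = coef c (graft (Mu (Lf l) (Lf r)))"
  proof (rule slice[OF assms])
    fix x :: "unit tree \<Rightarrow>\<^sub>0 'k" and ys
    assume "set ys \<subseteq> P" "\<forall>b\<in>supp x. arity b = length ys"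
    then obtain a y1 y2 where y: "y1 \<in> P" "\<And>l r. coef (lext (\<lambda>b. expand (place tree_parity b ys)) x)
        (Mu (Lf l) (Lf r)) = a * coef y1 l * coef y2 r"
      using generator_at_Mu by metis
    show "\<exists>y\<in>P. \<forall>l. coef (lext (\<lambda>b. expand (place tree_parity b ys)) x) (Mu (Lf l) (Lf r)) = coef y l"
      using fv.subspace_scale[OF subspace y(1)]
      by (intro bexI[of _ "fsc (a * coef y2 r) y1"]) (simp_all add: y(2) lookup_fsc)
  qed (auto simp: inj_def)
  then show ?thesis by simp
qed

lemma right_slice:
  assumes "c \<in> P"
  shows "\<exists>c'\<in>P. \<forall>r. coef c' r = coef c (Mu l r)"
proof -
  have "\<exists>c'\<in>P. \<forall>r. coef c' r = coef c (graft (Mu (Lf l) (Lf r)))"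
  proof (rule slice[OF assms])
    fix x :: "unit tree \<Rightarrow>\<^sub>0 'k" and ys
    assume "set ys \<subseteq> P" "\<forall>b\<in>supp x. arity b = length ys"
    then obtain a y1 y2 where y: "y2 \<in> P" "\<And>l r. coef (lext (\<lambda>b. expand (place tree_parity b ys)) x)
        (Mu (Lf l) (Lf r)) = a * coef y1 l * coef y2 r"
      using generator_at_Mu by metis
    show "\<exists>y\<in>P. \<forall>r. coef (lext (\<lambda>b. expand (place tree_parity b ys)) x) (Mu (Lf l) (Lf r)) = coef y r"
      using fv.subspace_scale[OF subspace y(1)]
      by (intro bexI[of _ "fsc (a * coef y1 l) y2"]) (simp_all add: y(2) lookup_fsc)
  qed (auto simp: inj_def)
  then show ?thesis by simp
qed

lemma lookup_tree_parity: "coef (tree_parity y) a = (-1) ^ verts a * coef y a"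
proof -
  have "coef (tree_parity y) a =
      (\<Sum>x\<in>supp y. if a = x then (-1) ^ verts a * coef y a else 0)"
    unfolding tree_parity_def lookup_lext by (rule sum.cong) (auto simp: lookup_fsc lookup_gen)
  then show ?thesis by (auto simp: in_keys_iff)
qed

text \<open>
  This is where the relation \<open>s\<^sup>2 qR\<close> enters: its elements have opposite
  coefficients at the two binary trees with three leaves.
\<close>

lemma assoc_coeff:
  assumes "x \<in> P"
  shows "coef x (Mu (Lf ()) (Mu (Lf ()) (Lf ()))) = - coef x (Mu (Mu (Lf ()) (Lf ())) (Lf ()))"
proof -
  let ?r = "Mu (Lf ()) (Mu (Lf ()) (Lf ()))" and ?l = "Mu (Mu (Lf ()) (Lf ())) (Lf ())"
  let ?T = "{v :: unit tree \<Rightarrow>\<^sub>0 'k. coef v ?r + coef v ?l = 0}"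
  have "fv.subspace ?T"
    by (rule fv.subspaceI) (auto simp: lookup_add lookup_fsc algebra_simps simp flip: distrib_left)
  then have "s2qR \<subseteq> ?T"
    unfolding s2qR_def by (rule fv.span_minimal[rotated]) (auto simp: lookup_minus lookup_gen)
  then have "part (\<lambda>w. verts w = 2) x \<in> ?T" using weight2[OF assms] by blast
  moreover have "coef (part Q x) w = (if Q w then coef x w else 0)" for Q w
  proof -
    have "coef (part Q x) w =
        (\<Sum>y\<in>supp x. if w = y then (if Q w then coef x w else 0) else 0)"
      unfolding part_def lookup_lext by (rule sum.cong) (auto simp: lookup_gen)
    then show ?thesis by (auto simp: in_keys_iff)
  qed
  ultimately show ?thesis by (simp add: eq_neg_iff_add_eq_0)
qed

text \<open>
  The bottom trees with two vertices of an element of \<open>P\<close> are governed by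
  \<open>assoc_coeff\<close>. In the right comb, the first upper tree has moved past one more
  vertex.
\<close>

lemma rotate:
  assumes "c \<in> P"
  shows "coef c (Mu a (Mu b d)) = - ((-1) ^ verts a * coef c (Mu (Mu a b) d))"
proof -
  let ?r = "Mu (Lf a) (Mu (Lf b) (Lf d))" and ?l = "Mu (Mu (Lf a) (Lf b)) (Lf d)"
  define \<phi> where "\<phi> X = coef X ?r + (-1) ^ verts a * coef X ?l"
    for X :: "unit tree tree \<Rightarrow>\<^sub>0 'k"
  interpret k: vector_space "(*) :: 'k \<Rightarrow> 'k \<Rightarrow> 'k" by unfold_locales (auto simp: algebra_simps)
  have "\<phi> (lext decomp c) \<in> {0}"
  proof (rule composite_rule[OF assms _ k.subspace_single_0])
    show "Vector_Spaces.linear fsc (*) \<phi>"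
    proof unfold_locales
      show "\<phi> (u + v) = \<phi> u + \<phi> v" for u v
        by (simp only: \<phi>_def lookup_add distrib_left add_ac)
      show "\<phi> (fsc r u) = r * \<phi> u" for r u
        by (simp only: \<phi>_def lookup_fsc distrib_left mult_ac)
    qed
    fix x ys assume x: "x \<in> P" "set ys \<subseteq> P" "\<forall>b\<in>supp x. arity b = length ys"
    show "\<phi> (lext (\<lambda>b. expand (place tree_parity b ys)) x) \<in> {0}"
    proof (cases "length ys = 3")
      case True
      then obtain y1 y2 y3 where ys: "ys = [y1, y2, y3]" by (auto simp: length_Suc_conv numeral_3_eq_3)
      show ?thesis
        by (simp add: \<phi>_def lookup_generator ys lookup_Lf lookup_tree_parity assoc_coeff[OF x(1)])
    next
      case False
      then have "coef x (shape ?r) = 0" "coef x (shape ?l) = 0"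
        using keys_arity[OF x(3)] by auto
      then show ?thesis by (simp add: \<phi>_def lookup_generator)
    qed
  qed
  then show ?thesis by (simp add: \<phi>_def lookup_lext_decomp eq_neg_iff_add_eq_0)
qed

end

text \<open>
  The recursion peels off the last leaf of a left comb, so it runs over the reversed word.
\<close>

fun lcomb :: "bool list \<Rightarrow> unit tree" where
  "lcomb [] = Lf ()"
| "lcomb [x] = (if x then Cork else Lf ())"
| "lcomb (x # xs) = Mu (lcomb xs) (if x then Cork else Lf ())"

abbreviation left_comb :: "bool list \<Rightarrow> unit tree" where
  "left_comb b \<equiv> lcomb (rev b)"

lemma corkword_lcomb: "b \<noteq> [] \<Longrightarrow> corkword (lcomb b) = rev b"
  by (induction b rule: lcomb.induct) auto

lemma treesgn_lcomb: "treesgn (lcomb b) = 0"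
  by (induction b rule: lcomb.induct) auto

lemma left_comb_snoc: "b \<noteq> [] \<Longrightarrow> left_comb (b @ [x]) = Mu (left_comb b) (if x then Cork else Lf ())"
  by (cases "rev b") auto

context weight2_cooperad
begin

text \<open>
  By induction on the number of leaves, all subtrees become left combs, thanks to the slices. If
  the right subtree of the root then has more than one leaf, a rotation moves all of it but the
  last leaf to the left.
\<close>

lemma coeff_left_comb:
  "c \<in> P \<Longrightarrow> coef c w = (-1) ^ treesgn w * coef c (left_comb (corkword w))"
proof (induction "length (corkword w)" arbitrary: w c rule: less_induct)
  case less
  show ?case
  proof (cases w)
    case (Mu l r)
    have ll: "length (corkword l) < length (corkword w)" and lr: "length (corkword r) < length (corkword w)"
      by (simp_all add: Mu)
    show ?thesis
    proof (cases "length (corkword r) = 1")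
      case True
      then obtain x where x: "corkword r = [x]" by (auto simp: length_Suc_conv)
      then have r: "r = (if x then Cork else Lf ())" using trees_single[of x] by auto
      obtain c' where c': "c' \<in> P" "\<And>l. coef c' l = coef c (Mu l r)"
        using left_slice[OF less.prems] by blast
      show ?thesis
        using less.hyps[OF ll c'(1)] left_comb_snoc[of "corkword l" x] 
        by (cases x) (simp_all add: c'(2) Mu x r)
    next
      case False
      moreover have "corkword r \<noteq> []" by simp
      ultimately obtain b x where b: "corkword r = b @ [x]" "b \<noteq> []"
        by (cases "corkword r" rule: rev_cases) auto
      let ?x = "if x then Cork else Lf ()" and ?r1 = "left_comb b"
      have cr1: "corkword ?r1 = b" using b corkword_lcomb[of "rev b"] by simp
      obtain c' where c': "c' \<in> P" "\<And>r. coef c' r = coef c (Mu l r)"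
        using right_slice[OF less.prems] by blast
      obtain c'' where c'': "c'' \<in> P" "\<And>l. coef c'' l = coef c (Mu l ?x)"
        using left_slice[OF less.prems] by blast
      have "coef c w = (-1) ^ treesgn r * coef c (Mu l (Mu ?r1 ?x))"
        using less.hyps[OF lr c'(1)] left_comb_snoc[OF b(2), of x]
        by (cases x) (simp_all add: c'(2) Mu b)
      also have "coef c (Mu l (Mu ?r1 ?x)) =
          - ((-1) ^ verts l * coef c (Mu (Mu l ?r1) ?x))"
        by (rule rotate[OF less.prems])
      also have "coef c (Mu (Mu l ?r1) ?x) =
          (-1) ^ treesgn (Mu l ?r1) * coef c (Mu (left_comb (corkword (Mu l ?r1))) ?x)"
        using less.hyps[of "Mu l ?r1", OF _ c''(1)] by (simp add: c''(2) Mu b cr1)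
      also have "Mu (left_comb (corkword (Mu l ?r1))) ?x = left_comb (corkword w)"
        using left_comb_snoc[of "corkword l @ b" x] by (simp add: Mu b cr1)
      also have "(-1) ^ treesgn r * - ((-1) ^ verts l * ((-1) ^ treesgn (Mu l ?r1) * coef c (left_comb (corkword w)))) =
          (-1) ^ treesgn w * coef c (left_comb (corkword w))"
      proof -
        let ?A = "length (corkword l) + corks (corkword l)"
        obtain m where m: "length b = Suc m" using b(2) by (cases b) auto
        have 1: "treesgn (Mu l ?r1) = treesgn l + ?A * m" by (simp add: treesgn_lcomb cr1 m)
        have 2: "treesgn w = treesgn l + treesgn r + ?A * Suc m" by (simp add: Mu b m)
        have "(-1 :: 'k) ^ treesgn r * - ((-1) ^ verts l * (-1) ^ treesgn (Mu l ?r1)) =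
            (-1) ^ (treesgn r + Suc (verts l) + treesgn (Mu l ?r1))"
          by (simp add: power_add)
        also have "\<dots> = (-1) ^ treesgn w"
          unfolding 1 2 verts_corkword by (rule power_parity) auto
        finally have "(-1 :: 'k) ^ treesgn r * - ((-1) ^ verts l * (-1) ^ treesgn (Mu l ?r1)) = (-1) ^ treesgn w" .
        from arg_cong[OF this, of "\<lambda>y. y * coef c (left_comb (corkword w))"]
        show ?thesis by (simp only: mult.assoc mult_minus_left mult_minus_right)
      qed
      finally show ?thesis .
    qed
  qed auto
qed

text \<open>
  Hence every element is the combination of corollas with its own coefficients at the left combs.
\<close>

lemma expansion:
  assumes "c \<in> P"
  shows "c = (\<Sum>b\<in>corkword ` supp c. fsc (coef c (left_comb b)) (cor b))"
proof (rule poly_mapping_eqI)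
  fix w
  have "coef (\<Sum>b\<in>corkword ` supp c. fsc (coef c (left_comb b)) (cor b)) w =
      (\<Sum>b\<in>corkword ` supp c. if corkword w = b then coef c w else 0)"
    unfolding lookup_sum
    by (rule sum.cong) (auto simp: lookup_fsc lookup_cor coeff_left_comb[OF assms, of w] mult.commute)
  also have "\<dots> = coef c w"
    by (auto simp: in_keys_iff intro!: image_eqI[of _ _ w])
  finally show "coef c w = coef (\<Sum>b\<in>corkword ` supp c.
      fsc (coef c (left_comb b)) (cor b)) w" ..
qed

end

lemma uAs_dual_expansion:
  assumes "c \<in> uAs_dual"
  shows "c = (\<Sum>b\<in>corkword ` supp c. fsc (coef c (left_comb b)) (cor b))"
proof -
  obtain P where "c \<in> P" "subcooperad P" "\<forall>v\<in>P. part (\<lambda>w. verts w = 2) v \<in> s2qR"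
    using assms by (auto simp: uAs_dual_def)
  then show ?thesis by (intro weight2_cooperad.expansion[of P]) (auto simp: weight2_cooperad_def)
qed

lemma cor_uAs_dual: "cor b \<in> uAs_dual"
  by (rule subsetD[OF cor_in_uAs_dual], rule fv.span_base, rule rangeI)

section \<open>Labelled corollas span the cofree coalgebra\<close>

context complex
begin

abbreviation "lcor \<equiv> labcor (tau A)"

lemma tensor_rep_cor: "tensor_rep A (cor (word zs)) (vals zs) = lcor zs"
  by (simp add: tensor_rep_def labcor_def)

lemma ex_labelling: "length xs + corks b = length b \<Longrightarrow> \<exists>zs. word zs = b \<and> vals zs = xs"
proof (induction b arbitrary: xs)
  case (Cons c b)
  have le: "corks b \<le> length b" by (simp add: count_le_length)
  show ?case
  proof (cases c)
    case True
    then obtain zs where "word zs = b \<and> vals zs = xs" using Cons.IH[of xs] Cons.prems by auto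
    then show ?thesis using True by (intro exI[of _ "None # zs"]) auto
  next
    case False
    then obtain x xs' where xs: "xs = x # xs'" using Cons.prems le by (cases xs) auto
    then obtain zs where "word zs = b \<and> vals zs = xs'" using Cons.IH[of xs'] Cons.prems False by auto
    then show ?thesis using False xs by (intro exI[of _ "Some x # zs"]) auto
  qed
qed simp

text \<open>
  Expanding an element of the cooperad into corollas expands the tensors accordingly. The labels
  are the same for all corollas, only the positions of the corks vary.
\<close>

lemma tensor_rep_expand:
  assumes "c \<in> uAs_dual" "\<forall>w\<in>supp c. arity w = length xs"
  obtains Z where "tensor_rep A c xs = (\<Sum>b\<in>corkword ` supp c.
      fsc (coef c (left_comb b)) (lcor (Z b)))"
    "\<And>b. b \<in> corkword ` supp c \<Longrightarrow> word (Z b) = b"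
proof -
  have "\<exists>zs. word zs = b \<and> vals zs = xs" if "b \<in> corkword ` supp c" for b
  proof -
    obtain w where "w \<in> supp c" "b = corkword w" using \<open>b \<in> _\<close> by auto
    then show ?thesis using assms(2) arity_corkword[of w] by (intro ex_labelling) auto
  qed
  then obtain Z where Z: "\<And>b. b \<in> corkword ` supp c \<Longrightarrow> word (Z b) = b \<and> vals (Z b) = xs"
    by metis
  have "tensor_rep A c xs = (\<Sum>b\<in>corkword ` supp c.
      fsc (coef c (left_comb b)) (tensor_rep A (cor b) xs))"
    by (subst uAs_dual_expansion[OF assms(1)]) (simp add: tensor_rep_def lext_sum)
  also have "\<dots> = (\<Sum>b\<in>corkword ` supp c.
      fsc (coef c (left_comb b)) (lcor (Z b)))"
  proof (rule sum.cong[OF refl])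
    fix b assume "b \<in> corkword ` supp c"
    from Z[OF this] show "fsc (coef c (left_comb b)) (tensor_rep A (cor b) xs) =
        fsc (coef c (left_comb b)) (lcor (Z b))"
      by (metis tensor_rep_cor)
  qed
  finally show ?thesis using that Z by blast
qed

lemma lcor_cofree: "lcor zs \<in> cofree A"
proof -
  have "\<forall>w\<in>supp (cor (word zs) :: _ \<Rightarrow>\<^sub>0 'k). arity w = length (vals zs)"
    using keys_cor arity_word by blast
  then show ?thesis
    unfolding cofree_def tensor_rep_cor[symmetric]
    by (intro fv.span_base UnI1 CollectI exI[of _ "cor (word zs)"] exI[of _ "vals zs"] conjI refl cor_uAs_dual)
qed

lemma subspace_cofree: "fv.subspace (cofree A)"
  unfolding cofree_def by (rule fv.subspace_span)

lemma rel1_cofree: "v \<in> rel1 A \<Longrightarrow> v \<in> cofree A"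
  unfolding cofree_def by (rule fv.span_base) simp

text \<open>
  Linear statements about the cofree coalgebra need to be checked on labelled corollas only.
\<close>

lemma cofree_induct:
  assumes "v \<in> cofree A" "Vector_Spaces.linear fsc s \<phi>" "module.subspace s T"
    and "\<And>v. v \<in> rel1 A \<Longrightarrow> \<phi> v \<in> T" "\<And>zs. zs \<noteq> [] \<Longrightarrow> \<phi> (lcor zs) \<in> T"
  shows "\<phi> v \<in> T"
proof (rule linear_span[OF assms(2,3) _ assms(1)[unfolded cofree_def]])
  interpret l: Vector_Spaces.linear fsc s \<phi> by fact
  fix u assume "u \<in> {tensor_rep A c xs |c xs. c \<in> uAs_dual \<and> (\<forall>w\<in>supp c. arity w = length xs)} \<union> rel1 A"
  then show "\<phi> u \<in> T"
  proof
    assume "u \<in> {tensor_rep A c xs |c xs. c \<in> uAs_dual \<and> (\<forall>w\<in>supp c. arity w = length xs)}"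
    then obtain c xs where u: "u = tensor_rep A c xs" "c \<in> uAs_dual" "\<forall>w\<in>supp c. arity w = length xs"
      by blast
    then obtain Z where Z: "tensor_rep A c xs = (\<Sum>b\<in>corkword ` supp c.
        fsc (coef c (left_comb b)) (lcor (Z b)))"
      "\<And>b. b \<in> corkword ` supp c \<Longrightarrow> word (Z b) = b"
      using tensor_rep_expand by blast
    have "Z b \<noteq> []" if "b \<in> corkword ` supp c" for b
    proof -
      have "b \<noteq> []" using that by (metis corkword_nonempty imageE)
      then show ?thesis using Z(2)[OF that] by auto
    qed
    then show "\<phi> u \<in> T"
      unfolding u(1) Z(1) l.sum l.scale
      by (intro l.vs2.subspace_sum[OF assms(3)] l.vs2.subspace_scale[OF assms(3)] assms(5))
  qed (rule assms(4))
qed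

lemma eqv_Lf_add: "eqv A (gen (Lf (x + y))) (gen (Lf x) + gen (Lf y))"
  and eqv_Lf_scl: "eqv A (gen (Lf (scl A c x))) (fsc c (gen (Lf x)))"
  using qlin_Lf_id[of A] by (simp_all add: qlin_def)

lemma eqv_Lf_0: "eqv A (gen (Lf 0)) 0"
  using eqv_Lf_scl[of 0 0] by simp

lemma eqv_Lf_sum: "eqv A (gen (Lf (sum g X))) (\<Sum>x\<in>X. gen (Lf (g x)))"
proof (induction X rule: infinite_finite_induct)
  case (insert x X)
  then show ?case
    using eqv_trans[OF eqv_Lf_add eqv_add[OF eqv_refl insert.IH]] by simp
qed (simp_all add: eqv_Lf_0)

lemma eqv_lext_Lf: "eqv A (lext (\<lambda>t. gen (Lf (g t))) c) (gen (Lf (gext (scl A) g c)))"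
proof (rule eqv_sym)
  have "eqv A (gen (Lf (gext (scl A) g c))) (\<Sum>x\<in>supp c. gen (Lf (scl A (coef c x) (g x))))"
    unfolding gext_def by (rule eqv_Lf_sum)
  also have "eqv A \<dots> (lext (\<lambda>t. gen (Lf (g t))) c)"
    unfolding lext_def by (intro eqv_sum eqv_Lf_scl)
  finally show "eqv A (gen (Lf (gext (scl A) g c))) (lext (\<lambda>t. gen (Lf (g t))) c)" .
qed

lemma gext_MuF: "gext (scl A) g (MuF u v) = gext (scl A) (\<lambda>s. gext (scl A) (\<lambda>t. g (Mu s t)) v) u"
  by (simp add: MuF_def gext_lext')

lemma gext_zero [simp]: "gext (scl A) (\<lambda>_. 0) v = 0"
  by (simp add: gext_def)

end

lemma sgn_map_MuF: "lext (sgn_map \<tau>) (MuF u v) = - MuF (lext (sgn_map \<tau>) u) (lext (sgn_map \<tau>) v)"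
proof -
  have *: "sgn_map \<tau> (Mu s t) = - MuF (sgn_map \<tau> s) (sgn_map \<tau> t)" for s t
    by (simp add: sgn_map_def power_add mult.commute)
  show ?thesis
    unfolding lext_MuF * lext_fun_neg by (simp add: MuF_lext(1)) (simp add: MuF_lext(2))
qed

context ops
begin

text \<open>
  The operations have odd degree when a tree counts with its number of vertices.
\<close>

lemma gam_sgn_map: "gam (lext (sgn_map (tau A)) u) = - tau A (gam u)"
proof -
  have "gam (sgn_map (tau A) t) = - tau A (top_op \<gamma> A t)" for t
  proof (cases "\<exists>x. t = Lf x")
    case True
    then show ?thesis by (auto simp: sgn_map_def top_op_def ge.scale)
  next
    case False
    then have "shape t \<noteq> Lf ()" by simp
    then have "tau A (\<gamma> (shape t) (labels (tau A) t)) =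
        scl A ((-1) ^ Suc (verts t)) (\<gamma> (shape t) (map (tau A) (labels (tau A) t)))"
      using \<gamma>_tau[of "shape t" "labels (tau A) t"] by simp
    moreover have "shape (map_tree (tau A) t) = shape t" by (simp add: tree.map_comp comp_def)
    ultimately show ?thesis
      using False labels_map_tree[of "tau A" t]
      by (cases t) (simp_all add: sgn_map_def ge.scale ge.neg top_op_def del: labels.simps)
  qed
  then have "gam (lext (sgn_map (tau A)) u) = gext (scl A) (\<lambda>t. - tau A (top_op \<gamma> A t)) u"
    by (simp add: gext_lext')
  also have "\<dots> = - tau A (gam u)"
    using lin_gext[OF linear_tau, of "top_op \<gamma> A" u] by (simp add: gext_def sum_negf)
  finally show ?thesis .
qed

end

section \<open>Homogeneous elements\<close>

lemma funpow_ident: "(\<lambda>x. x) ^^ n = (\<lambda>x. x)"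
  by (induction n) auto

context complex
begin

abbreviation hom :: "'a list \<Rightarrow> int list \<Rightarrow> bool" where
  "hom \<equiv> list_all2 (\<lambda>x d. proj A d x = x)"

lemma hom_tau_pow: "hom xs ds \<Longrightarrow> hom (map (tau A ^^ n) xs) ds"
  unfolding list_all2_map1
  by (erule list_all2_mono) (metis proj_tau tau_homogeneous tau_pow)

lemma hom_labels: "hom (labels (\<lambda>x. x) t) ds \<Longrightarrow> hom (labels (tau A) t) ds"
  by (induction t arbitrary: ds)
    (auto simp: list_all2_append1 funpow_ident simp del: list_all2_map1 intro!: hom_tau_pow list_all2_appendI)

lemma hom_place: "hom xs ds \<Longrightarrow> arity w = length xs \<Longrightarrow> hom (labels (\<lambda>x. x) (place (tau A) w xs)) ds"
proof (induction w arbitrary: xs ds)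
  case (Lf x)
  then show ?case by (cases xs) auto
next
  case Cork
  then show ?case by simp
next
  case (Mu l r)
  have t: "hom (take (arity l) xs) (take (arity l) ds)" and d: "hom (drop (arity l) xs) (drop (arity l) ds)"
    using Mu.prems by (simp_all add: list_all2_takeI list_all2_dropI)
  have "hom (labels (\<lambda>x. x) (place (tau A) l (map (tau A ^^ verts r) (take (arity l) xs)))) (take (arity l) ds)"
    by (rule Mu.IH[OF hom_tau_pow[OF t]]) (use Mu.prems in simp)
  moreover have "hom (labels (\<lambda>x. x) (place (tau A) r (drop (arity l) xs))) (drop (arity l) ds)"
    by (rule Mu.IH[OF d]) (use Mu.prems in simp)
  ultimately have "hom (labels (\<lambda>x. x) (place (tau A) l (map (tau A ^^ verts r) (take (arity l) xs))) @
      labels (\<lambda>x. x) (place (tau A) r (drop (arity l) xs))) (take (arity l) ds @ drop (arity l) ds)"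
    by (rule list_all2_appendI)
  then show ?case by (simp add: funpow_ident)
qed

lemma subspace_homogeneous: "fv.subspace (homogeneous A n)"
  unfolding homogeneous_def by (rule fv.subspace_span)

lemma homogeneous_gen:
  "hom (labels (\<lambda>x. x) t) ds \<Longrightarrow> int (verts t) + sum_list ds = n \<Longrightarrow> gen t \<in> homogeneous A n"
  unfolding homogeneous_def by (rule fv.span_base) blast

lemma homogeneous_rel1: "v \<in> rel1 A \<Longrightarrow> v \<in> homogeneous A n"
  unfolding homogeneous_def by (rule fv.span_base) blast

lemma homogeneous_induct:
  assumes "v \<in> homogeneous A n" "Vector_Spaces.linear fsc s \<phi>" "module.subspace s T"
    and "\<And>v. v \<in> rel1 A \<Longrightarrow> \<phi> v \<in> T"
    and "\<And>t ds. hom (labels (\<lambda>x. x) t) ds \<Longrightarrow> int (verts t) + sum_list ds = n \<Longrightarrow> \<phi> (gen t) \<in> T"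
  shows "\<phi> v \<in> T"
  by (rule linear_span[OF assms(2,3) _ assms(1)[unfolded homogeneous_def]]) (use assms(4,5) in blast)

lemma homogeneous_MuF:
  assumes "u \<in> homogeneous A m" "v \<in> homogeneous A n"
  shows "MuF u v \<in> homogeneous A (m + n + 1)"
proof (rule homogeneous_induct[OF assms(1) MuF_linear_left subspace_homogeneous])
  fix s ds assume s: "hom (labels (\<lambda>x. x) s) ds" "int (verts s) + sum_list ds = m"
  show "MuF (gen s) v \<in> homogeneous A (m + n + 1)"
  proof (rule homogeneous_induct[OF assms(2) MuF_linear_right subspace_homogeneous])
    fix t es assume t: "hom (labels (\<lambda>x. x) t) es" "int (verts t) + sum_list es = n"
    show "MuF (gen s) (gen t) \<in> homogeneous A (m + n + 1)"
      unfolding MuF_gen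
      by (rule homogeneous_gen[of _ "ds @ es"]) (use s t in \<open>auto simp: funpow_ident intro: list_all2_appendI\<close>)
  qed (intro homogeneous_rel1 MuF_rel1)
qed (intro homogeneous_rel1 MuF_rel1)

end

context ops
begin

lemma gam_homogeneous:
  assumes "u \<in> homogeneous A n"
  shows "proj A (n - 1) (gam u) = gam u"
proof -
  let ?\<phi> = "\<lambda>u. proj A (n - 1) (gam u) - gam u"
  have "?\<phi> u \<in> {0}"
  proof (rule homogeneous_induct[OF assms _ subspace_single_0])
    show "Vector_Spaces.linear fsc (scl A) ?\<phi>"
    proof unfold_locales
      show "?\<phi> (x + y) = ?\<phi> x + ?\<phi> y" for x y by (simp add: ge.add pr.add)
      show "?\<phi> (fsc c x) = scl A c (?\<phi> x)" for c x by (simp add: ge.scale pr.scale scale_right_diff_distrib)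
    qed
    show "?\<phi> v \<in> {0}" if "v \<in> rel1 A" for v using rel1_kill(1)[OF that] by simp
    fix t ds assume t: "hom (labels (\<lambda>x. x) t) ds" "int (verts t) + sum_list ds = n"
    show "?\<phi> (gen t) \<in> {0}"
    proof (cases "\<exists>x. t = Lf x")
      case False
      then have "End_op A (arity t) (int (verts t) - 1) (\<gamma> (shape t))"
        using End[of "shape t"] by simp
      then have "proj A (sum_list ds + (int (verts t) - 1)) (\<gamma> (shape t) (labels (tau A) t)) = \<gamma> (shape t) (labels (tau A) t)"
        using hom_labels[OF t(1)] by (simp add: End_op_def)
      moreover have "sum_list ds + (int (verts t) - 1) = n - 1" using t(2) by simp
      ultimately show ?thesis using False by (cases t) (simp_all add: top_op_def del: labels.simps)
    qed (auto simp: top_op_def)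
  qed
  then show ?thesis by simp
qed

end

section \<open>The transferred structure\<close>

text \<open>
  The last two assumptions are the side conditions, and not part of the notion of a strong
  deformation retract in use here.
\<close>

locale transfer = A: ops A \<gamma> + V: complex V
  for A :: "('k::field_char_0, 'a::ab_group_add) cplx" and \<gamma> :: "unit tree \<Rightarrow> 'a list \<Rightarrow> 'a"
    and V :: "('k, 'v::ab_group_add) cplx" +
  fixes i :: "'v \<Rightarrow> 'a" and p :: "'a \<Rightarrow> 'v" and h :: "'a \<Rightarrow> 'a"
  assumes alg: "uA_infinity_algebra A \<gamma>"
    and sdr: "strong_deformation_retract A V i p h"
    and h_i: "\<And>x. h (i x) = 0" and h_h: "\<And>x. h (h x) = 0"
begin

lemma degree_i: "degree_map V A 0 i" and degree_p: "degree_map A V 0 p" and degree_h: "degree_map A A 1 h"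
  and i_dif: "i (dif V v) = dif A (i v)" and p_dif: "p (dif A x) = dif V (p x)"
  and p_i: "p (i v) = v" and homotopy: "dif A (h x) + h (dif A x) = x - i (p x)"
  using sdr by (simp_all add: strong_deformation_retract_def chain_map_def)

sublocale i: Vector_Spaces.linear "scl V" "scl A" i
  using degree_i by (simp add: degree_map_def linear_map_def)
sublocale p: Vector_Spaces.linear "scl A" "scl V" p
  using degree_p by (simp add: degree_map_def linear_map_def)
sublocale h: Vector_Spaces.linear "scl A" "scl A" h
  using degree_h by (simp add: degree_map_def linear_map_def)

lemma i_tau: "i (tau V v) = tau A (i v)"
  using degree_map_tau[OF V.complex A.complex degree_i] by simp

lemma p_tau: "p (tau A x) = tau V (p x)"
  using degree_map_tau[OF A.complex V.complex degree_p] by simp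

lemma h_tau: "h (tau A x) = - tau A (h x)"
  using degree_map_tau[OF A.complex A.complex degree_h] by simp

text \<open>
  Here \<open>h d h = h\<close>, by \<open>h h = 0\<close> and \<open>h i = 0\<close>, and
  \<open>h d h = h - i p h\<close>.
\<close>

lemma p_h: "p (h x) = 0"
proof -
  have "dif A (h x) = x - i (p x) - h (dif A x)" using homotopy[of x] by (simp add: eq_diff_eq)
  then have "h (dif A (h x)) = h x" by (simp add: h.diff h_i h_h)
  moreover have "h (dif A (h x)) = h x - i (p (h x))" using homotopy[of "h x"] by (simp add: h_h)
  ultimately have "i (p (h x)) = 0" by simp
  then show ?thesis by (metis p_i p.zero)
qed

text \<open>
  \<open>F\<close> is the coalgebra morphism, \<open>F'\<close> its part with a nontrivial bottom
  tree, and \<open>f\<close> its projection to the labels. The recursion for \<open>F\<close> has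
  \<open>f\<close> unfolded, as it is not structural in \<open>f\<close>.
\<close>

primrec F :: "'v tree \<Rightarrow> ('a tree \<Rightarrow>\<^sub>0 'k)" where
  "F (Lf v) = gen (Lf (i v))"
| "F Cork = gen (Lf (- h (\<gamma> Cork []))) + gen Cork"
| "F (Mu l r) = gen (Lf (- h (A.gam (MuF (F l) (F r))))) + MuF (F l) (F r)"

definition F' :: "'v tree \<Rightarrow> ('a tree \<Rightarrow>\<^sub>0 'k)" where
  "F' t = (case t of Lf v \<Rightarrow> 0 | Cork \<Rightarrow> gen Cork | Mu l r \<Rightarrow> MuF (F l) (F r))"

definition f :: "'v tree \<Rightarrow> 'a" where
  "f t = (case t of Lf v \<Rightarrow> i v | _ \<Rightarrow> - h (A.gam (F' t)))"

definition \<gamma>V :: "unit tree \<Rightarrow> 'v list \<Rightarrow> 'v" where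
  "\<gamma>V w xs = p (A.gam (F' (place (tau V) w xs)))"

abbreviation "gf \<equiv> gext (scl A) f"

lemma F_split: "F t = gen (Lf (f t)) + F' t"
  by (cases t) (simp_all add: F'_def f_def top_op_def)

lemma f_nonleaf: "shape t \<noteq> Lf () \<Longrightarrow> f t = - h (A.gam (F' t))"
  by (cases t) (simp_all add: f_def)

lemma F'_Lf [simp]: "F' (Lf v) = 0" and F'_Mu [simp]: "F' (Mu s t) = MuF (F s) (F t)" and F'_Cork [simp]: "F' Cork = gen Cork"
  by (simp_all add: F'_def)

lemma f_Lf [simp]: "f (Lf v) = i v"
  by (simp add: f_def)

lemma F'_MuF: "lext F' (MuF u v) = MuF (lext F u) (lext F v)"
  by (simp add: lext_MuF MuF_lext(1)) (simp add: MuF_lext(2))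

lemma linear_hgam: "Vector_Spaces.linear fsc (scl A) (\<lambda>u. - h (A.gam u))"
proof unfold_locales
  show "- h (A.gam (x + y)) = - h (A.gam x) + - h (A.gam y)" for x y by (simp add: A.ge.add h.add)
  show "- h (A.gam (fsc c x)) = scl A c (- h (A.gam x))" for c x
    by (simp add: A.ge.scale h.scale A.scale_minus_right)
qed

lemma qlin_F: "\<sigma> \<in> slots1 \<Longrightarrow> qlin V A (\<lambda>x. F (\<sigma> x))"
proof (induction rule: slots.induct)
  case (1 \<sigma>)
  then show ?case by (simp add: qlin_Lf[OF i.linear_axioms])
next
  case (2 \<sigma> r)
  have q: "qlin V A (\<lambda>x. MuF (F (\<sigma> x)) (F r))" by (rule qlin_MuF(1)[OF 2(2)])
  have "Vector_Spaces.linear (scl V) (scl A) (\<lambda>x. - h (A.gam (MuF (F (\<sigma> x)) (F r))))"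
    by (rule qlin_linear[OF V.vector_space_axioms linear_hgam _ q]) (simp add: A.rel1_kill)
  then show ?case by (simp add: qlin_add qlin_Lf q)
next
  case (3 \<sigma> l)
  have q: "qlin V A (\<lambda>x. MuF (F l) (F (\<sigma> x)))" by (rule qlin_MuF(2)[OF 3(2)])
  have "Vector_Spaces.linear (scl V) (scl A) (\<lambda>x. - h (A.gam (MuF (F l) (F (\<sigma> x)))))"
    by (rule qlin_linear[OF V.vector_space_axioms linear_hgam _ q]) (simp add: A.rel1_kill)
  then show ?case by (simp add: qlin_add qlin_Lf q)
qed

lemma qlin_F': "\<sigma> \<in> slots1 \<Longrightarrow> qlin V A (\<lambda>x. F' (\<sigma> x))"
proof (erule slots.cases)
  show "qlin V A (\<lambda>x. F' (\<sigma> x))" if "\<sigma> = (\<lambda>x. Lf (\<sigma>' x))" for \<sigma>'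
    using that by (simp add: qlin_def)
qed (auto intro!: qlin_MuF qlin_F)

lemma eqv_F: "eqv V u v \<Longrightarrow> eqv A (lext F u) (lext F v)"
  by (rule eqv_lext_cong[OF qlin_F])

lemma F_lext_split: "eqv A (lext F u) (gen (Lf (gf u)) + lext F' u)"
proof -
  have "lext F u = lext (\<lambda>t. gen (Lf (f t))) u + lext F' u"
    by (simp flip: lext_fun_add F_split)
  then show ?thesis by (simp add: eqv_add A.eqv_lext_Lf)
qed

subsection \<open>Degrees\<close>

lemma F_homogeneous:
  "V.hom (labels (\<lambda>x. x) t) ds \<Longrightarrow> F t \<in> homogeneous A (int (verts t) + sum_list ds) \<and>
    F' t \<in> homogeneous A (int (verts t) + sum_list ds)"
proof (induction t arbitrary: ds)
  case (Lf v)
  then obtain d where d: "ds = [d]" "proj V d v = v" by (auto simp: list_all2_Cons1)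
  have "proj A d (i v) = i v" using degree_i d by (simp add: degree_map_def)
  then have "gen (Lf (i v)) \<in> homogeneous A d" by (intro A.homogeneous_gen[of _ "[d]"]) auto
  then show ?case using d fv.subspace_0[OF A.subspace_homogeneous] by simp
next
  case Cork
  then have ds: "ds = []" by simp
  have c: "gen Cork \<in> homogeneous A 1" by (rule A.homogeneous_gen[of _ "[]"]) auto
  have "proj A 0 (A.gam (gen Cork)) = A.gam (gen Cork)" using A.gam_homogeneous[OF c] by simp
  then have "proj A 1 (h (A.gam (gen Cork))) = h (A.gam (gen Cork))"
    using degree_h unfolding degree_map_def by (metis add_0)
  then have "gen (Lf (- h (\<gamma> Cork []))) \<in> homogeneous A 1"
    by (intro A.homogeneous_gen[of _ "[1]"]) (auto simp: top_op_def A.pr.neg)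
  then show ?case using c ds by (simp add: fv.subspace_add[OF A.subspace_homogeneous])
next
  case (Mu l r)
  obtain dl dr where ds: "ds = dl @ dr" "V.hom (labels (\<lambda>x. x) l) dl" "V.hom (labels (\<lambda>x. x) r) dr"
    using Mu.prems by (auto simp: list_all2_append1 funpow_ident)
  let ?n = "int (verts (Mu l r)) + sum_list ds"
  have c: "MuF (F l) (F r) \<in> homogeneous A ?n"
    using A.homogeneous_MuF[OF conjunct1[OF Mu.IH(1)[OF ds(2)]] conjunct1[OF Mu.IH(2)[OF ds(3)]]]
    by (simp add: ds(1) algebra_simps)
  have "proj A (?n - 1) (A.gam (MuF (F l) (F r))) = A.gam (MuF (F l) (F r))" by (rule A.gam_homogeneous[OF c])
  then have "proj A ?n (h (A.gam (MuF (F l) (F r)))) = h (A.gam (MuF (F l) (F r)))"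
    using degree_h unfolding degree_map_def by (metis diff_add_cancel)
  then have "gen (Lf (- h (A.gam (MuF (F l) (F r))))) \<in> homogeneous A ?n"
    by (intro A.homogeneous_gen[of _ "[?n]"]) (auto simp: A.pr.neg)
  then show ?case using c by (simp add: fv.subspace_add[OF A.subspace_homogeneous] del: verts.simps)
qed

lemma End_\<gamma>V:
  assumes "w \<noteq> Lf ()"
  shows "End_op V (arity w) (int (verts w) - 1) (\<gamma>V w)"
  unfolding End_op_def
proof (intro conjI allI impI)
  fix us vs :: "'v list" assume len: "length us + 1 + length vs = arity w"
  obtain \<sigma> e where \<sigma>: "\<sigma> \<in> slots1" "\<And>x. place (tau V) w (us @ x # vs) = \<sigma> ((tau V ^^ e) x)"
    using place_slot[OF len] by blast
  have "Vector_Spaces.linear fsc (scl V) (\<lambda>u. p (A.gam u))"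
    using Vector_Spaces.linear_compose[OF A.linear_gext p.linear_axioms] by (simp add: comp_def)
  then have "Vector_Spaces.linear (scl V) (scl V) (\<lambda>x. p (A.gam (F' (\<sigma> ((tau V ^^ e) x)))))"
    by (rule qlin_linear[OF V.vector_space_axioms _ _ qlin_comp[OF V.linear_tau_pow qlin_F'[OF \<sigma>(1)]]])
      (simp add: A.rel1_kill p.zero)
  then show "linear_map V V (\<lambda>x. \<gamma>V w (us @ x # vs))" by (simp add: linear_map_def \<gamma>V_def \<sigma>(2))
next
  fix xs ds assume x: "length xs = arity w \<and> V.hom xs ds"
  let ?t = "place (tau V) w xs"
  have "F' ?t \<in> homogeneous A (int (verts w) + sum_list ds)"
    using F_homogeneous[OF V.hom_place[of xs ds w]] x by simp
  then have "proj A (int (verts w) + sum_list ds - 1) (A.gam (F' ?t)) = A.gam (F' ?t)" by (rule A.gam_homogeneous)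
  then show "proj V (sum_list ds + (int (verts w) - 1)) (\<gamma>V w xs) = \<gamma>V w xs"
    using degree_p unfolding degree_map_def \<gamma>V_def by (metis add.commute add.right_neutral add_diff_eq)
qed

sublocale VO: ops V \<gamma>V
  by unfold_locales (rule End_\<gamma>V)

lemma top_V: "top_op \<gamma>V V t = p (A.gam (F' t))"
  using place_labels[OF V.tau_comp_tau, of t]
  by (cases t) (simp_all add: top_op_def \<gamma>V_def p.zero del: labels.simps place.simps)

subsection \<open>Compatibility with the parity involutions\<close>

abbreviation "eA \<equiv> lext (sgn_map (tau A))"
abbreviation "eV \<equiv> lext (sgn_map (tau V))"

text \<open>
  \<open>f\<close> and \<open>F\<close> have degree 0: an operation of a tree has degree
  \<open>verts t - 1\<close>, and the homotopy compensates for the \<open>- 1\<close>.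
\<close>

lemma F_sgn_map_gen: "eqv A (lext F (sgn_map (tau V) t)) (eA (F t)) \<and>
    scl A ((-1) ^ verts t) (f (map_tree (tau V) t)) = tau A (f t)"
proof (induction t)
  case (Lf v)
  then show ?case by (simp add: sgn_map_def i_tau)
next
  case Cork
  have e: "eA (gen Cork) = - gen Cork" by (simp add: sgn_map_def)
  have "A.gam (- gen Cork) = - tau A (A.gam (gen Cork))"
    using A.gam_sgn_map[of "gen Cork"] by (simp only: e)
  then have "tau A (A.gam (gen Cork)) = A.gam (gen Cork)" by (simp add: A.ge.neg)
  then have "tau A (\<gamma> Cork []) = \<gamma> Cork []" by (simp add: top_op_def)
  then have "h (\<gamma> Cork []) = - tau A (h (\<gamma> Cork []))" using h_tau[of "\<gamma> Cork []"] by simp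
  then have t: "tau A (h (\<gamma> Cork [])) = - h (\<gamma> Cork [])" by (metis minus_minus)
  have "lext F (sgn_map (tau V) Cork) = - gen (Lf (- h (\<gamma> Cork []))) - gen Cork"
    by (simp add: sgn_map_def)
  moreover have "eA (F Cork) = gen (Lf (h (\<gamma> Cork []))) - gen Cork"
    by (simp add: sgn_map_def t A.ta.neg)
  moreover have "eqv A (- gen (Lf (- h (\<gamma> Cork [])))) (gen (Lf (h (\<gamma> Cork []))))"
    using eqv_neg[OF A.eqv_Lf_scl[of "-1" "h (\<gamma> Cork [])"]] by simp
  ultimately show ?case by (simp add: eqv_diff f_def top_op_def t A.ta.neg)
next
  case (Mu l r)
  let ?c = "MuF (F l) (F r)"
  have 1: "eqv A (lext F' (sgn_map (tau V) (Mu l r))) (eA ?c)"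
  proof -
    have "(sgn_map (tau V) (Mu l r) :: _ \<Rightarrow>\<^sub>0 'k) = - MuF (sgn_map (tau V) l) (sgn_map (tau V) r)"
      by (simp add: sgn_map_def power_add mult.commute)
    then have "lext F' (sgn_map (tau V) (Mu l r)) = - MuF (lext F (sgn_map (tau V) l)) (lext F (sgn_map (tau V) r))"
      by (simp only: F'_MuF lext_simps)
    also have "eqv A \<dots> (- MuF (eA (F l)) (eA (F r)))"
      using Mu.IH by (intro eqv_neg eqv_MuF) auto
    finally show ?thesis by (simp add: sgn_map_MuF)
  qed
  let ?m = "Mu (map_tree (tau V) l) (map_tree (tau V) r)" and ?s = "(-1 :: 'k) ^ verts (Mu l r)"
  have "A.gam (fsc ?s (F' ?m)) = A.gam (eA ?c)"
    using A.eqv_gam[OF 1] by (simp add: sgn_map_def)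
  then have g: "scl A ?s (A.gam (F' ?m)) = - tau A (A.gam ?c)"
    by (simp only: A.gam_sgn_map A.ge.scale)
  have 2: "scl A ?s (f ?m) = tau A (f (Mu l r))"
  proof -
    have "scl A ?s (f ?m) = - h (scl A ?s (A.gam (F' ?m)))"
      by (simp add: f_nonleaf h.scale h.neg A.scale_minus_right del: F'_Mu verts.simps)
    also have "\<dots> = tau A (f (Mu l r))"
      unfolding g by (simp add: f_nonleaf h.neg h_tau A.ta.neg)
    finally show ?thesis .
  qed
  have "lext F (sgn_map (tau V) (Mu l r)) = fsc ?s (gen (Lf (f ?m))) + lext F' (sgn_map (tau V) (Mu l r))"
    unfolding sgn_map_def by (simp add: F_split[of ?m] fv.scale_right_distrib del: F.simps F'_Mu)
  also have "eqv A \<dots> (gen (Lf (tau A (f (Mu l r)))) + eA ?c)"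
    using 1 eqv_sym[OF A.eqv_Lf_scl[of ?s "f ?m"]] unfolding 2 by (intro eqv_add)
  also have "\<dots> = eA (F (Mu l r))"
    unfolding F_split[of "Mu l r"] by (simp add: sgn_map_def)
  finally show ?case using 2 by simp
qed

lemma F_sgn_map: "eqv A (lext F (eV u)) (eA (lext F u))"
  unfolding lext_lext by (rule eqv_lext) (use F_sgn_map_gen in blast)

lemma gf_sgn_map: "gf (eV u) = tau A (gf u)"
proof -
  have "gf (eV u) = gext (scl A) (\<lambda>t. tau A (f t)) u"
    unfolding A.gext_lext' using F_sgn_map_gen by (simp add: sgn_map_def A.ge.scale)
  then show ?thesis using lin_gext[OF A.linear_tau, of f u] by simp
qed

subsection \<open>\<open>F\<close> is a morphism of coalgebras\<close>

text \<open>
  This identifies the recursive definition with the sum over all cuts.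
\<close>

lemma F_decomp: "F t = lext (\<lambda>b. gen (map_tree f b)) (decomp t)"
proof (induction t)
  case (Mu l r)
  then have "lext (\<lambda>b. gen (map_tree f b)) (MuF (decomp l) (decomp r)) = MuF (F l) (F r)"
    by (subst lext_MuF_hom) simp_all
  then show ?case using F_split[of "Mu l r"] by (simp del: F.simps)
qed (simp_all add: F_split[of Cork] del: F.simps(2))

text \<open>
  This holds on the nose and on all trees, because \<open>\<F>\<^sup>c(sW)(V)\<close> is cofree as
  well.
\<close>

lemma F_coalgebra: "lext decomp (F t) = lext (\<lambda>b. expand (map_tree F b)) (decomp t)"
proof (induction t)
  case (Mu l r)
  have "lext (\<lambda>b. expand (map_tree F b)) (decomp (Mu l r)) =
      lext (\<lambda>y. gen (Lf y)) (F (Mu l r)) + MuF (lext decomp (F l)) (lext decomp (F r))"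
    using lext_MuF_hom[of "\<lambda>b. expand (map_tree F b)" "decomp l" "decomp r"] Mu by (simp del: F.simps)
  then show ?case by (simp add: decomp_MuF)
qed simp_all

lemma expand_gf: "eqv A (lext (\<lambda>b. gen (map_tree f b)) (expand s)) (gen (map_tree gf s))"
proof (induction s)
  case (Lf v)
  show ?case by (simp add: lext_lext A.eqv_lext_Lf)
next
  case (Mu l r)
  have "lext (\<lambda>b. gen (map_tree f b)) (expand (Mu l r)) =
      MuF (lext (\<lambda>b. gen (map_tree f b)) (expand l)) (lext (\<lambda>b. gen (map_tree f b)) (expand r))"
    by (simp add: lext_MuF_hom)
  also have "eqv A \<dots> (MuF (gen (map_tree gf l)) (gen (map_tree gf r)))"
    by (intro eqv_MuF Mu)
  finally show ?case by simp
qed simp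

definition branch :: "'v option list option list \<Rightarrow> 'a option list" where
  "branch Q = map (map_option (\<lambda>zs. gf (V.lcor zs))) (shift (tau V) Q)"

text \<open>
  Since \<open>F\<close> applies \<open>f\<close> to the upper trees, it turns a two-level tree of
  corollas into one corolla labelled by the values of \<open>f\<close>.
\<close>

lemma F_segterm: "eqv A (lext (\<lambda>b. gen (map_tree f b)) (segterm (tau V) Q)) (A.lcor (branch Q))"
proof -
  have "eqv A (lext (\<lambda>b. gen (map_tree f b)) (segterm (tau V) Q))
      (lext (\<lambda>s. gen (map_tree gf s)) (labcor eV (map (map_option V.lcor) (shift (tau V) Q))))"
    unfolding segterm_def lext_lext by (intro eqv_lext expand_gf)
  also have "lext (\<lambda>s. gen (map_tree gf s)) (labcor eV (map (map_option V.lcor) (shift (tau V) Q))) =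
      A.lcor (map (map_option gf) (map (map_option V.lcor) (shift (tau V) Q)))"
  proof (rule labcor_natural)
    have "gf ((eV ^^ n) x) = (tau A ^^ n) (gf x)" for n x
      by (induction n) (simp_all add: gf_sgn_map)
    then show "\<forall>n. gf ((eV ^^ n) x) = (tau A ^^ n) (gf x)" for x by blast
  qed
  finally show ?thesis by (simp add: branch_def option.map_comp comp_def)
qed

text \<open>
  In particular \<open>F\<close> maps one cofree coalgebra into the other.
\<close>

lemma F_lcor:
  assumes "zs \<noteq> []"
  shows "eqv A (lext F (V.lcor zs)) (\<Sum>Q\<in>segs zs. fsc ((-1) ^ seg_sgn Q) (A.lcor (branch Q)))"
proof -
  have "F = (\<lambda>t. lext (\<lambda>b. gen (map_tree f b)) (decomp t))" using F_decomp by blast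
  then have "lext F (V.lcor zs) = lext (\<lambda>b. gen (map_tree f b)) (lext decomp (V.lcor zs))"
    unfolding lext_lext by simp
  also have "\<dots> = (\<Sum>Q\<in>segs zs. fsc ((-1) ^ seg_sgn Q) (lext (\<lambda>b. gen (map_tree f b)) (segterm (tau V) Q)))"
    by (simp add: decomp_labcor[OF assms] lext_sum)
  also have "eqv A \<dots> (\<Sum>Q\<in>segs zs. fsc ((-1) ^ seg_sgn Q) (A.lcor (branch Q)))"
    by (intro eqv_sum eqv_fsc F_segterm)
  finally show ?thesis .
qed

lemma F'_lcor:
  assumes "zs \<noteq> []"
  shows "eqv A (lext F' (V.lcor zs)) (\<Sum>Q\<in>segs zs - {[Some zs]}. fsc ((-1) ^ seg_sgn Q) (A.lcor (branch Q)))"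
proof -
  have whole: "[Some zs] \<in> segs zs" using assms by (simp add: segs_def)
  have t: "fsc ((-1) ^ seg_sgn [Some zs]) (A.lcor (branch [Some zs])) = (gen (Lf (gf (V.lcor zs))) :: _ \<Rightarrow>\<^sub>0 'k)"
    by (simp add: branch_def option.map_id0 flip: id_def)
  have "eqv A (gen (Lf (gf (V.lcor zs))) + lext F' (V.lcor zs))
      (gen (Lf (gf (V.lcor zs))) + (\<Sum>Q\<in>segs zs - {[Some zs]}. fsc ((-1) ^ seg_sgn Q) (A.lcor (branch Q))))"
    using eqv_trans[OF eqv_sym[OF F_lext_split] F_lcor[OF assms]]
    unfolding sum.remove[OF finite_segs whole] t .
  from eqv_diff[OF this eqv_refl[of A "gen (Lf (gf (V.lcor zs)))"]] show ?thesis by simp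
qed

end

section \<open>The transferred relations\<close>

text \<open>
  No component in the space of labels itself. On such elements \<open>\<delta>\<close> and
  \<open>\<gamma>\<close> agree, and \<open>f\<close> is given by the homotopy.
\<close>

definition leafless :: "('x tree \<Rightarrow>\<^sub>0 'k::field_char_0) \<Rightarrow> bool" where
  "leafless c \<longleftrightarrow> (\<forall>x. coef c (Lf x) = 0)"

lemma leafless_linear_eq:
  assumes "leafless c" "Vector_Spaces.linear fsc s \<phi>" "Vector_Spaces.linear fsc s \<psi>"
    and "\<And>t. shape t \<noteq> Lf () \<Longrightarrow> \<phi> (gen t) = \<psi> (gen t)"
  shows "\<phi> c = \<psi> c"
proof -
  have "gext s (\<lambda>t. \<phi> (gen t)) c = gext s (\<lambda>t. \<psi> (gen t)) c"
  proof (rule gext_cong)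
    fix t assume "t \<in> supp c"
    then have "shape t \<noteq> Lf ()" using assms(1) by (auto simp: leafless_def in_keys_iff)
    then show "\<phi> (gen t) = \<psi> (gen t)" by (rule assms(4))
  qed
  then show ?thesis using lin_eq_gext[OF assms(2), of c] lin_eq_gext[OF assms(3), of c] by simp
qed

lemma leafless_lext: "(\<And>t. leafless (g t)) \<Longrightarrow> leafless (lext g c)"
  by (simp add: leafless_def lookup_lext)

lemma leafless_inner_dif: "leafless (lext (inner_dif A \<gamma>) c)"
  by (rule leafless_lext) (auto simp: leafless_def inner_dif_def lookup_minus split: tree.split)

lemma word_eq_leaf: "word zs = [False] \<longleftrightarrow> (\<exists>x. zs = [Some x])"
  by (cases zs; cases "tl zs") auto

lemma leafless_labcor: "\<nexists>x. zs = [Some x] \<Longrightarrow> leafless (labcor \<tau> zs)"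
proof -
  assume *: "\<nexists>x. zs = [Some x]"
  have "coef (gen (place \<tau> w (vals zs)) :: _ \<Rightarrow>\<^sub>0 'b) (Lf x) = 0"
    if "w \<in> supp (cor (word zs) :: _ \<Rightarrow>\<^sub>0 'b)" for w x
  proof -
    have "corkword w = word zs" using that by (rule keys_cor)
    then have "w \<noteq> Lf ()" using * word_eq_leaf[of zs] by (cases w) auto
    then have "place \<tau> w (vals zs) \<noteq> Lf x" using place_eq_Lf_iff[of \<tau> w "vals zs"] by blast
    then show ?thesis by (simp add: lookup_gen del: place_eq_Lf_iff)
  qed
  then show "leafless (labcor \<tau> zs :: _ \<Rightarrow>\<^sub>0 'b)"
    by (simp add: leafless_def labcor_def lookup_lext del: place_eq_Lf_iff)
qed

context ops
begin

lemma gam_leafless: "leafless c \<Longrightarrow> del c = gam c"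
  by (rule leafless_linear_eq[OF _ linear_gext linear_gext])
    (auto simp: root_op_def top_op_def split: tree.split)

lemma bar_dif_lext: "lext D c = lext (\<lambda>t. gen (Lf (root_op \<gamma> A t))) c + lext (inner_dif A \<gamma>) c"
  by (simp flip: lext_fun_add bar_dif_split)

lemma del_dif: "del (lext D c) = dif A (del c) + gam (lext (inner_dif A \<gamma>) c)"
proof -
  have "del (lext (\<lambda>t. gen (Lf (root_op \<gamma> A t))) c) = gext (scl A) (\<lambda>t. dif A (root_op \<gamma> A t)) c"
    by (simp add: gext_lext' root_op_def)
  also have "\<dots> = dif A (del c)"
    using lin_gext[OF linear_dif, of "root_op \<gamma> A" c] by simp
  finally show ?thesis
    by (simp add: bar_dif_lext ge.add gam_leafless[OF leafless_inner_dif])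
qed

lemma del_dif_lcor:
  assumes "uA_infinity_algebra A \<gamma>" "\<nexists>x. zs = [Some x]"
  shows "del (lext D (lcor zs)) = kap (lcor zs)"
proof -
  have "coef (cor (word zs) :: _ \<Rightarrow>\<^sub>0 'k) (Lf ()) = 0"
    using assms(2) word_eq_leaf[of zs] by (auto simp: lookup_cor)
  moreover have "\<forall>w\<in>supp (cor (word zs) :: _ \<Rightarrow>\<^sub>0 'k). arity w = length (vals zs)"
    using keys_cor arity_word by blast
  ultimately have "del (lext D (tensor_rep A (cor (word zs)) (vals zs))) = kap (tensor_rep A (cor (word zs)) (vals zs))"
    using assms(1) cor_uAs_dual[of "word zs"] unfolding uA_infinity_algebra_iff by blast
  then show ?thesis unfolding tensor_rep_cor .
qed

end

context transfer
begin

abbreviation "dA \<equiv> lext (bar_dif A \<gamma>)"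
abbreviation "dV \<equiv> lext (bar_dif V \<gamma>V)"
abbreviation "nA \<equiv> lext (inner_dif A \<gamma>)"
abbreviation "nV \<equiv> lext (inner_dif V \<gamma>V)"

text \<open>
  The curvature picks those terms of \<open>F'\<close> in which one subtree of the root is a cork
  left in place, and the other one is replaced by its value under \<open>f\<close>.
\<close>

lemma kap_F'_Mu: "A.kap (F' (Mu l r)) = (if r = Cork then - tau A (f l) else 0) + (if l = Cork then - f r else 0)"
proof -
  define R where "R s = gext (scl A) (\<lambda>t. curv_op A (Mu s t)) (F r)" for s
  have R: "R s = curv_op A (Mu s (Lf (f r))) + gext (scl A) (\<lambda>t. curv_op A (Mu s t)) (F' r)" for s
    by (simp add: R_def F_split[of r] A.ge.add del: F.simps)
  have RLf: "R (Lf a) = (if r = Cork then - tau A a else 0)" for a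
    unfolding R by (cases r) (simp_all add: curv_op_def A.gext_MuF)
  have RCork: "R Cork = - f r"
    unfolding R by (cases r) (simp_all add: curv_op_def A.gext_MuF)
  have RMu: "R (Mu s t) = 0" for s t
    unfolding R by (simp add: curv_op_def)
  have "A.kap (F' (Mu l r)) = R (Lf (f l)) + gext (scl A) R (F' l)"
    by (simp add: A.gext_MuF R_def[symmetric] F_split[of l] A.ge.add)
  also have "gext (scl A) R (F' l) = (if l = Cork then - f r else 0)"
    by (cases l) (simp_all add: RCork RMu A.gext_MuF)
  finally show ?thesis by (simp add: RLf)
qed

lemma h_f: "h (f t) = 0"
  by (cases t) (simp_all add: f_def h_i h_h h.neg)

lemma p_f: "p (f t) = (case t of Lf v \<Rightarrow> v | _ \<Rightarrow> 0)"
  by (cases t) (simp_all add: f_def p_i p_h p.neg)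

lemma h_kap_F': "h (A.kap (F' t)) = 0"
proof (cases t)
  case (Mu l r)
  show ?thesis unfolding Mu kap_F'_Mu by (simp add: h.add h.neg h_tau h_f)
qed (simp_all add: curv_op_def)

lemma p_kap_F': "p (A.kap (F' t)) = curv_op V t"
proof (cases t)
  case (Mu l r)
  show ?thesis unfolding Mu kap_F'_Mu
    by (cases l; cases r) (simp_all add: p.add p.neg p.diff p_tau p_f p_i curv_op_def)
qed (simp_all add: curv_op_def)

lemma h_kap: "h (A.kap (lext F' c)) = 0"
  using lin_gext[OF h.linear_axioms, of "\<lambda>t. A.kap (F' t)" c] by (simp add: A.gext_lext' h_kap_F')

lemma p_kap: "p (A.kap (lext F' c)) = V.kap c"
  using lin_gext[OF p.linear_axioms, of "\<lambda>t. A.kap (F' t)" c] by (simp add: A.gext_lext' p_kap_F')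

lemma leafless_F': "leafless (lext F' c)"
  by (rule leafless_lext) (auto simp: leafless_def F'_def lookup_gen split: tree.split)

lemma gam_V: "VO.gam u = p (A.gam (lext F' u))"
  using lin_gext[OF p.linear_axioms, of "\<lambda>t. A.gam (F' t)" u]
  by (simp add: A.gext_lext' top_V[abs_def])

lemma gf_leafless: "leafless c \<Longrightarrow> gf c = - h (A.gam (lext F' c))"
proof (rule leafless_linear_eq[OF _ A.linear_gext])
  show "Vector_Spaces.linear fsc (scl A) (\<lambda>c. - h (A.gam (lext F' c)))"
    using Vector_Spaces.linear_compose[OF lext_linear linear_hgam] by (simp add: comp_def)
qed (auto simp: f_nonleaf)

definition commutes :: "('v tree \<Rightarrow>\<^sub>0 'k) \<Rightarrow> bool" where
  "commutes u \<longleftrightarrow> eqv A (lext F (dV u)) (dA (lext F u))"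

text \<open>
  The induction step for the inner part: \<open>F'\<close> is multiplicative, and the inner
  predifferentials are derivations.
\<close>

lemma inner_commutes_MuF:
  assumes "commutes u" "commutes v"
  shows "eqv A (lext F' (nV (MuF u v))) (nA (lext F' (MuF u v)))"
proof -
  have "lext F' (nV (MuF u v)) = - MuF (lext F (dV u)) (lext F v) - MuF (lext F (eV u)) (lext F (dV v))"
    by (simp add: inner_dif_MuF F'_MuF)
  also have "eqv A \<dots> (- MuF (dA (lext F u)) (lext F v) - MuF (eA (lext F u)) (dA (lext F v)))"
    using assms by (intro eqv_diff eqv_neg eqv_MuF eqv_refl F_sgn_map) (simp_all add: commutes_def)
  finally show ?thesis by (simp add: inner_dif_MuF F'_MuF)
qed

lemma branch_nonleaf:
  assumes "Q \<in> segs zs - {[Some zs]}"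
  shows "\<nexists>x. branch Q = [Some x]"
proof
  assume "\<exists>x. branch Q = [Some x]"
  then obtain x where "branch Q = [Some x]" by blast
  then have "\<exists>b. Q = [Some b]"
    by (cases Q; cases "tl Q") (auto simp: branch_def)
  then show False using assms by (auto simp: segs_def)
qed

text \<open>
  \<open>F'\<close> of a corolla is a sum of corollas of \<open>A\<close> other than single
  labels, so the relations of \<open>A\<close> apply.
\<close>

lemma del_dif_F':
  assumes "zs \<noteq> []"
  shows "A.del (dA (lext F' (V.lcor zs))) = A.kap (lext F' (V.lcor zs))"
proof -
  let ?S = "\<Sum>Q\<in>segs zs - {[Some zs]}. fsc ((-1) ^ seg_sgn Q) (A.lcor (branch Q)) :: _ \<Rightarrow>\<^sub>0 'k"
  have "A.del (dA (lext F' (V.lcor zs))) = A.del (dA ?S)"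
    by (intro A.eqv_del A.eqv_bar_dif F'_lcor assms)
  also have "\<dots> = A.kap ?S"
    using A.del_dif_lcor[OF alg branch_nonleaf]
    by (simp add: lext_sum A.ge.sum A.ge.scale)
  also have "\<dots> = A.kap (lext F' (V.lcor zs))"
    by (intro A.eqv_kap eqv_sym[OF F'_lcor] assms)
  finally show ?thesis .
qed

text \<open>
  The argument of the introduction, with \<open>G = \<gamma> (F' c)\<close>, \<open>X = \<gamma>
  (F' (D' c))\<close> and \<open>\<kappa> = \<kappa> (F' c)\<close>.
\<close>

lemma transfer_step:
  assumes "zs \<noteq> []" "\<nexists>x. zs = [Some x]"
    and ic: "eqv A (lext F' (nV (V.lcor zs))) (nA (lext F' (V.lcor zs)))"
  shows "commutes (V.lcor zs) \<and> VO.del (dV (V.lcor zs)) = V.kap (V.lcor zs)"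
proof -
  define c :: "'v tree \<Rightarrow>\<^sub>0 'k" where "c = V.lcor zs"
  have red: "leafless c" unfolding c_def by (rule leafless_labcor) fact
  define G where "G = A.gam (lext F' c)"
  define X where "X = A.gam (lext F' (nV c))"
  define \<kappa> where "\<kappa> = A.kap (lext F' c)"
  have X: "X = A.gam (nA (lext F' c))"
    unfolding X_def c_def by (rule A.eqv_gam[OF ic])
  have delF': "A.del (lext F' c) = G"
    unfolding G_def by (rule A.gam_leafless[OF leafless_F'])
  have E: "dif A G + X = \<kappa>"
    using del_dif_F'[OF assms(1)] unfolding c_def[symmetric] A.del_dif delF' X[symmetric] \<kappa>_def .
  have delV: "VO.del c = p G"
    using VO.gam_leafless[OF red] by (simp add: gam_V G_def)
  have "VO.del (dV c) = dif V (p G) + p X"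
    by (simp add: VO.del_dif delV gam_V X_def)
  also have "\<dots> = p \<kappa>" by (simp add: E[symmetric] p.add p_dif)
  finally have rel: "VO.del (dV c) = V.kap c" by (simp add: \<kappa>_def p_kap)
  \<comment> \<open>the component in the labels of \<open>F D c\<close> is \<open>i p G - h X\<close>, the one of \<open>D F c\<close> is \<open>- d h G + G\<close>; they agree by this equation
    and the homotopy identity\<close>
  have hX: "h X = - h (dif A G)"
  proof -
    have "h (dif A G + X) = 0" unfolding E \<kappa>_def by (rule h_kap)
    then show ?thesis by (simp add: h.add eq_neg_iff_add_eq_0 add.commute)
  qed
  have "lext F (dV c) = lext F (lext (\<lambda>t. gen (Lf (root_op \<gamma>V V t))) c) + lext F (nV c)"
    by (simp add: VO.bar_dif_lext)
  also have "eqv A \<dots> (gen (Lf (i (p G))) + (gen (Lf (gf (nV c))) + lext F' (nV c)))"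
  proof (rule eqv_add[OF _ F_lext_split])
    have "eqv A (lext F (lext (\<lambda>t. gen (Lf (root_op \<gamma>V V t))) c)) (lext F (gen (Lf (VO.del c))))"
      by (intro eqv_F V.eqv_lext_Lf)
    then show "eqv A (lext F (lext (\<lambda>t. gen (Lf (root_op \<gamma>V V t))) c)) (gen (Lf (i (p G))))"
      by (simp add: delV)
  qed
  also have "\<dots> = (gen (Lf (i (p G))) + gen (Lf (- h X))) + lext F' (nV c)"
    by (simp add: gf_leafless[OF leafless_inner_dif] X_def)
  also have "eqv A \<dots> (gen (Lf (i (p G) + - h X)) + nA (lext F' c))"
    unfolding c_def by (intro eqv_add eqv_sym[OF A.eqv_Lf_add] ic)
  also have "i (p G) + - h X = dif A (- h G) + G"
    using homotopy[of G] by (simp add: hX A.df.neg algebra_simps)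
  also have "eqv A (gen (Lf (dif A (- h G) + G)) + nA (lext F' c))
      (gen (Lf (dif A (- h G))) + gen (Lf G) + nA (lext F' c))"
    by (intro eqv_add eqv_refl A.eqv_Lf_add)
  also have "\<dots> = gen (Lf (dif A (gf c))) + (gen (Lf (A.del (lext F' c))) + nA (lext F' c))"
    by (simp add: gf_leafless[OF red] G_def delF')
  also have "eqv A \<dots> (gen (Lf (dif A (gf c))) + (lext (\<lambda>t. gen (Lf (root_op \<gamma> A t))) (lext F' c) + nA (lext F' c)))"
    by (intro eqv_add eqv_refl eqv_sym[OF A.eqv_lext_Lf])
  also have "\<dots> = dA (gen (Lf (gf c)) + lext F' c)"
    by (simp add: A.bar_dif_lext)
  also have "eqv A \<dots> (dA (lext F c))"
    by (intro A.eqv_bar_dif eqv_sym[OF F_lext_split])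
  finally have "commutes c" by (simp add: commutes_def)
  with rel show ?thesis by (simp add: c_def)
qed

lemma commutes_lcor:
  "zs \<noteq> [] \<Longrightarrow> commutes (V.lcor zs) \<and> ((\<nexists>x. zs = [Some x]) \<longrightarrow> VO.del (dV (V.lcor zs)) = V.kap (V.lcor zs))"
proof (induction zs rule: measure_induct_rule[of length])
  case (less zs)
  show ?case
    using less.prems
  proof (cases rule: labelled_word_cases)
    case 1
    have "eqv A (lext F' (nV (V.lcor zs))) (nA (lext F' (V.lcor zs)))"
      by (simp add: 1 inner_dif_def)
    then show ?thesis using transfer_step[of zs] 1 by simp
  next
    case 2
    then show ?thesis by (simp add: commutes_def i_dif)
  next
    case 3
    have "eqv A (lext F' (nV (V.lcor zs))) (nA (lext F' (V.lcor zs)))"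
    proof -
      have *: "eqv A (lext F' (nV (MuF (V.lcor (map (map_option (tau V ^^ n_verts r)) l)) (V.lcor r))))
          (nA (lext F' (MuF (V.lcor (map (map_option (tau V ^^ n_verts r)) l)) (V.lcor r))))"
        if "(l, r) \<in> splits zs" for l r
        using that by (intro inner_commutes_MuF conjunct1[OF less.IH]) (auto simp: splits_def)
      show ?thesis
        unfolding labcor_rec[OF 3] lext_sum
        by (rule eqv_sum) (auto intro!: eqv_fsc *)
    qed
    then show ?thesis using transfer_step[of zs] 3 by fastforce
  qed
qed

lemma V_algebra: "uA_infinity_algebra V \<gamma>V"
  unfolding uA_infinity_algebra_iff
proof (intro conjI ballI allI impI)
  show "ops V \<gamma>V" by unfold_locales
  fix c :: "unit tree \<Rightarrow>\<^sub>0 'k" and xs :: "'v list" assume c: "c \<in> uAs_dual"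
    and "coef c (Lf ()) = 0 \<and> (\<forall>w\<in>supp c. arity w = length xs)"
  then have c0: "coef c (Lf ()) = 0" and ar: "\<forall>w\<in>supp c. arity w = length xs" by auto
  obtain Z where Z: "tensor_rep V c xs = (\<Sum>b\<in>corkword ` supp c.
      fsc (coef c (left_comb b)) (V.lcor (Z b)))"
    "\<And>b. b \<in> corkword ` supp c \<Longrightarrow> word (Z b) = b"
    using V.tensor_rep_expand[OF c ar] by blast
  have "VO.del (dV (V.lcor (Z b))) = V.kap (V.lcor (Z b))" if b: "b \<in> corkword ` supp c" for b
  proof -
    obtain w where w: "w \<in> supp c" "b = corkword w" using b by auto
    have "w \<noteq> Lf ()" using w(1) c0 by (auto simp: in_keys_iff)
    then have "b \<noteq> [False]" "b \<noteq> []" using w(2) trees_single[of False] by auto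
    then have "Z b \<noteq> []" "\<nexists>x. Z b = [Some x]" using Z(2)[OF b] word_eq_leaf[of "Z b"] by auto
    then show ?thesis using commutes_lcor[of "Z b"] by blast
  qed
  then show "VO.del (dV (tensor_rep V c xs)) = V.kap (tensor_rep V c xs)"
    unfolding Z(1) by (simp add: lext_sum V.ge.sum V.ge.scale)
qed

lemma F_rel1: "v \<in> rel1 V \<Longrightarrow> lext F v \<in> rel1 A"
  by (rule rel1_lext[where F = F, OF qlin_F])

lemma F_infinity_morphism: "infinity_morphism V \<gamma>V A \<gamma> F"
  unfolding infinity_morphism_def
proof (intro conjI ballI allI subsetI; (elim imageE)?)
  fix y v assume "y = lext F v" "v \<in> rel1 V"
  then show "y \<in> rel1 A" using F_rel1 by blast
next
  fix y v assume y: "y = lext F v" "v \<in> cofree V"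
  show "y \<in> cofree A"
    unfolding y(1)
  proof (rule V.cofree_induct[OF y(2) lext_linear A.subspace_cofree])
    show "lext F v \<in> cofree A" if "v \<in> rel1 V" for v
      using that by (intro A.rel1_cofree F_rel1)
    fix zs :: "'v option list" assume "zs \<noteq> []"
    from F_lcor[OF this]
    have "lext F (V.lcor zs) - (\<Sum>Q\<in>segs zs. fsc ((-1) ^ seg_sgn Q) (A.lcor (branch Q))) \<in> cofree A"
      unfolding eqv_def by (rule A.rel1_cofree)
    moreover have "(\<Sum>Q\<in>segs zs. fsc ((-1) ^ seg_sgn Q) (A.lcor (branch Q))) \<in> cofree A"
      by (intro fv.subspace_sum fv.subspace_scale A.subspace_cofree A.lcor_cofree)
    ultimately show "lext F (V.lcor zs) \<in> cofree A"
      using fv.subspace_add[OF A.subspace_cofree] by fastforce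
  qed
next
  fix n y v assume y: "y = lext F v" "v \<in> cofree V \<inter> homogeneous V n"
  show "y \<in> homogeneous A n"
    unfolding y(1)
  proof (rule V.homogeneous_induct[OF _ lext_linear A.subspace_homogeneous])
    show "v \<in> homogeneous V n" using y(2) by blast
    show "lext F v \<in> homogeneous A n" if "v \<in> rel1 V" for v
      using that by (intro A.homogeneous_rel1 F_rel1)
    show "lext F (gen t) \<in> homogeneous A n"
      if "V.hom (labels (\<lambda>x. x) t) ds" "int (verts t) + sum_list ds = n" for t ds
      using F_homogeneous[OF that(1)] that(2) by simp
  qed
next
  fix v :: "'v tree \<Rightarrow>\<^sub>0 'k"
  have "lext decomp (lext F v) = lext (\<lambda>b. expand (map_tree F b)) (lext decomp v)"
    unfolding lext_lext F_coalgebra ..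
  then show "lext decomp (lext F v) - lext (\<lambda>b. expand (map_tree F b)) (lext decomp v) \<in> rel2 A"
    by (simp add: fv.subspace_0[OF subspace_multilin])
next
  fix v assume v: "v \<in> cofree V"
  have "lext F (dV v) - dA (lext F v) \<in> rel1 A"
  proof (rule V.cofree_induct[OF v _ subspace_multilin, where \<phi> = "\<lambda>v. lext F (dV v) - dA (lext F v)"])
    show "Vector_Spaces.linear fsc fsc (\<lambda>v. lext F (dV v) - dA (lext F v))"
      by unfold_locales (simp_all add: fv.scale_right_diff_distrib)
    show "lext F (dV v) - dA (lext F v) \<in> rel1 A" if "v \<in> rel1 V" for v
      using that by (intro fv.subspace_diff[OF subspace_multilin] F_rel1
          rel1_lext[where F = "bar_dif V \<gamma>V", OF VO.qlin_bar_dif]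
          rel1_lext[where F = "bar_dif A \<gamma>", OF A.qlin_bar_dif])
    show "lext F (dV (V.lcor zs)) - dA (lext F (V.lcor zs)) \<in> rel1 A" if "zs \<noteq> []" for zs
      using commutes_lcor[OF that] by (simp add: commutes_def eqv_def)
  qed
  then show "dA (lext F v) - lext F (dV v) \<in> rel1 A"
    using fv.subspace_neg[OF subspace_multilin] by fastforce
qed

end

section \<open>Tree sums\<close>

lemma positions_eq_iff:
  assumes "length b = length c"
  shows "positions id b = positions id c \<longleftrightarrow> b = c"
proof
  assume eq: "positions id b = positions id c"
  show "b = c"
  proof (rule nth_equalityI[OF assms])
    fix j assume "j < length b"
    have "Suc j \<in> positions id b \<longleftrightarrow> Suc j \<in> positions id c" using eq by simp
    then show "b ! j = c ! j" using \<open>j < length b\<close> assms by (simp add: positions_def)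
  qed
qed simp

lemma corolla_cor: "corolla (length b) (positions id b) = cor b"
proof -
  have "{w :: unit tree. length (corkword w) = length b \<and> positions id (corkword w) = positions id b} = {w. corkword w = b}"
    using positions_eq_iff by blast
  then show ?thesis by (simp add: corolla_def cor_def)
qed

lemma positions_map: "positions P ts = positions id (map P ts)"
  by (auto simp: positions_def)

text \<open>
  \<open>ptrees\<close>, indexed by words.
\<close>

definition ltrees :: "'x option list \<Rightarrow> ptree set" where
  "ltrees zs = {t. ptree_ok t \<and> t \<noteq> Conn \<and> pword t = word zs}"

lemma ptrees_ltrees:
  assumes "length (word zs) = n" "positions id (word zs) = S"
  shows "ptrees n S = ltrees zs"
proof -
  have "length (pword t) = n \<and> positions id (pword t) = S \<longleftrightarrow> pword t = word zs" for t
    by (metis assms positions_eq_iff)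
  then show ?thesis unfolding ptrees_def ltrees_def by blast
qed

text \<open>
  Pairs \<open>(n, S)\<close> and cork words are equivalent data.
\<close>

lemma ex_word: "S \<subseteq> {1..n} \<Longrightarrow> \<exists>b. length b = n \<and> positions id b = S \<and> corks b = card S"
proof (induction n arbitrary: S)
  case (Suc n)
  have "S - {Suc n} \<subseteq> {1..n}" using Suc.prems by (auto simp: le_Suc_eq)
  then obtain b where b: "length b = n" "positions id b = S - {Suc n}" "corks b = card (S - {Suc n})"
    using Suc.IH by blast
  have fin: "finite S" using Suc.prems finite_subset by blast
  have "positions id (b @ [Suc n \<in> S]) = S"
  proof (rule set_eqI)
    fix j
    have "j \<in> positions id (b @ [Suc n \<in> S]) \<longleftrightarrow> (j \<in> positions id b \<or> (j = Suc n \<and> Suc n \<in> S))"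
      using b(1) by (cases j) (auto simp: positions_def nth_append)
    then show "j \<in> positions id (b @ [Suc n \<in> S]) \<longleftrightarrow> j \<in> S" using b(2) by auto
  qed
  moreover have "corks (b @ [Suc n \<in> S]) = card S"
    using b(3) card_Suc_Diff1[OF fin, of "Suc n"] by auto
  moreover have "length (b @ [Suc n \<in> S]) = Suc n" using b(1) by simp
  ultimately show ?case by blast
qed (auto simp: positions_def)

text \<open>
  The children of the root of a planar tree define a segmentation: a connected cork stays at the
  bottom, every other child lies above its block.
\<close>

fun fits :: "ptree \<Rightarrow> 'x option list option \<Rightarrow> bool" where
  "fits t None \<longleftrightarrow> t = Conn"
| "fits t (Some b) \<longleftrightarrow> t \<in> ltrees b"

lemma fits_pword: "fits t q \<Longrightarrow> pword t = word (blk q)"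
  by (cases q) (auto simp: ltrees_def)

lemma fits_Conn: "fits t q \<Longrightarrow> t = Conn \<longleftrightarrow> q = None"
  by (cases q) (auto simp: ltrees_def)

lemma fits_ok: "fits t q \<Longrightarrow> ptree_ok t"
  by (cases q) (auto simp: ltrees_def)

definition forests :: "'x option list option list \<Rightarrow> ptree list set" where
  "forests Q = {ts. list_all2 fits ts Q}"

lemma forests_Nil [simp]: "forests [] = {[]}"
  by (auto simp: forests_def)

lemma forests_Cons: "forests (q # Q) = (\<lambda>(t, ts). t # ts) ` ({t. fits t q} \<times> forests Q)"
  by (auto simp: forests_def list_all2_Cons2)

lemma forests_pword: "ts \<in> forests Q \<Longrightarrow> concat (map pword ts) = word (ucat Q)"
  unfolding forests_def mem_Collect_eq by (induction rule: list_all2_induct) (auto dest: fits_pword)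

lemma pword_nonempty: "ptree_ok t \<Longrightarrow> pword t \<noteq> []"
proof (induction t)
  case (Node ts)
  then obtain t ts' where "ts = t # ts'" by (cases ts) auto
  then show ?case using Node by auto
qed auto

lemma word_append_cases: "word zs = u @ v \<Longrightarrow> \<exists>zs1 zs2. zs = zs1 @ zs2 \<and> word zs1 = u \<and> word zs2 = v"
  by (auto simp: map_eq_append_conv)

lemma ex_segs:
  assumes "\<forall>t\<in>set ts. ptree_ok t" "concat (map pword ts) = word zs"
  shows "\<exists>Q. ucat Q = zs \<and> Some [] \<notin> set Q \<and> ts \<in> forests Q"
  using assms
proof (induction ts arbitrary: zs)
  case Nil
  then show ?case by (intro exI[of _ "[]"]) auto
next
  case (Cons t ts)
  obtain zs1 zs2 where zs: "zs = zs1 @ zs2" "word zs1 = pword t" "word zs2 = concat (map pword ts)"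
    using word_append_cases[of zs "pword t" "concat (map pword ts)"] Cons.prems(2) by auto
  obtain Q where Q: "ucat Q = zs2" "Some [] \<notin> set Q" "ts \<in> forests Q"
    using Cons.IH[of zs2] Cons.prems(1) zs(3) by auto
  have ne: "zs1 \<noteq> []" using pword_nonempty[of t] Cons.prems(1) zs(2) by auto
  show ?case
  proof (cases "t = Conn")
    case True
    then have "zs1 = [None]" using zs(2) by auto
    then show ?thesis using True Q zs(1) by (intro exI[of _ "None # Q"]) (auto simp: forests_Cons)
  next
    case False
    then have "t \<in> ltrees zs1" using Cons.prems(1) zs(2) by (simp add: ltrees_def)
    then show ?thesis using Q zs(1) ne by (intro exI[of _ "Some zs1 # Q"]) (auto simp: forests_Cons)
  qed
qed

lemma forests_unique:
  "ts \<in> forests Q \<Longrightarrow> ts \<in> forests R \<Longrightarrow> ucat Q = ucat R \<Longrightarrow> Q = R"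
proof (induction Q arbitrary: R ts)
  case Nil
  then show ?case by (auto simp: forests_def)
next
  case (Cons q Q)
  then obtain t ts' r R' where ts: "ts = t # ts'" "R = r # R'" "fits t q" "fits t r" "ts' \<in> forests Q" "ts' \<in> forests R'"
    by (auto simp: forests_def list_all2_Cons2 list_all2_Cons1)
  have "length (blk q) = length (blk r)"
    using fits_pword[OF ts(3)] fits_pword[OF ts(4)] by (metis length_map)
  then have b: "blk q = blk r" "ucat Q = ucat R'" using Cons.prems(3) ts(2) by auto
  then have "q = r" using fits_Conn[OF ts(3)] fits_Conn[OF ts(4)] by (cases q; cases r) auto
  then show ?case using Cons.IH[OF ts(5,6) b(2)] ts(2) by simp
qed

lemma forests_ok: "ts \<in> forests Q \<Longrightarrow> \<forall>s\<in>set ts. ptree_ok s"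
  unfolding forests_def mem_Collect_eq by (induction rule: list_all2_induct) (auto dest: fits_ok)

lemma forests_length: "ts \<in> forests Q \<Longrightarrow> length ts = length Q"
  unfolding forests_def mem_Collect_eq by (rule list_all2_lengthD)

text \<open>
  The segmentation with a single block is excluded, as a vertex has at least two inputs.
\<close>

lemma ltrees_Node:
  assumes "2 \<le> length zs"
  shows "ltrees zs = (\<lambda>(Q, ts). Node ts) ` (SIGMA Q:segs zs - {[Some zs]}. forests Q)"
proof (intro equalityI subsetI)
  fix t assume t: "t \<in> ltrees zs"
  have "length (pword t) = length zs" using t by (simp add: ltrees_def)
  then obtain ts where ts: "t = Node ts" using assms by (cases t) auto
  obtain Q where Q: "ucat Q = zs" "Some [] \<notin> set Q" "ts \<in> forests Q"
    using ex_segs[of ts zs] t by (auto simp: ltrees_def ts list_all_iff)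
  have "length ts = length Q" using Q(3) by (auto simp: forests_def list_all2_lengthD)
  then have "Q \<noteq> [Some zs]" using t by (auto simp: ltrees_def ts)
  then show "t \<in> (\<lambda>(Q, ts). Node ts) ` (SIGMA Q:segs zs - {[Some zs]}. forests Q)"
    using Q ts by (intro image_eqI[of _ _ "(Q, ts)"]) (auto simp: segs_def)
next
  fix t assume "t \<in> (\<lambda>(Q, ts). Node ts) ` (SIGMA Q:segs zs - {[Some zs]}. forests Q)"
  then obtain Q ts where t: "t = Node ts" "Q \<in> segs zs" "Q \<noteq> [Some zs]" "ts \<in> forests Q" by auto
  have "2 \<le> length Q"
  proof (rule ccontr)
    assume "\<not> 2 \<le> length Q"
    then consider "Q = []" | q where "Q = [q]" by (cases Q rule: remdups_adj.cases) auto
    then show False using t(2,3) assms by cases (auto simp: segs_def split: option.splits)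
  qed
  moreover note forests_length[OF t(4)] forests_ok[OF t(4)]
  ultimately show "t \<in> ltrees zs"
    using forests_pword[OF t(4)] t(2) by (auto simp: ltrees_def t(1) segs_def list_all_iff)
qed

lemma Node_not_ltrees:
  assumes "length zs = 1"
  shows "Node ts \<notin> ltrees zs"
proof
  assume t: "Node ts \<in> ltrees zs"
  obtain Q where Q: "ucat Q = zs" "Some [] \<notin> set Q" "ts \<in> forests Q"
    using ex_segs[of ts zs] t by (auto simp: ltrees_def list_all_iff)
  show False using forests_length[OF Q(3)] length_ucat[OF Q(2)] Q(1) t assms by (auto simp: ltrees_def)
qed

lemma ltrees_Some: "ltrees [Some x] = {Leaf}"
proof -
  have "t \<in> ltrees [Some x] \<longleftrightarrow> t = Leaf" for t
    using Node_not_ltrees[of "[Some x]"] by (cases t) (auto simp: ltrees_def)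
  then show ?thesis by blast
qed

lemma ltrees_None: "ltrees [None] = {Disc}"
proof -
  have "t \<in> ltrees [None :: 'a option] \<longleftrightarrow> t = Disc" for t
    using Node_not_ltrees[of "[None :: 'a option]"] by (cases t) (auto simp: ltrees_def)
  then show "ltrees [None :: 'a option] = {Disc}" by blast
qed

lemmas ltrees_single = ltrees_Some ltrees_None

lemma finite_forests: "(\<And>b. Some b \<in> set Q \<Longrightarrow> finite (ltrees b)) \<Longrightarrow> finite (forests Q)"
proof (induction Q)
  case (Cons q Q)
  have "finite {t. fits t q}" using Cons.prems by (cases q) auto
  then show ?case using Cons by (auto simp: forests_Cons)
qed simp

lemma segs_shorter:
  assumes "Q \<in> segs zs - {[Some zs]}" "Some b \<in> set Q"
  shows "length b < length zs" "b \<noteq> []"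
proof -
  obtain Q1 Q2 where Q: "Q = Q1 @ Some b # Q2" using split_list[OF assms(2)] by blast
  show "b \<noteq> []" using assms Q by (auto simp: segs_def)
  have "Q1 \<noteq> [] \<or> Q2 \<noteq> []" using assms(1) Q by (auto simp: segs_def)
  then have "0 < length (ucat Q1) + length (ucat Q2)"
    using ucat_nonempty[of Q1] ucat_nonempty[of Q2] assms(1) Q by (auto simp: segs_def simp del: concat_eq_Nil_conv)
  moreover have "zs = ucat Q1 @ b @ ucat Q2" using assms(1) Q by (simp add: segs_def)
  ultimately show "length b < length zs" by simp
qed

lemma finite_ltrees: "zs \<noteq> [] \<Longrightarrow> finite (ltrees zs)"
proof (induction zs rule: measure_induct_rule[of length])
  case (less zs)
  show ?case
    using less.prems
  proof (cases rule: labelled_word_cases)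
    case 3
    show ?thesis
      unfolding ltrees_Node[OF 3]
      by (intro finite_imageI finite_SigmaI finite_Diff finite_segs, rule finite_forests, rule less.IH)
        (erule (1) segs_shorter)+
  qed (simp_all add: ltrees_single)
qed

lemma sum_ltrees:
  assumes "2 \<le> length zs"
  shows "(\<Sum>t\<in>ltrees zs. g t) = (\<Sum>Q\<in>segs zs - {[Some zs]}. \<Sum>ts\<in>forests Q. g (Node ts))"
proof -
  have "inj_on (\<lambda>(Q, ts). Node ts) (SIGMA Q:segs zs - {[Some zs]}. forests Q)"
    by (rule inj_onI) (auto simp: segs_def dest: forests_unique)
  then have "(\<Sum>t\<in>ltrees zs. g t) = (\<Sum>(Q, ts)\<in>(SIGMA Q:segs zs - {[Some zs]}. forests Q). g (Node ts))"
    unfolding ltrees_Node[OF assms] by (subst sum.reindex) (auto simp: case_prod_unfold)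
  also have "\<dots> = (\<Sum>Q\<in>segs zs - {[Some zs]}. \<Sum>ts\<in>forests Q. g (Node ts))"
    by (rule sum.Sigma[symmetric])
      (simp, intro ballI, rule finite_forests, rule finite_ltrees, erule (1) segs_shorter(2))
  finally show ?thesis .
qed

text \<open>
  The sign of a tree with a homotopy at its root; leaves and connected corks carry none.
\<close>

definition edge_sgn :: "ptree \<Rightarrow> nat" where
  "edge_sgn t = ptree_sgn t + (if t = Leaf \<or> t = Conn then 0 else 1)"

lemma fits_length: "fits t q \<Longrightarrow> pleaves t = length (blk q)"
  and fits_corks: "fits t q \<Longrightarrow> pcorks t = n_corks (blk q)"
  using fits_pword[of t q] by simp_all

lemma sum_pleaves: "ts \<in> forests Q \<Longrightarrow> Some [] \<notin> set Q \<Longrightarrow>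
    (\<Sum>j<length ts. pleaves (ts ! j) - 1) = length (ucat Q) - length Q"
  unfolding forests_def mem_Collect_eq
proof (induction rule: list_all2_induct)
  case (Cons t ts q Q)
  have "1 \<le> length (blk q)" using Cons.prems by (cases q) (auto simp: Suc_le_eq)
  then show ?case
    using Cons length_ucat[of Q] fits_length[OF Cons.hyps(1)]
    by (simp add: sum.lessThan_Suc_shift del: sum.lessThan_Suc)
qed simp

lemma card_Conn: "ts \<in> forests Q \<Longrightarrow> card {l. l < length ts \<and> ts ! l = Conn} = n_corks Q"
  unfolding forests_def mem_Collect_eq
proof (induction rule: list_all2_induct)
  case (Cons t ts q Q)
  have "{l. l < length (t # ts) \<and> (t # ts) ! l = Conn} =
      (if t = Conn then {0} else {}) \<union> Suc ` {l. l < length ts \<and> ts ! l = Conn}"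
    by (auto simp: less_Suc_eq_0_disj)
  then show ?case using Cons fits_Conn[OF Cons.hyps(1)] by (auto simp: card_image)
qed simp

text \<open>
  Both sides are computed by removing the first child: it contributes to the first sum only
  through the inner sums of the later children, and to the second sum only through its own
  summand.
\<close>

lemma forest_sgn:
  assumes "ts \<in> forests Q" "Some [] \<notin> set Q"
  shows "(\<Sum>j<length ts. (pleaves (ts ! j) - 1) * (\<Sum>l<j. pleaves (ts ! l) + pcorks (ts ! l))) +
     (\<Sum>j<length ts. if ts ! j = Conn then 0
        else pdegree (ts ! j) * card {l. j < l \<and> l < length ts \<and> ts ! l = Conn}) = seg_sgn Q"
  using assms unfolding forests_def mem_Collect_eq
proof (induction rule: list_all2_induct)
  case (Cons t ts q Q)
  let ?c = "\<lambda>t. pleaves t + pcorks t"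
  have f: "ts \<in> forests Q" using Cons.hyps by (simp add: forests_def)
  have ne: "Some [] \<notin> set Q" using Cons.prems by simp
  have shift: "card {l. Suc j < l \<and> l < Suc (length ts) \<and> (t # ts) ! l = Conn} =
      card {l. j < l \<and> l < length ts \<and> ts ! l = Conn}" for j
  proof -
    have "{l. Suc j < l \<and> l < Suc (length ts) \<and> (t # ts) ! l = Conn} =
        Suc ` {l. j < l \<and> l < length ts \<and> ts ! l = Conn}"
    proof (rule set_eqI)
      show "l \<in> {l. Suc j < l \<and> l < Suc (length ts) \<and> (t # ts) ! l = Conn} \<longleftrightarrow>
          l \<in> Suc ` {l. j < l \<and> l < length ts \<and> ts ! l = Conn}" for l
        by (cases l) auto
    qed
    then show ?thesis by (simp add: card_image)
  qed
  have shift0: "card {l. 0 < l \<and> l < Suc (length ts) \<and> (t # ts) ! l = Conn} = n_corks Q"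
  proof -
    have "{l. 0 < l \<and> l < Suc (length ts) \<and> (t # ts) ! l = Conn} = Suc ` {l. l < length ts \<and> ts ! l = Conn}"
    proof (rule set_eqI)
      show "l \<in> {l. 0 < l \<and> l < Suc (length ts) \<and> (t # ts) ! l = Conn} \<longleftrightarrow>
          l \<in> Suc ` {l. l < length ts \<and> ts ! l = Conn}" for l
        by (cases l) auto
    qed
    then show ?thesis using card_Conn[OF f] by (simp add: card_image)
  qed
  have "(\<Sum>j<length (t # ts). (pleaves ((t # ts) ! j) - 1) * (\<Sum>l<j. ?c ((t # ts) ! l))) =
      (\<Sum>j<length ts. (pleaves (ts ! j) - 1) * (?c t + (\<Sum>l<j. ?c (ts ! l))))"
    by (simp add: sum.lessThan_Suc_shift del: sum.lessThan_Suc)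
  also have "\<dots> = (length (ucat Q) - length Q) * ?c t + (\<Sum>j<length ts. (pleaves (ts ! j) - 1) * (\<Sum>l<j. ?c (ts ! l)))"
    unfolding sum_pleaves[OF f ne, symmetric] by (simp only: distrib_left sum.distrib sum_distrib_right)
  finally have 1: "(\<Sum>j<length (t # ts). (pleaves ((t # ts) ! j) - 1) * (\<Sum>l<j. ?c ((t # ts) ! l))) = \<dots>" .
  have 2: "(\<Sum>j<length (t # ts). if (t # ts) ! j = Conn then 0
        else pdegree ((t # ts) ! j) * card {l. j < l \<and> l < length (t # ts) \<and> (t # ts) ! l = Conn}) =
      (if t = Conn then 0 else pdegree t * n_corks Q) +
      (\<Sum>j<length ts. if ts ! j = Conn then 0 else pdegree (ts ! j) * card {l. j < l \<and> l < length ts \<and> ts ! l = Conn})"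
    by (simp add: sum.lessThan_Suc_shift shift shift0 del: sum.lessThan_Suc cong: if_cong)
  have t: "(if t = Conn then 0 else pdegree t * n_corks Q) = case_option 0 n_verts q * n_corks Q"
    using fits_Conn[OF Cons.hyps(1)] fits_length[OF Cons.hyps(1)] fits_corks[OF Cons.hyps(1)]
    by (cases q) (auto simp: n_verts_def)
  show ?case
    unfolding 1 2 t using Cons.IH[OF ne] fits_length[OF Cons.hyps(1)] fits_corks[OF Cons.hyps(1)]
    by simp
qed simp

lemma ptree_sgn_Node:
  assumes "ts \<in> forests Q" "Some [] \<notin> set Q"
  shows "ptree_sgn (Node ts) = seg_sgn Q + sum_list (map edge_sgn ts)"
proof -
  have "length (filter (\<lambda>t. t \<noteq> Leaf \<and> t \<noteq> Conn) ts) + sum_list (map ptree_sgn ts) = sum_list (map edge_sgn ts)"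
    by (induction ts) (auto simp: edge_sgn_def)
  then show ?thesis using forest_sgn[OF assms] by (simp add: vertex_sgn_def)
qed

section \<open>The tree formula for the transferred structure\<close>

context ops
begin

text \<open>
  \<open>\<mu>\<^sub>n\<^sup>S\<close> in terms of labelled words.
\<close>

definition corolla_op :: "'a option list \<Rightarrow> 'a" where
  "corolla_op ys = act A \<gamma> (cor (word ys)) (vals ys)"

lemma act_gext: "act A \<gamma> c xs = gext (scl A) (\<lambda>w. \<gamma> w xs) c"
  by (simp add: act_def gext_def)

lemma gam_lcor:
  assumes "\<nexists>x. ys = [Some x]"
  shows "gam (lcor ys) = corolla_op ys"
proof -
  have "gam (lcor ys) = gext (scl A) (\<lambda>w. top_op \<gamma> A (place (tau A) w (vals ys))) (cor (word ys))"
    by (simp add: labcor_def gext_lext')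
  also have "\<dots> = corolla_op ys"
    unfolding corolla_op_def act_gext
  proof (rule gext_cong)
    fix w assume "w \<in> supp (cor (word ys) :: _ \<Rightarrow>\<^sub>0 'k)"
    then have "corkword w = word ys" by (rule keys_cor)
    then show "top_op \<gamma> A (place (tau A) w (vals ys)) = \<gamma> w (vals ys)"
      using assms word_eq_leaf[of ys] by (intro top_op_place) (auto simp: arity_word)
  qed
  finally show ?thesis .
qed

lemma mu_op_corolla_op: "mu_op A \<gamma> (length ys) (positions id (word ys)) (vals ys) = corolla_op ys"
proof -
  have "corolla (length ys) (positions id (word ys)) = (cor (word ys) :: _ \<Rightarrow>\<^sub>0 'k)"
    using corolla_cor[of "word ys"] by simp
  then show ?thesis by (simp only: mu_op_def corolla_op_def)
qed

text \<open>
  The word with a single label is excluded, since the tree \<open>|\<close> carries no operation.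
\<close>

lemma linear_corolla_op:
  assumes "us \<noteq> [] \<or> vs \<noteq> []"
  shows "Vector_Spaces.linear (scl A) (scl A) (\<lambda>x. corolla_op (us @ Some x # vs))"
proof -
  let ?c = "cor (word us @ False # word vs) :: _ \<Rightarrow>\<^sub>0 'k"
  have l: "Vector_Spaces.linear (scl A) (scl A) (\<lambda>x. \<gamma> w (vals us @ x # vals vs))" if "w \<in> supp ?c" for w
  proof (rule End_op_linear[OF End])
    have cw: "corkword w = word us @ False # word vs" using that by (rule keys_cor)
    show "w \<noteq> Lf ()"
    proof
      assume "w = Lf ()"
      then have "[False] = word us @ False # word vs" using cw by simp
      then have "length [False] = length (word us @ False # word vs)" by (rule arg_cong)
      then show False using assms by auto
    qed
    have "corkword w = word (us @ Some undefined # vs)" using cw by simp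
    from arity_word[OF this] show "length (vals us) + 1 + length (vals vs) = arity w" by simp
  qed
  have add: "\<gamma> w (vals us @ (x + y) # vals vs) = \<gamma> w (vals us @ x # vals vs) + \<gamma> w (vals us @ y # vals vs)"
    and scale: "\<gamma> w (vals us @ scl A r x # vals vs) = scl A r (\<gamma> w (vals us @ x # vals vs))"
    if w: "w \<in> supp ?c" for w x y r
  proof -
    interpret l: Vector_Spaces.linear "scl A" "scl A" "\<lambda>x. \<gamma> w (vals us @ x # vals vs)" by (rule l[OF w])
    show "\<gamma> w (vals us @ (x + y) # vals vs) = \<gamma> w (vals us @ x # vals vs) + \<gamma> w (vals us @ y # vals vs)"
      by (rule l.add)
    show "\<gamma> w (vals us @ scl A r x # vals vs) = scl A r (\<gamma> w (vals us @ x # vals vs))"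
      by (rule l.scale)
  qed
  have "corolla_op (us @ Some x # vs) = (\<Sum>w\<in>supp ?c.
      scl A (coef ?c w) (\<gamma> w (vals us @ x # vals vs)))" for x
    by (simp add: corolla_op_def act_def)
  moreover have "Vector_Spaces.linear (scl A) (scl A) (\<lambda>x. \<Sum>w\<in>supp ?c.
      scl A (coef ?c w) (\<gamma> w (vals us @ x # vals vs)))"
  proof unfold_locales
    show "(\<Sum>w\<in>supp ?c. scl A (coef ?c w) (\<gamma> w (vals us @ (x + y) # vals vs))) =
        (\<Sum>w\<in>supp ?c. scl A (coef ?c w) (\<gamma> w (vals us @ x # vals vs))) +
        (\<Sum>w\<in>supp ?c. scl A (coef ?c w) (\<gamma> w (vals us @ y # vals vs)))" for x y
      unfolding sum.distrib[symmetric] scale_right_distrib[symmetric]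
      by (rule sum.cong[OF refl]) (simp only: add)
    show "(\<Sum>w\<in>supp ?c. scl A (coef ?c w) (\<gamma> w (vals us @ scl A r x # vals vs))) =
        scl A r (\<Sum>w\<in>supp ?c. scl A (coef ?c w) (\<gamma> w (vals us @ x # vals vs)))" for r x
      unfolding scale_sum_right
      by (rule sum.cong[OF refl]) (simp only: scale scale_left_commute)
  qed
  ultimately show ?thesis by presburger
qed

end

text \<open>
  A child of a vertex as a label of the corolla at this vertex; connected corks are not labelled.
\<close>

fun entry :: "(ptree \<Rightarrow> 'v list \<Rightarrow> 'a) \<Rightarrow> ptree \<Rightarrow> 'v option list option \<Rightarrow> 'a option" where
  "entry e t None = None"
| "entry e t (Some b) = Some (e t (vals b))"

context ops
begin

text \<open>
  Multiplying out: the values at the blocks are sums over trees, the result is a sum over forests.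
  The entries \<open>us\<close> are already expanded.
\<close>

lemma corolla_op_expand:
  fixes val :: "'v option list \<Rightarrow> 'a"
  assumes "\<And>b. Some b \<in> set R \<Longrightarrow> val b = (\<Sum>t\<in>ltrees b. scl A ((-1) ^ edge_sgn t) (e t (vals b)))"
    and "length us + length R \<noteq> 1"
  shows "corolla_op (us @ map (map_option val) R) =
    (\<Sum>ts\<in>forests R. scl A ((-1) ^ sum_list (map edge_sgn ts)) (corolla_op (us @ map2 (entry e) ts R)))"
  using assms
proof (induction R arbitrary: us)
  case (Cons r R)
  have inj: "inj_on (\<lambda>(t, ts). t # ts) X" for X :: "(ptree \<times> ptree list) set" by (auto simp: inj_on_def)
  have sums: "(\<Sum>ts\<in>forests (r # R). g ts) = (\<Sum>t | fits t r. \<Sum>ts\<in>forests R. g (t # ts))" for g :: "_ \<Rightarrow> 'a"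
    unfolding forests_Cons by (subst sum.reindex[OF inj]) (simp add: sum.cartesian_product case_prod_unfold)
  have IH: "corolla_op ((us @ [y]) @ map (map_option val) R) =
    (\<Sum>ts\<in>forests R. scl A ((-1) ^ sum_list (map edge_sgn ts)) (corolla_op ((us @ [y]) @ map2 (entry e) ts R)))" for y
    by (rule Cons.IH) (use Cons.prems in auto)
  show ?case
  proof (cases r)
    case None
    have "{t. fits t r} = {Conn}" by (simp add: None)
    then show ?thesis unfolding sums using IH[of None] by (simp add: None edge_sgn_def)
  next
    case (Some b)
    let ?vs = "map (map_option val) R"
    interpret l: Vector_Spaces.linear "scl A" "scl A" "\<lambda>x. corolla_op (us @ Some x # ?vs)"
      by (rule linear_corolla_op) (use Cons.prems(2) in auto)
    have "corolla_op (us @ map (map_option val) (r # R)) =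
        (\<Sum>t\<in>ltrees b. scl A ((-1) ^ edge_sgn t) (corolla_op (us @ Some (e t (vals b)) # ?vs)))"
      using Cons.prems(1)[of b] Some by (simp add: l.sum l.scale)
    also have "\<dots> = (\<Sum>t\<in>ltrees b. \<Sum>ts\<in>forests R. scl A ((-1) ^ sum_list (map edge_sgn (t # ts)))
        (corolla_op (us @ map2 (entry e) (t # ts) (r # R))))"
    proof (rule sum.cong[OF refl])
      fix t
      show "scl A ((-1) ^ edge_sgn t) (corolla_op (us @ Some (e t (vals b)) # ?vs)) =
          (\<Sum>ts\<in>forests R. scl A ((-1) ^ sum_list (map edge_sgn (t # ts))) (corolla_op (us @ map2 (entry e) (t # ts) (r # R))))"
        using IH[of "Some (e t (vals b))"] by (simp add: Some scale_sum_right power_add)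
    qed
    finally show ?thesis unfolding sums by (simp add: Some)
  qed
qed simp

end

context transfer
begin

abbreviation "eop \<equiv> edge_op A \<gamma> V i h"
abbreviation "cop \<equiv> core_op A \<gamma> V i h"

lemma pdegree_sum: "ts \<in> forests Q \<Longrightarrow>
    sum_list (map (pdegree \<circ> fst) (filter (\<lambda>(t, f). t \<noteq> Conn) (zip ts (map g ts)))) = upper_verts Q"
  unfolding forests_def mem_Collect_eq
proof (induction rule: list_all2_induct)
  case (Cons t ts q Q)
  then show ?case
    using fits_Conn[OF Cons.hyps(1)] fits_length[OF Cons.hyps(1)] fits_corks[OF Cons.hyps(1)]
    by (cases q) (auto simp: n_verts_def)
qed simp

text \<open>
  \<open>tensor_apply\<close> distributes the inputs over the children and applies the same signs
  as \<open>shift\<close>.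
\<close>

lemma tensor_apply_entries: "ts \<in> forests Q \<Longrightarrow>
    tensor_apply (tau V) (filter (\<lambda>(t, f). t \<noteq> Conn) (zip ts (map eop ts))) (vals (ucat Q)) =
    vals (map2 (entry eop) ts (shift (tau V) Q))"
  unfolding forests_def mem_Collect_eq
proof (induction rule: list_all2_induct)
  case (Cons t ts q Q)
  have f: "ts \<in> forests Q" using Cons.hyps by (simp add: forests_def)
  show ?case
  proof (cases q)
    case None
    then show ?thesis using Cons by simp
  next
    case (Some b)
    then have t: "t \<noteq> Conn" using fits_Conn[OF Cons.hyps(1)] by simp
    have "pleaves t - pcorks t = length (vals b)"
      using fits_length[OF Cons.hyps(1)] fits_corks[OF Cons.hyps(1)] length_vals[of b] Some by simp
    then show ?thesis
      using Cons.IH t pdegree_sum[OF f, of eop]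
      by (simp add: Some Let_def vals_map_option del: map_map not_None_eq)
  qed
qed simp

lemma word_entries: "ts \<in> forests Q \<Longrightarrow> word (map2 (entry e) ts (shift (tau V) Q)) = map (\<lambda>t. t = Conn) ts"
  unfolding forests_def mem_Collect_eq
proof (induction rule: list_all2_induct)
  case (Cons t ts q Q)
  then show ?case using fits_Conn[OF Cons.hyps(1)] by (cases q) auto
qed simp

lemma core_Node:
  assumes "ts \<in> forests Q"
  shows "cop (Node ts) (vals (ucat Q)) = A.corolla_op (map2 (entry eop) ts (shift (tau V) Q))"
proof -
  let ?E = "map2 (entry eop) ts (shift (tau V) Q)"
  have "length ?E = length ts"
    using assms by (auto simp: forests_def dest: list_all2_lengthD)
  then have "A.corolla_op ?E = mu_op A \<gamma> (length ts) (positions (\<lambda>t. t = Conn) ts) (vals ?E)"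
    using A.mu_op_corolla_op[of ?E] unfolding word_entries[OF assms] positions_map[of "\<lambda>t. t = Conn" ts] by simp
  then show ?thesis
    by (simp only: core_op.simps vertex_op_def tensor_apply_entries[OF assms])
qed

lemma ltrees_relabel [simp]: "ltrees (map (map_option g) b) = ltrees b"
  by (simp add: ltrees_def comp_def)

lemma forests_shift [simp]: "forests (shift \<tau> Q) = forests Q"
proof (induction Q)
  case (Cons q Q)
  then show ?case by (cases q) (simp_all add: forests_Cons)
qed simp

lemma shift_lengths: "Some b \<in> set (shift \<tau> Q) \<Longrightarrow> \<exists>b'. Some b' \<in> set Q \<and> length b' = length b"
proof (induction Q)
  case (Cons q Q)
  show ?case
  proof (cases "Some b \<in> set (shift \<tau> Q)")
    case False
    then obtain b' where "q = Some b'" "b = map (map_option (\<tau> ^^ upper_verts Q)) b'"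
      using Cons.prems by (cases q) auto
    then show ?thesis by (intro exI[of _ b']) simp
  qed (use Cons.IH in auto)
qed simp

text \<open>
  By induction, \<open>f\<close> at each block of a segmentation is a sum over the planar trees
  for this block; grafting these trees on a common root gives the planar trees for the whole word.
\<close>

lemma core_sum:
  "zs \<noteq> [] \<Longrightarrow> \<nexists>x. zs = [Some x] \<Longrightarrow>
    A.gam (lext F' (V.lcor zs)) = (\<Sum>t\<in>ltrees zs. scl A ((-1) ^ ptree_sgn t) (cop t (vals zs)))"
proof (induction zs rule: measure_induct_rule[of length])
  case (less zs)
  let ?S = "segs zs - {[Some zs]}"
  have "A.gam (lext F' (V.lcor zs)) = A.gam (\<Sum>Q\<in>?S. fsc ((-1) ^ seg_sgn Q) (A.lcor (branch Q)))"
    by (rule A.eqv_gam[OF F'_lcor[OF less.prems(1)]])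
  also have "\<dots> = (\<Sum>Q\<in>?S. scl A ((-1) ^ seg_sgn Q) (A.corolla_op (branch Q)))"
    using A.gam_lcor[OF branch_nonleaf] by (simp add: A.ge.sum A.ge.scale)
  finally have main: "A.gam (lext F' (V.lcor zs)) = (\<Sum>Q\<in>?S. scl A ((-1) ^ seg_sgn Q) (A.corolla_op (branch Q)))" .
  consider "zs = [None]" | "2 \<le> length zs"
    using less.prems(1) by (cases rule: labelled_word_cases) (use less.prems(2) in auto)
  then show ?case
  proof cases
    case 1
    have "?S = {[None]}" unfolding 1 segs_single by auto
    then have "A.gam (lext F' (V.lcor zs)) = A.corolla_op [None]"
      unfolding main by (simp add: branch_def)
    also have "\<dots> = mu_op A \<gamma> 1 {1} []"
    proof -
      have "positions id [True] = {1}" by (auto simp: positions_def)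
      then show ?thesis using A.mu_op_corolla_op[of "[None]"] by simp
    qed
    finally show ?thesis by (simp add: 1 ltrees_single)
  next
    case 2
    have edge: "gf (V.lcor b) = (\<Sum>t\<in>ltrees b. scl A ((-1) ^ edge_sgn t) (eop t (vals b)))"
      if "length b < length zs" "b \<noteq> []" for b
    proof (cases "\<exists>x. b = [Some x]")
      case True
      then show ?thesis by (auto simp: ltrees_single edge_sgn_def)
    next
      case False
      have "gf (V.lcor b) = - h (\<Sum>t\<in>ltrees b. scl A ((-1) ^ ptree_sgn t) (cop t (vals b)))"
        using less.IH[OF that] False gf_leafless[OF leafless_labcor, of b "tau V"] by simp
      also have "\<dots> = (\<Sum>t\<in>ltrees b. scl A ((-1) ^ edge_sgn t) (eop t (vals b)))"
        unfolding h.sum sum_negf[symmetric]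
      proof (rule sum.cong[OF refl])
        fix t assume t: "t \<in> ltrees b"
        have "t \<noteq> Leaf" "t \<noteq> Conn" using t False word_eq_leaf[of b] by (auto simp: ltrees_def)
        then show "- h (scl A ((-1) ^ ptree_sgn t) (cop t (vals b))) = scl A ((-1) ^ edge_sgn t) (eop t (vals b))"
          by (cases t) (simp_all add: edge_sgn_def h.scale)
      qed
      finally show ?thesis .
    qed
    have summand: "scl A ((-1) ^ seg_sgn Q) (A.corolla_op (branch Q)) =
        (\<Sum>ts\<in>forests Q. scl A ((-1) ^ ptree_sgn (Node ts)) (cop (Node ts) (vals zs)))" if Q: "Q \<in> ?S" for Q
    proof -
      have ok: "Some [] \<notin> set Q" "ucat Q = zs" using Q by (auto simp: segs_def)
      have "length Q \<noteq> 1"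
      proof
        assume "length Q = 1"
        then obtain q where "Q = [q]" by (cases Q) auto
        then show False using Q 2 by (auto simp: segs_def split: option.splits)
      qed
      then have "A.corolla_op ([] @ map (map_option (\<lambda>b. gf (V.lcor b))) (shift (tau V) Q)) =
          (\<Sum>ts\<in>forests (shift (tau V) Q). scl A ((-1) ^ sum_list (map edge_sgn ts))
            (A.corolla_op ([] @ map2 (entry eop) ts (shift (tau V) Q))))"
      proof (intro A.corolla_op_expand edge)
        fix b assume "Some b \<in> set (shift (tau V) Q)"
        then obtain b' where b': "Some b' \<in> set Q" "length b' = length b" using shift_lengths by blast
        show "length b < length zs" "b \<noteq> []" using segs_shorter[OF Q b'(1)] b'(2) by auto
      qed auto
      then have "A.corolla_op (branch Q) = (\<Sum>ts\<in>forests Q. scl A ((-1) ^ sum_list (map edge_sgn ts)) (cop (Node ts) (vals zs)))"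
        unfolding branch_def using core_Node[of _ Q] ok(2) by simp
      then show ?thesis
        using ptree_sgn_Node[OF _ ok(1)] by (simp add: A.scale_sum_right power_add del: ptree_sgn.simps core_op.simps)
    qed
    show ?thesis
      unfolding main sum_ltrees[OF 2] by (rule sum.cong[OF refl summand])
  qed
qed

lemma root_part_F: "root_part A (lext F u) = gf u"
proof -
  have r: "root_part A = gext (scl A) (\<lambda>t. case t of Lf a \<Rightarrow> a | _ \<Rightarrow> 0)"
    by (simp add: fun_eq_iff root_part_def gext_def)
  have "root_part A (F' t) = 0" for t
  proof (cases t)
    case (Mu s t')
    then show ?thesis by (simp add: r A.gext_MuF)
  qed (simp_all add: r)
  then have "root_part A (F t) = f t" for t
    unfolding F_split[of t] by (simp add: r A.ge.add)
  then show ?thesis by (simp add: r A.gext_lext')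
qed

theorem tree_formulae:
  assumes "1 \<le> n" "S \<subseteq> {1..n}" "(n, S) \<noteq> (1, {})" "length xs = n - card S"
  shows "mu_op V \<gamma>V n S xs = tree_sum A \<gamma> V i h V p n S xs"
    and "component V A F n S xs = - tree_sum A \<gamma> V i h A h n S xs"
proof -
  obtain b where b: "length b = n" "positions id b = S" "corks b = card S"
    using ex_word[OF assms(2)] by blast
  have "card S \<le> n" using card_mono[OF _ assms(2)] by simp
  then obtain zs where zs: "word zs = b" "vals zs = xs"
    using V.ex_labelling[of xs b] b assms(4) by auto
  have "zs \<noteq> []" using b(1) zs(1) assms(1) by auto
  have nonleaf: "\<nexists>x. zs = [Some x]"
  proof
    assume "\<exists>x. zs = [Some x]"
    then have "b = [False]" using zs(1) by auto
    then show False using b assms(3) by (auto simp: positions_def)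
  qed
  have T: "ptrees n S = ltrees zs" using b zs(1) by (intro ptrees_ltrees) auto
  have c: "corolla n S = (cor (word zs) :: _ \<Rightarrow>\<^sub>0 'k)" using corolla_cor[of b] b zs(1) by simp
  let ?\<Phi> = "A.gam (lext F' (V.lcor zs))"
  have \<Phi>: "?\<Phi> = (\<Sum>t\<in>ptrees n S. scl A ((-1) ^ ptree_sgn t) (cop t xs))"
    unfolding T using core_sum[OF \<open>zs \<noteq> []\<close> nonleaf] zs(2) by simp
  have "mu_op V \<gamma>V n S xs = VO.corolla_op zs" unfolding mu_op_def VO.corolla_op_def c zs(2) ..
  also have "\<dots> = p ?\<Phi>" using VO.gam_lcor[OF nonleaf] by (simp add: gam_V)
  also have "\<dots> = tree_sum A \<gamma> V i h V p n S xs" by (simp add: \<Phi> p.sum p.scale tree_sum_def)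
  finally show "mu_op V \<gamma>V n S xs = tree_sum A \<gamma> V i h V p n S xs" .
  have "component V A F n S xs = gf (V.lcor zs)"
    unfolding component_def root_part_F c zs(2)[symmetric] V.tensor_rep_cor ..
  also have "\<dots> = - h ?\<Phi>" by (rule gf_leafless[OF leafless_labcor[OF nonleaf]])
  also have "h ?\<Phi> = tree_sum A \<gamma> V i h A h n S xs" by (simp add: \<Phi> h.sum h.scale tree_sum_def)
  finally show "component V A F n S xs = - tree_sum A \<gamma> V i h A h n S xs" .
qed

lemma component_1: "component V A F 1 {} [x] = i x"
proof -
  have "positions id [False] = {}" by (auto simp: positions_def)
  then have "corolla 1 {} = (cor [False] :: _ \<Rightarrow>\<^sub>0 'k)" using corolla_cor[of "[False]"] by simp
  then show ?thesis unfolding component_def root_part_F by (simp add: tensor_rep_def)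
qed

end

section \<open>The normalised homotopy\<close>

text \<open>
  With \<open>a = q h q\<close> and the projector \<open>q = 1 - i p\<close>, the equations
  \<open>d a + a d = q\<close> and \<open>q a = a = a q\<close> imply \<open>a a d = d a
  a\<close>. Hence \<open>k = a d a\<close> has square \<open>a d (a a d) a = a d d a a a =
  0\<close>, and \<open>d k + k d = d a + a d = q\<close>.
\<close>

lemma normal_homotopy_sdr:
  assumes "chain_complex A" "chain_complex V" "strong_deformation_retract A V i p h"
  defines "k \<equiv> normal_homotopy A i p h"
  shows "strong_deformation_retract A V i p k" "k (i v) = 0" "k (k x) = 0"
proof -
  interpret A: complex A by unfold_locales fact
  interpret V: complex V by unfold_locales fact
  have deg: "degree_map V A 0 i" "degree_map A V 0 p" "degree_map A A 1 h"
    and id: "i (dif V v) = dif A (i v)" and pd: "p (dif A x) = dif V (p x)"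
    and p_i: "p (i v) = v" and hom: "dif A (h x) + h (dif A x) = x - i (p x)" for x v
    using assms(3) by (simp_all add: strong_deformation_retract_def chain_map_def)
  interpret i: Vector_Spaces.linear "scl V" "scl A" i using deg by (simp add: degree_map_def linear_map_def)
  interpret p: Vector_Spaces.linear "scl A" "scl V" p using deg by (simp add: degree_map_def linear_map_def)
  interpret h: Vector_Spaces.linear "scl A" "scl A" h using deg by (simp add: degree_map_def linear_map_def)
  define d where "d = dif A"
  define q where "q x = x - i (p x)" for x
  define a where "a x = q (h (q x))" for x
  have k: "k x = a (d (a x))" for x
    by (simp add: k_def normal_homotopy_def a_def q_def d_def Let_def)
  have q_add: "q (x + y) = q x + q y" and q_diff: "q (x - y) = q x - q y" and q_scl: "q (scl A c x) = scl A c (q x)" for x y c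
    by (simp_all add: q_def p.add i.add p.diff i.diff p.scale i.scale A.scale_right_diff_distrib)
  have a_add: "a (x + y) = a x + a y" and a_diff: "a (x - y) = a x - a y" and a_scl: "a (scl A c x) = scl A c (a x)" for x y c
    by (simp_all add: a_def q_add h.add q_diff h.diff q_scl h.scale)
  have a0: "a 0 = 0" using a_diff[of 0 0] by simp
  have d_add: "d (x + y) = d x + d y" and d_diff: "d (x - y) = d x - d y" and d_scl: "d (scl A c x) = scl A c (d x)"
    and dd: "d (d x) = 0" and d0: "d 0 = 0" for x y c
    by (simp_all add: d_def A.df.add A.df.diff A.df.scale A.df.zero)
  have qq: "q (q x) = q x" for x by (simp add: q_def p.diff i.diff p_i)
  have qd: "q (d x) = d (q x)" for x by (simp add: q_def d_def A.df.diff pd id)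
  have qi: "q (i v) = 0" for v by (simp add: q_def p_i)
  have qa: "q (a x) = a x" and aq: "a (q x) = a x" for x by (simp_all add: a_def qq)
  have da: "d (a x) = q x - a (d x)" for x
  proof -
    have "d (a x) + a (d x) = q (d (h (q x)) + h (d (q x)))"
      by (simp add: a_def qd[symmetric] q_add)
    also have "\<dots> = q x" using hom[of "q x"] by (simp add: d_def[symmetric] qq q_def[symmetric])
    finally show ?thesis by (simp add: eq_diff_eq)
  qed
  show ki: "k (i v) = 0" for v
  proof -
    have "a (i v) = 0" using aq[of "i v"] by (simp add: qi a0)
    then show ?thesis by (simp add: k a0 d0)
  qed
  have ad: "a (d x) = q x - d (a x)" for x using da[of x] by simp
  have aad: "a (a (d x)) = d (a (a x))" for x
    by (simp add: ad a_diff aq qa)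
  show "k (k x) = 0"
  proof -
    have "k (k x) = a (d (a (a (d (a x)))))" by (simp add: k)
    also have "\<dots> = a (d (d (a (a (a x)))))" by (simp only: aad)
    finally show ?thesis by (simp add: dd a0)
  qed
  have hd: "d (k x) + k (d x) = q x" for x
  proof -
    have "d (k x) = d (a x)" using da[of "d (a x)"] by (simp add: k dd a0 qd qa)
    moreover have "k (d x) = a (d x)" using da[of "d x"] by (simp add: k dd a0 a_diff aq)
    ultimately show ?thesis using da[of x] by simp
  qed
  have degk: "degree_map A A 1 k"
    unfolding degree_map_def linear_map_def
  proof (intro conjI allI)
    show "Vector_Spaces.linear (scl A) (scl A) k"
      by unfold_locales (simp_all add: k a_add d_add a_scl d_scl)
    have q_proj: "proj A n (q x) = q (proj A n x)" for n x
      using deg(1,2) unfolding degree_map_def by (simp add: q_def A.pr.diff)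
    have h_proj: "proj A (n + 1) (h x) = h (proj A n x)" for n x
      using deg(3) by (simp add: degree_map_def)
    have a_proj: "proj A (n + 1) (a x) = a (proj A n x)" for n x
      by (simp add: a_def q_proj h_proj)
    have d_proj: "proj A n (d x) = d (proj A (n + 1) x)" for n x
      using A.degree_dif unfolding degree_map_def d_def by (metis add.assoc add.right_neutral add.right_inverse)
    show "proj A (n + 1) (k x) = k (proj A n x)" for n x
      by (simp add: k a_proj d_proj)
  qed
  show "strong_deformation_retract A V i p k"
    using assms(3) degk hd unfolding strong_deformation_retract_def by (simp add: d_def q_def)
qed

theorem theorem1p3p2:
  fixes A :: "('k::field_char_0, 'a::ab_group_add) cplx"
    and V :: "('k, 'v::ab_group_add) cplx"
    and \<gamma>A :: "unit tree \<Rightarrow> 'a list \<Rightarrow> 'a"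
    and i :: "'v \<Rightarrow> 'a" and p :: "'a \<Rightarrow> 'v" and h :: "'a \<Rightarrow> 'a"
  assumes "uA_infinity_algebra A \<gamma>A"
    and "chain_complex V"
    and "strong_deformation_retract A V i p h"
  shows "\<forall>k. k = normal_homotopy A i p h \<or>
             (k = h \<and> (\<forall>x. h (i x) = 0) \<and> (\<forall>x. h (h x) = 0)) \<longrightarrow>
     (\<exists>\<gamma>V F. uA_infinity_algebra V \<gamma>V \<and>
        infinity_morphism V \<gamma>V A \<gamma>A F \<and>
        (\<forall>x. component V A F 1 {} [x] = i x) \<and>
        (\<forall>n S xs. 1 \<le> n \<and> S \<subseteq> {1..n} \<and> (n, S) \<noteq> (1, {}) \<and> length xs = n - card S \<longrightarrow>
           mu_op V \<gamma>V n S xs = tree_sum A \<gamma>A V i k V p n S xs \<and>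
           component V A F n S xs = - tree_sum A \<gamma>A V i k A k n S xs))"
proof (intro allI impI)
  fix k assume k: "k = normal_homotopy A i p h \<or>
             (k = h \<and> (\<forall>x. h (i x) = 0) \<and> (\<forall>x. h (h x) = 0))"
  have ops: "ops A \<gamma>A" using assms(1) by (simp add: uA_infinity_algebra_iff)
  then have cA: "chain_complex A" by (simp add: ops_def complex_def)
  have sdr: "strong_deformation_retract A V i p k" "\<And>x. k (i x) = 0" "\<And>x. k (k x) = 0"
    using k normal_homotopy_sdr[OF cA assms(2,3)] assms(3) by auto
  interpret transfer A \<gamma>A V i p k
    using ops assms(1,2) sdr by (simp add: transfer_def transfer_axioms_def complex_def)
  show "\<exists>\<gamma>V F. uA_infinity_algebra V \<gamma>V \<and>
        infinity_morphism V \<gamma>V A \<gamma>A F \<and>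
        (\<forall>x. component V A F 1 {} [x] = i x) \<and>
        (\<forall>n S xs. 1 \<le> n \<and> S \<subseteq> {1..n} \<and> (n, S) \<noteq> (1, {}) \<and> length xs = n - card S \<longrightarrow>
           mu_op V \<gamma>V n S xs = tree_sum A \<gamma>A V i k V p n S xs \<and>
           component V A F n S xs = - tree_sum A \<gamma>A V i k A k n S xs)"
    using V_algebra F_infinity_morphism component_1 tree_formulae by blast
qed

end
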